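(* Let $G$ be a connected partial $3$-tree with $n$ vertices. Then $\mathrm{pn}(G)\le \lfloor n/2\rfloor$, or $G$ is isomorphic to $K_3$ or to $K_5^-$.
   Context: All graphs are finite and simple. A path decomposition of a graph $G$ is a set of pairwise edge-disjoint paths of $G$ that together cover $E(G)$; $\mathrm{pn}(G)$ is the minimum size of a path decomposition of $G$ (it is $0$ if $G$ has no edges). $K_5^-$ is the graph obtained from $K_5$ by removing exactly one edge. For a positive integer $k$, a graph $G$ is a $k$-tree if either $G\simeq K_k$, or $G$ contains a vertex $v$ such that the subgraph induced by the neighborhood $N(v)$ is isomorphic to $K_k$ and $G-v$ is a $k$-tree. A partial $k$-tree is a subgraph of a $k$-tree. (Partial $k$-trees are exactly the graphs with treewidth at most $k$.) *)

theory Defs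
  imports Main
begin

datatype 'a ugraph = UGraph (uverts: "'a set") (uedges: "'a set set")

definition simple_graph :: "'a ugraph \<Rightarrow> bool" where
  "simple_graph G \<longleftrightarrow> finite (uverts G) \<and> (\<forall>e\<in>uedges G. e \<subseteq> uverts G \<and> card e = 2)"

definition subgraph :: "'a ugraph \<Rightarrow> 'a ugraph \<Rightarrow> bool" where
  "subgraph H G \<longleftrightarrow> simple_graph H \<and> uverts H \<subseteq> uverts G \<and> uedges H \<subseteq> uedges G"

definition graph_iso :: "'a ugraph \<Rightarrow> 'b ugraph \<Rightarrow> bool" where
  "graph_iso G H \<longleftrightarrow>
     (\<exists>f. bij_betw f (uverts G) (uverts H) \<and> uedges H = (\<lambda>e. f ` e) ` uedges G)"

definition neighborhood :: "'a ugraph \<Rightarrow> 'a \<Rightarrow> 'a set" where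
  "neighborhood G v = {u \<in> uverts G. {u, v} \<in> uedges G \<and> u \<noteq> v}"

definition induced_subgraph :: "'a ugraph \<Rightarrow> 'a set \<Rightarrow> 'a ugraph" where
  "induced_subgraph G S = UGraph (uverts G \<inter> S) {e \<in> uedges G. e \<subseteq> S}"

definition delete_vertex :: "'a ugraph \<Rightarrow> 'a \<Rightarrow> 'a ugraph" where
  "delete_vertex G v = induced_subgraph G (uverts G - {v})"

definition connected_graph :: "'a ugraph \<Rightarrow> bool" where
  "connected_graph G \<longleftrightarrow> uverts G \<noteq> {} \<and>
     (\<forall>u\<in>uverts G. \<forall>v\<in>uverts G. (\<lambda>x y. {x, y} \<in> uedges G)\<^sup>*\<^sup>* u v)"

definition complete_graph :: "nat \<Rightarrow> nat ugraph" where
  "complete_graph n = UGraph {..<n} {{i, j} | i j. i < n \<and> j < n \<and> i \<noteq> j}"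

text \<open>All edges of \<open>K\<^sub>5\<close> are equivalent under automorphisms, so the choice of the removed edge
  is immaterial up to isomorphism.\<close>

definition K5_minus :: "nat ugraph" where
  "K5_minus = UGraph (uverts (complete_graph 5)) (uedges (complete_graph 5) - {{0, 1}})"

inductive k_tree :: "nat \<Rightarrow> 'a ugraph \<Rightarrow> bool" for k :: nat where
  complete: "0 < k \<Longrightarrow> simple_graph G \<Longrightarrow> graph_iso G (complete_graph k) \<Longrightarrow> k_tree k G"
| extend: "simple_graph G \<Longrightarrow> v \<in> uverts G \<Longrightarrow>
     graph_iso (induced_subgraph G (neighborhood G v)) (complete_graph k) \<Longrightarrow>
     k_tree k (delete_vertex G v) \<Longrightarrow> k_tree k G"

text \<open>The surrounding \<open>k\<close>-tree may need more vertices than the type \<open>'a\<close> has elements. It is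
  therefore taken over \<open>nat\<close>, where every finite graph has an isomorphic copy, and
  ``is a subgraph of'' is read up to isomorphism.\<close>

definition partial_k_tree :: "nat \<Rightarrow> 'a ugraph \<Rightarrow> bool" where
  "partial_k_tree k G \<longleftrightarrow>
     (\<exists>(T :: nat ugraph) H. k_tree k T \<and> subgraph H T \<and> graph_iso G H)"

definition is_path :: "'a ugraph \<Rightarrow> bool" where
  "is_path P \<longleftrightarrow> (\<exists>xs. xs \<noteq> [] \<and> distinct xs \<and> uverts P = set xs \<and>
     uedges P = {{xs ! i, xs ! Suc i} | i. Suc i < length xs})"

text \<open>Paths with a single vertex are admitted; they cover no edge and do not affect the minimum.\<close>

definition path_decomposition :: "'a ugraph \<Rightarrow> 'a ugraph set \<Rightarrow> bool" where
  "path_decomposition G D \<longleftrightarrow> finite D \<and>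
     (\<forall>P\<in>D. is_path P \<and> subgraph P G) \<and>
     pairwise (\<lambda>P Q. disjnt (uedges P) (uedges Q)) D \<and>
     (\<Union>P\<in>D. uedges P) = uedges G"

definition pn :: "'a ugraph \<Rightarrow> nat" where
  "pn G = (LEAST m. \<exists>D. path_decomposition G D \<and> card D = m)"

text \<open>The minimum is taken over a nonempty set: the single edges form a path decomposition.\<close>

lemma path_decomposition_exists:
  assumes G: "simple_graph G"
  shows "\<exists>D. path_decomposition G D"
proof
  let ?D = "(\<lambda>e. UGraph e {e}) ` uedges G"
  have "finite (uedges G)"
    using G unfolding simple_graph_def by (meson PowI finite_Pow_iff finite_subset subsetI)
  moreover have "is_path (UGraph e {e}) \<and> subgraph (UGraph e {e}) G" if e: "e \<in> uedges G" for e
  proof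
    have "card e = 2" "e \<subseteq> uverts G"
      using G e by (auto simp: simple_graph_def)
    then obtain x y where "e = {x, y}" "x \<noteq> y"
      by (meson card_2_iff)
    then show "is_path (UGraph e {e})"
      unfolding is_path_def by (intro exI[of _ "[x, y]"]) auto
    show "subgraph (UGraph e {e}) G"
      using \<open>card e = 2\<close> \<open>e \<subseteq> uverts G\<close> e
      by (auto simp: subgraph_def simple_graph_def intro: card_ge_0_finite)
  qed
  ultimately show "path_decomposition G ?D"
    by (auto simp: path_decomposition_def pairwise_def disjnt_def)
qed

end

theory Submission
  imports Defs "HOL-Library.Multiset"
begin

text \<open>Let \<open>G\<close> be a counterexample with as few vertices as possible. A reduction removes two vertices
  \<open>v\<close>, \<open>w\<close> (one vertex, if \<open>n\<close> is even) and deletes or adds a few edges between their neighbours, so that the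
  smaller graph stays connected and every path decomposition of it extends to \<open>G\<close> with one more path.
  To extend, either the added edges are subdivided by \<open>v\<close> and \<open>w\<close> and one path is added, or one path is
  cut at a vertex or edge and its pieces are recombined with the missing edges into two paths; the
  latter works for every order in which the path visits the neighbours. If the smaller graph is
  itself \<open>K\<^sub>3\<close> or \<open>K\<^sub>5\<^sup>-\<close>, then \<open>G\<close> has at most seven vertices and a decomposition is given explicitly.

  Gluing two decompositions at a cut vertex, after forcing paths to end there, shows that a cut vertex only separates
  pendant vertices. The added edges must belong to a fixed 3-tree containing \<open>G\<close>. For even \<open>n\<close>, every
  vertex that is simplicial in this 3-tree admits a reduction. For odd \<open>n\<close>, delete the
  pendant vertices, then a maximal independent set of simplicial vertices, and choose a simplicial vertex \<open>u\<close> of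
  what remains: \<open>u\<close> and its remaining neighbours form a clique of at most four vertices that contains
  all neighbours of the deleted vertices next to \<open>u\<close>. Two of these, or one of them and \<open>u\<close>, admit a reduction.\<close>

section \<open>Path decompositions of edge sets\<close>

text \<open>For odd \<open>n\<close> one vertex less leaves \<open>n div 2\<close> unchanged and
  pays for no path, so vertices go in pairs; for even \<open>n\<close> a single vertex pays. The
  exceptional graphs have odd order \<open>k\<close> and get \<open>(k + 1) div 2\<close> paths, one
  above the bound. Over them a further path is too expensive: the enlarged graph must be decomposed
  with as many paths as the exceptional one, hence the tables for orders 3 and 5. Recombination can
  be checked by evaluation since only the order matters in which a path meets at most four labelled
  vertices; the stretches in between are moved and reversed as symbols. Chordality is demanded of an
  auxiliary edge set \<open>T\<close> only, which stays fixed while \<open>E\<close> changes, so an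
  added edge of \<open>T\<close> costs nothing. \<open>T\<close> itself is altered at one place,
  where suppressing a vertex of degree two calls for an edge that \<open>T\<close> need not contain.
  The obstacle in most cases is connectedness after deleting edges. It rests on the cut vertex
  result and on earlier reductions having been excluded, which fixes the order of the
  lemmas.\<close>

fun el :: "'a list \<Rightarrow> 'a set list" where
  "el (x # y # r) = {x, y} # el (y # r)"
| "el _ = []"

lemma el_Cons: "el (x # p) = (if p = [] then [] else {x, hd p} # el p)"
  by (cases p) auto

lemma el_append: "el (xs @ a # ys) = el (xs @ [a]) @ el (a # ys)"
  by (induction xs) (auto simp: el_Cons hd_append)

lemma mset_el_rev: "mset (el (rev p)) = mset (el p)"
proof (induction p)
  case (Cons x p)
  then show ?case
    by (cases p) (auto simp: el_append[of _ _ "[_]"] insert_commute)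
qed simp

lemma el_subset: "e \<in> set (el p) \<Longrightarrow> e \<subseteq> set p"
  by (induction p rule: el.induct) auto

lemma Union_el: "Suc 0 < length p \<Longrightarrow> \<Union> (set (el p)) = set p"
proof (induction p rule: el.induct)
  case (1 x y r)
  then show ?case by (cases r) auto
qed auto

lemma el_split: "e \<in> set (el p) \<Longrightarrow> \<exists>a b p1 p2. p = p1 @ [a, b] @ p2 \<and> e = {a, b}"
proof (induction p rule: el.induct)
  case (1 x y r)
  show ?case
  proof (cases "e = {x, y}")
    case True
    then have "x # y # r = [] @ [x, y] @ r \<and> e = {x, y}" by simp
    then show ?thesis by blast
  next
    case False
    with 1 obtain a b p1 p2 where "y # r = p1 @ [a, b] @ p2" "e = {a, b}" by auto
    then have "x # y # r = (x # p1) @ [a, b] @ p2 \<and> e = {a, b}" by simp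
    then show ?thesis by blast
  qed
qed auto

text \<open>All multiplicities in \<open>mset_set E\<close> are one, so a single equation expresses
  that the paths are edge-disjoint and that they cover. Cutting, gluing and exchanging paths then
  becomes addition of multisets.\<close>

definition decm :: "'a list list \<Rightarrow> 'a set multiset \<Rightarrow> bool" where
  "decm ps M \<longleftrightarrow> (\<forall>p\<in>set ps. distinct p) \<and> (\<Sum>p\<leftarrow>ps. mset (el p)) = M"

text \<open>Trivial paths carry no edge, so the vertex set plays no role; infinite \<open>E\<close> is excluded because
  \<open>mset_set\<close> is empty there.\<close>

definition pnle :: "'a set set \<Rightarrow> nat \<Rightarrow> bool" where
  "pnle E m \<longleftrightarrow> (\<exists>ps. length ps \<le> m \<and> finite E \<and> decm ps (mset_set E))"

lemma pnleI: "finite E \<Longrightarrow> decm ps (mset_set E) \<Longrightarrow> length ps \<le> m \<Longrightarrow> pnle E m"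
  unfolding pnle_def by auto

lemma pnle_mono: "pnle E m \<Longrightarrow> m \<le> k \<Longrightarrow> pnle E k"
  unfolding pnle_def by (meson le_trans)

lemma decm_in:
  assumes "decm ps M" "e \<in># M"
  obtains p R where "decm (p # R) M" "length ps = Suc (length R)" "e \<in> set (el p)" "set (p # R) = set ps"
proof -
  have "e \<in># (\<Sum>p\<leftarrow>ps. mset (el p))" using assms by (simp add: decm_def)
  then obtain p where p: "p \<in> set ps" "e \<in> set (el p)"
    by (induction ps) auto
  then obtain xs ys where "ps = xs @ p # ys" by (meson split_list)
  then show ?thesis
    using that[of p "xs @ ys"] assms p by (auto simp: decm_def ac_simps)
qed

lemma decm_rev: "decm (p # R) M \<Longrightarrow> decm (rev p # R) M"
  by (simp add: decm_def mset_el_rev)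

section \<open>Recombining the pieces of a path\<close>

text \<open>Tokens describe a path symbolically: a named vertex, a segment, or a reversed segment.\<close>

datatype tok = Pt nat | Fw nat | Bw nat

primrec sem :: "(nat \<Rightarrow> 'a) \<Rightarrow> (nat \<Rightarrow> 'a list) \<Rightarrow> tok \<Rightarrow> 'a list" where
  "sem f g (Pt i) = [f i]"
| "sem f g (Fw i) = g i"
| "sem f g (Bw i) = rev (g i)"

definition sems :: "(nat \<Rightarrow> 'a) \<Rightarrow> (nat \<Rightarrow> 'a list) \<Rightarrow> tok list \<Rightarrow> 'a list" where
  "sems f g ts = concat (map (sem f g) ts)"

lemma sems_simps [simp]:
  "sems f g [] = []" "sems f g (t # ts) = sem f g t @ sems f g ts"
  "sems f g (ts @ us) = sems f g ts @ sems f g us"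
  by (auto simp: sems_def)

lemma sems_P [simp]: "sems f g (map Pt p) = map f p"
  by (induction p) auto

text \<open>A named vertex ends one piece and starts the next, so each edge of the path lies in
  exactly one piece. Pieces are what survives when a path is taken apart and reassembled.\<close>

fun chunks :: "tok list \<Rightarrow> tok list list" where
  "chunks [] = []"
| "chunks [Pt j] = []"
| "chunks (a # Pt j # r) = [a, Pt j] # chunks (Pt j # r)"
| "chunks (a # b # Pt k # r) = [a, b, Pt k] # chunks (Pt k # r)"
| "chunks ts = [ts]"

primrec flip :: "tok \<Rightarrow> tok" where
  "flip (Pt i) = Pt i" | "flip (Fw i) = Bw i" | "flip (Bw i) = Fw i"

definition revt :: "tok list \<Rightarrow> tok list" where
  "revt ts = rev (map flip ts)"

lemma sem_flip: "sem f g (flip t) = rev (sem f g t)"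
  by (cases t) auto

lemma sems_revt: "sems f g (revt ts) = rev (sems f g ts)"
  by (induction ts) (auto simp: revt_def sem_flip)

definition selm :: "(nat \<Rightarrow> 'a) \<Rightarrow> (nat \<Rightarrow> 'a list) \<Rightarrow> tok list list \<Rightarrow> 'a set multiset" where
  "selm f g cs = (\<Sum>c\<leftarrow>cs. mset (el (sems f g c)))"

lemma selm_simps [simp]:
  "selm f g [] = {#}" "selm f g (c # cs) = mset (el (sems f g c)) + selm f g cs"
  "selm f g (cs @ ds) = selm f g cs + selm f g ds"
  by (auto simp: selm_def)

lemma el_chunks: "mset (el (sems f g ts)) = selm f g (chunks ts)"
proof (induction ts rule: chunks.induct)
  case (3 a j r)
  then show ?case
    by (simp add: el_append[of "sem f g a" "f j" "sems f g r"])
next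
  case ("4_1" a b k r)
  then show ?case
    using el_append[of "sem f g a @ g b" "f k" "sems f g r"] by simp
next
  case ("4_2" a b k r)
  then show ?case
    using el_append[of "sem f g a @ rev (g b)" "f k" "sems f g r"] by simp
qed auto

text \<open>Equality of multisets of pieces up to reversal of single pieces. Being a comparison of
  symbols, it is valid for every interpretation of the segments, in particular for empty ones, and
  can be evaluated once and for all.\<close>

fun same_edges :: "tok list list \<Rightarrow> tok list list \<Rightarrow> bool" where
  "same_edges [] ys \<longleftrightarrow> ys = []"
| "same_edges (x # xs) ys \<longleftrightarrow>
     (if x \<in> set ys then same_edges xs (remove1 x ys)
      else revt x \<in> set ys \<and> same_edges xs (remove1 (revt x) ys))"

lemma selm_remove1:
  "x \<in> set ys \<Longrightarrow> selm f g ys = mset (el (sems f g x)) + selm f g (remove1 x ys)"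
  by (induction ys) (auto simp: ac_simps)

lemma same_edges_selm: "same_edges xs ys \<Longrightarrow> selm f g xs = selm f g ys"
proof (induction xs ys rule: same_edges.induct)
  case (2 x xs ys)
  show ?case
  proof (cases "x \<in> set ys")
    case True
    with 2 show ?thesis using selm_remove1[OF True, of f g] by simp
  next
    case False
    with 2 have r: "revt x \<in> set ys" by simp
    with 2 False show ?thesis
      using selm_remove1[OF r, of f g] by (simp add: sems_revt mset_el_rev)
  qed
qed auto

primrec base :: "tok \<Rightarrow> tok" where
  "base (Pt i) = Pt i" | "base (Fw i) = Fw i" | "base (Bw i) = Fw i"

lemma set_sem_base [simp]: "set (sem f g (base t)) = set (sem f g t)"
  "distinct (sem f g (base t)) = distinct (sem f g t)"
  by (cases t; simp)+

text \<open>A segment and its reverse have the same vertices. Hence any selection of symbols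
  inherits distinctness from one reference list \<open>us\<close> in which every symbol occurs once,
  in forward direction.\<close>

lemma distinct_sems:
  assumes U: "distinct (sems f g us)" "distinct us"
    and A: "distinct (map base as)" "base ` set as \<subseteq> set us"
  shows "distinct (sems f g as)"
proof -
  have dj: "set (sem f g s) \<inter> set (sem f g t) = {}" if "s \<in> set us" "t \<in> set us" "s \<noteq> t" for s t
    using U that
  proof (induction us)
    case (Cons u us)
    have "set (sem f g r) \<subseteq> set (sems f g us)" if "r \<in> set us" for r
      using that by (auto simp: sems_def)
    with Cons show ?case by (auto simp: disjoint_iff)
  qed simp
  have dt: "distinct (sem f g s)" if "s \<in> set us" for s
    using U that by (induction us) auto
  show ?thesis using A
  proof (induction "as")
    case (Cons a "as")
    have "set (sem f g a) \<inter> set (sem f g b) = {}" if "b \<in> set as" for b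
    proof -
      have "base a \<noteq> base b" using Cons.prems that by auto
      then show ?thesis using dj[of "base a" "base b"] Cons.prems that by auto
    qed
    moreover have "distinct (sem f g a)" using dt[of "base a"] Cons.prems by auto
    ultimately show ?case using Cons by (auto simp: sems_def)
  qed simp
qed

text \<open>The vertices named in \<open>qs\<close> cut a path into segments; \<open>mk k qs\<close> is the resulting token list
  with segments numbered from \<open>k\<close>.\<close>

primrec mk :: "nat \<Rightarrow> nat list \<Rightarrow> tok list" where
  "mk k [] = [Fw k]"
| "mk k (q # qs) = Fw k # Pt q # mk (Suc k) qs"

lemma sems_mk_cong:
  "(\<And>i. k \<le> i \<Longrightarrow> i \<le> k + length qs \<Longrightarrow> g i = h i) \<Longrightarrow> sems f g (mk k qs) = sems f h (mk k qs)"
proof (induction qs arbitrary: k)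
  case (Cons q qs)
  have "sems f g (mk (Suc k) qs) = sems f h (mk (Suc k) qs)"
    by (rule Cons.IH) (use Cons.prems in auto)
  with Cons.prems[of k] show ?case by simp
qed simp

text \<open>Scanning from the right, a labelled vertex opens a new segment, and any other vertex is
  put in front of the first segment. Since segments may be empty, every list has a trace, whichever
  labelled vertices it meets.\<close>

lemma trace_exists:
  "\<exists>qs g. set qs \<subseteq> S \<and> (\<forall>i\<in>S. f i \<in> set L \<longrightarrow> i \<in> set qs) \<and> sems f g (mk k qs) = L"
  if "inj_on f S"
proof (induction L arbitrary: k)
  case Nil
  show ?case by (rule exI[of _ "[]"], rule exI[of _ "\<lambda>_. []"]) simp
next
  case (Cons x L)
  show ?case
  proof (cases "x \<in> f ` S")
    case True
    then obtain i where i: "i \<in> S" "x = f i" by auto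
    obtain qs g where q: "set qs \<subseteq> S" "\<forall>i\<in>S. f i \<in> set L \<longrightarrow> i \<in> set qs"
      "sems f g (mk (Suc k) qs) = L" using Cons by blast
    have "sems f (g(k := [])) (mk (Suc k) qs) = sems f g (mk (Suc k) qs)"
      by (rule sems_mk_cong) auto
    then have "sems f (g(k := [])) (mk k (i # qs)) = x # L" using q i by simp
    then show ?thesis using q i that
      by (intro exI[of _ "i # qs"] exI[of _ "g(k := [])"]) (auto dest: inj_onD simp del: fun_upd_apply)
  next
    case False
    obtain qs g where q: "set qs \<subseteq> S" "\<forall>i\<in>S. f i \<in> set L \<longrightarrow> i \<in> set qs"
      "sems f g (mk k qs) = L" using Cons by blast
    have "sems f (g(k := x # g k)) (mk k qs) = x # L"
    proof (cases qs)
      case Nil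
      then show ?thesis using q by simp
    next
      case (Cons a as)
      have "sems f (g(k := x # g k)) (mk (Suc k) as) = sems f g (mk (Suc k) as)"
        by (rule sems_mk_cong) auto
      then show ?thesis using q Cons by simp
    qed
    then show ?thesis using q False
      by (intro exI[of _ "qs"] exI[of _ "g(k := x # g k)"]) (auto simp del: fun_upd_apply)
  qed
qed

lemma set_mk: "set (map f qs) \<subseteq> set (sems f g (mk k qs))"
  by (induction qs arbitrary: k) auto

lemma distinct_mk: "distinct (sems f g (mk k qs)) \<Longrightarrow> distinct qs"
proof (induction qs arbitrary: k)
  case (Cons q qs)
  then show ?case using set_mk[of f qs g "Suc k"] by (auto simp: image_iff)
qed simp


lemma mk_snoc: "mk k (qs @ [q]) = mk k qs @ [Pt q, Fw (Suc (k + length qs))]"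
  by (induction qs arbitrary: k) auto

text \<open>Allows the tables to list only one of two opposite traces when the path is cut at a
  vertex.\<close>

lemma sems_mk_rev: "\<exists>h. sems f h (mk k' (rev qs)) = rev (sems f g (mk k qs))"
proof (induction qs arbitrary: k)
  case Nil
  show ?case by (rule exI[of _ "\<lambda>_. rev (g k)"]) simp
next
  case (Cons q qs)
  then obtain h where h: "sems f h (mk k' (rev qs)) = rev (sems f g (mk (Suc k) qs))" by blast
  let ?h = "h(Suc (k' + length qs) := rev (g k))"
  have "sems f ?h (mk k' (rev qs)) = sems f h (mk k' (rev qs))"
    by (rule sems_mk_cong) auto
  with h have "sems f ?h (mk k' (rev (q # qs))) = rev (sems f g (mk k (q # qs)))"
    by (simp add: mk_snoc)
  then show ?case by blast
qed

section \<open>Exchanging added edges for removed edges\<close>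

definition im :: "(nat \<Rightarrow> 'a) \<Rightarrow> (nat \<times> nat) list \<Rightarrow> 'a set set" where
  "im f es = (\<lambda>(i, j). {f i, f j}) ` set es"

definition ends :: "(nat \<times> nat) list \<Rightarrow> nat set" where
  "ends es = fst ` set es \<union> snd ` set es"

definition tedge :: "nat \<times> nat \<Rightarrow> tok list" where
  "tedge e = [Pt (fst e), Pt (snd e)]"

text \<open>Fixing the orientation of each pair makes the passage from label pairs to edges
  injective, as soon as the labelling is.\<close>

definition sorted_pairs :: "(nat \<times> nat) list \<Rightarrow> bool" where
  "sorted_pairs es \<longleftrightarrow> distinct es \<and> (\<forall>(i, j)\<in>set es. i < j)"

lemma mset_im:
  assumes "sorted_pairs es" "inj_on f (ends es)"
  shows "mset_set (im f es) = selm f g (map tedge es)"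
proof -
  have "inj_on (\<lambda>(i, j). {f i, f j}) (set es)"
  proof (rule inj_onI, clarify)
    fix i j k l assume a: "(i, j) \<in> set es" "(k, l) \<in> set es" "{f i, f j} = {f k, f l}"
    then have "{i, j, k, l} \<subseteq> ends es"
      unfolding ends_def by (metis Un_iff fst_conv image_eqI insert_subset empty_subsetI snd_conv)
    then have "f i = f k \<longleftrightarrow> i = k" "f j = f l \<longleftrightarrow> j = l" "f i = f l \<longleftrightarrow> i = l" "f j = f k \<longleftrightarrow> j = k"
      using inj_on_eq_iff[OF assms(2)] by auto
    moreover have "i < j" "k < l" using a assms(1) by (auto simp: sorted_pairs_def)
    ultimately show "i = k \<and> j = l" using a(3) by (simp add: doubleton_eq_iff) linarith
  qed
  then have "mset_set (im f es) = image_mset (\<lambda>(i, j). {f i, f j}) (mset_set (set es))"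
    unfolding im_def by (rule image_mset_mset_set[symmetric])
  also have "mset_set (set es) = mset es"
    using assms(1) by (simp add: sorted_pairs_def mset_set_set)
  also have "image_mset (\<lambda>(i, j). {f i, f j}) (mset es) = selm f g (map tedge es)"
    by (induction es) (auto simp: tedge_def)
  finally show ?thesis .
qed

text \<open>The labels \<open>ws\<close> name the vertices that are added back, all other labels name old vertices.\<close>

definition ext :: "nat list \<Rightarrow> (nat \<Rightarrow> 'a) \<Rightarrow> (nat \<times> nat) list \<Rightarrow> (nat \<times> nat) list \<Rightarrow> 'a set set \<Rightarrow> bool" where
  "ext ws f J N E' \<longleftrightarrow> (\<forall>m. im f J \<subseteq> E' \<longrightarrow> im f N \<inter> E' = {} \<longrightarrow> f ` set ws \<inter> \<Union> E' = {} \<longrightarrow>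
     pnle E' m \<longrightarrow> pnle ((E' - im f J) \<union> im f N) (Suc m))"

lemma mset_swap:
  assumes "finite E'" "im f J \<subseteq> E'" "im f N \<inter> E' = {}"
    "sorted_pairs J" "sorted_pairs N" "inj_on f (ends J)" "inj_on f (ends N)"
  shows "mset_set E' + selm f g (map tedge N) = mset_set ((E' - im f J) \<union> im f N) + selm f g (map tedge J)"
proof -
  have fin: "finite (im f J)" "finite (im f N)" by (auto simp: im_def)
  have "mset_set ((E' - im f J) \<union> im f N) = mset_set (E' - im f J) + mset_set (im f N)"
    using assms fin by (intro mset_set_Union) auto
  moreover have "mset_set E' = mset_set (E' - im f J) + mset_set (im f J)"
    using mset_set_Union[of "E' - im f J" "im f J"] assms fin by (auto simp: Un_absorb2)
  ultimately show ?thesis using assms by (simp add: mset_im[symmetric, of _ f g])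
qed

text \<open>\<open>J\<close> holds the edges added to the smaller graph, \<open>N\<close> those to
  be restored. The cut path \<open>tp\<close> with \<open>N\<close> must consist of the same pieces
  as the new paths \<open>A\<close> and \<open>C\<close> with \<open>J\<close>. The reference list
  \<open>us\<close> also contains the new vertices and the labels that the path misses, since
  \<open>A\<close> and \<open>C\<close> may visit them.\<close>

definition chk_cert :: "nat list \<Rightarrow> (nat \<times> nat) list \<Rightarrow> (nat \<times> nat) list \<Rightarrow> nat list \<Rightarrow> nat list \<Rightarrow> nat list \<Rightarrow> nat list \<Rightarrow> tok list \<Rightarrow> tok list \<Rightarrow> bool" where
  "chk_cert ws J N qs mid q1 q2 A C \<longleftrightarrow>
    (let tp = mk 0 q1 @ map Pt mid @ mk (Suc (length q1)) q2;
         us = tp @ map Pt ws @ map Pt (filter (\<lambda>q. q \<notin> set q1 \<and> q \<notin> set q2) qs)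
     in distinct us \<and> distinct (map base A) \<and> distinct (map base C) \<and>
        list_all (\<lambda>t. t \<in> set us) (map base A) \<and> list_all (\<lambda>t. t \<in> set us) (map base C) \<and>
        same_edges (chunks A @ chunks C @ map tedge J) (chunks tp @ map tedge N))"

text \<open>A path meets a labelled vertex at most once and may miss it, so all orders of all
  subsets have to be considered.\<close>

definition arrs :: "nat list \<Rightarrow> nat list list" where
  "arrs qs = filter distinct (concat (map (\<lambda>n. List.n_lists n qs) [0..<Suc (length qs)]))"

text \<open>\<open>mid\<close> is the vertex or edge at which a path is cut; \<open>tab\<close> lists, for the possible labelled vertices
  before and after \<open>mid\<close>, the two new paths. A path may be reversed if \<open>mid\<close> is a vertex.\<close>

definition chk_trace :: "nat list \<Rightarrow> (nat \<times> nat) list \<Rightarrow> (nat \<times> nat) list \<Rightarrow> nat list \<Rightarrow> nat list \<Rightarrow>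
    ((nat list \<times> nat list) \<times> (tok list \<times> tok list)) list \<Rightarrow> bool" where
  "chk_trace ws J N qs mid tab \<longleftrightarrow>
     distinct (mid @ qs @ ws) \<and> sorted_pairs J \<and> sorted_pairs N \<and>
     list_all (\<lambda>(i, j). i \<in> set (mid @ qs) \<and> j \<in> set (mid @ qs)) J \<and>
     list_all (\<lambda>(i, j). i \<in> set (mid @ qs @ ws) \<and> j \<in> set (mid @ qs @ ws)) N \<and>
     list_all (\<lambda>((q1, q2), (A, C)). chk_cert ws J N qs mid q1 q2 A C) tab \<and>
     (let ks = map fst tab in
      list_all (\<lambda>l. list_all (\<lambda>i. (take i l, drop i l) \<in> set ks \<or>
         length mid = 1 \<and> (rev (drop i l), rev (take i l)) \<in> set ks) [0..<Suc (length l)]) (arrs qs))"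

lemma in_arrs:
  assumes "distinct l" "set l \<subseteq> set qs"
  shows "l \<in> set (arrs qs)"
proof -
  have "length l \<le> length qs"
    using assms by (metis card_length card_mono distinct_card finite_set le_trans)
  then show ?thesis using assms by (auto simp: arrs_def set_n_lists)
qed

text \<open>Bookkeeping for the next theorem: \<open>p\<close> is the path that is cut,
  \<open>r\<close> the other paths, \<open>a\<close> and \<open>c\<close> the two replacements,
  \<open>j\<close> and \<open>n\<close> the added and the restored edges.\<close>

lemma mset_exchange:
  fixes M :: "'b multiset"
  assumes "a + c + j = p + n" "M + n = M' + j" "M = p + r"
  shows "a + c + r = M'"
proof -
  have "a + c + r + j = (a + c + j) + r" by (simp only: ac_simps)
  also have "\<dots> = M + n" using assms by (simp only: ac_simps)
  also have "\<dots> = M' + j" by (rule assms)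
  finally show ?thesis by simp
qed

text \<open>The assumption on \<open>mid\<close> provides a path through it. Only this path changes:
  its trace on both sides of \<open>mid\<close> selects an entry of the table, and the two paths
  found there replace it, so the number of paths grows by one.\<close>

lemma trace_ext:
  assumes chk: "chk_trace ws J N qs mid tab"
    and inj: "inj_on f (set (mid @ qs @ ws))"
    and mid: "(\<exists>m. mid = [m] \<and> f m \<in> \<Union> E') \<or> (\<exists>p q. mid = [p, q] \<and> {f p, f q} \<in> E')"
    and E': "\<And>e. e \<in> E' \<Longrightarrow> card e = 2"
  shows "ext ws f J N E'"
  unfolding ext_def
proof (intro allI impI)
  fix m assume J: "im f J \<subseteq> E'" and N: "im f N \<inter> E' = {}" and new: "f ` set ws \<inter> \<Union> E' = {}"
    and "pnle E' m"
  then obtain ps where ps: "length ps \<le> m" "finite E'" "decm ps (mset_set E')"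
    by (auto simp: pnle_def)
  obtain e where e: "e \<in> E'" "(\<exists>m. mid = [m] \<and> f m \<in> e) \<or> (\<exists>p q. mid = [p, q] \<and> {f p, f q} = e)"
    using mid by blast
  obtain p0 R where p0: "decm (p0 # R) (mset_set E')" "length ps = Suc (length R)" "e \<in> set (el p0)"
    using decm_in[OF ps(3), of e] e(1) ps(2) by (metis finite_set_mset_mset_set)
  obtain a b r1 r2 where r: "p0 = r1 @ [a, b] @ r2" "e = {a, b}" using el_split[OF p0(3)] by blast
  \<comment> \<open>If \<open>mid\<close> is an edge, the path may traverse it in the opposite
    direction and is then reversed.\<close>
  have "\<exists>p P1 P2. decm (p # R) (mset_set E') \<and> Suc 0 < length p \<and> p = P1 @ map f mid @ P2"
    using e(2)
  proof
    assume "\<exists>m. mid = [m] \<and> f m \<in> e"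
    then obtain m where m: "mid = [m]" "f m = a \<or> f m = b" using r by auto
    then have "p0 = r1 @ map f mid @ (b # r2) \<or> p0 = (r1 @ [a]) @ map f mid @ r2" using r by auto
    moreover have "Suc 0 < length p0" using r by simp
    ultimately show ?thesis using p0(1) by blast
  next
    assume "\<exists>p q. mid = [p, q] \<and> {f p, f q} = e"
    then obtain p q where m: "mid = [p, q]" "(f p = a \<and> f q = b) \<or> (f p = b \<and> f q = a)"
      using r by (auto simp: doubleton_eq_iff)
    then have "p0 = r1 @ map f mid @ r2 \<or> rev p0 = rev r2 @ map f mid @ rev r1" using r by auto
    moreover have "Suc 0 < length p0" "Suc 0 < length (rev p0)" using r by simp_all
    ultimately show ?thesis using p0(1) decm_rev by blast
  qed
  then obtain p P1 P2 where p: "decm (p # R) (mset_set E')" "Suc 0 < length p"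
    "p = P1 @ map f mid @ P2" by blast
  have dp: "distinct p" using p by (simp add: decm_def)
  have injq: "inj_on f (set qs)" using inj by (rule inj_on_subset) auto
  have main: "pnle ((E' - im f J) \<union> im f N) (Suc m)"
    if p': "decm (p' # R) (mset_set E')" "Suc 0 < length p'" "p' = P1 @ map f mid @ P2"
      and q1: "set q1 \<subseteq> set qs" "\<forall>i\<in>set qs. f i \<in> set P1 \<longrightarrow> i \<in> set q1" "sems f g1 (mk 0 q1) = P1"
      and q2: "set q2 \<subseteq> set qs" "\<forall>i\<in>set qs. f i \<in> set P2 \<longrightarrow> i \<in> set q2"
        "sems f g2 (mk (Suc (length q1)) q2) = P2"
      and tab: "((q1, q2), (A, C)) \<in> set tab"
    for p' P1 P2 q1 q2 g1 g2 A C
  proof -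
    \<comment> \<open>The segments after \<open>mid\<close> are numbered from
      \<open>Suc (length q1)\<close> on, so the two interpretations do not collide.\<close>
    define g where "g = (\<lambda>i. if i \<le> length q1 then g1 i else g2 i)"
    define tp where "tp = mk 0 q1 @ map Pt mid @ mk (Suc (length q1)) q2"
    define us where "us = tp @ map Pt ws @ map Pt (filter (\<lambda>q. q \<notin> set q1 \<and> q \<notin> set q2) qs)"
    have c: "chk_cert ws J N qs mid q1 q2 A C" using chk tab by (auto simp: chk_trace_def list_all_iff)
    have "sems f g (mk 0 q1) = P1" using q1(3) sems_mk_cong[of 0 q1 g g1 f] by (simp add: g_def)
    moreover have "sems f g (mk (Suc (length q1)) q2) = P2"
      using q2(3) sems_mk_cong[of "Suc (length q1)" q2 g g2 f] by (simp add: g_def)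
    ultimately have tp: "sems f g tp = p'" using p' by (simp add: tp_def)
    have dp': "distinct p'" using p' by (simp add: decm_def)
    have "set (el p') \<subseteq> E'"
    proof
      fix e assume "e \<in> set (el p')"
      moreover have "mset_set E' = mset (el p') + (\<Sum>p\<leftarrow>R. mset (el p))"
        using p'(1) by (simp add: decm_def)
      ultimately have "e \<in># mset_set E'" by simp
      then show "e \<in> E'" using ps(2) by simp
    qed
    \<comment> \<open>A path with an edge visits only vertices covered by \<open>E'\<close> and
      therefore avoids the vertices that are added back.\<close>
    with Union_el[OF p'(2)] have vp: "set p' \<subseteq> \<Union> E'" by blast
    let ?mi = "filter (\<lambda>q. q \<notin> set q1 \<and> q \<notin> set q2) qs"
    have dist: "distinct (mid @ qs @ ws)" using chk by (simp add: chk_trace_def)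
    have "f i \<notin> set p'" if "i \<in> set ?mi" for i
    proof
      assume "f i \<in> set p'"
      then have "f i \<in> f ` set mid" using p'(3) q1(2) q2(2) that by auto
      then obtain j where "j \<in> set mid" "f i = f j" by auto
      moreover from this have "i = j" using that by (intro inj_onD[OF inj]) auto
      ultimately show False using dist that by auto
    qed
    moreover have "distinct (map f ws)"
      using dist by (auto simp: distinct_map intro!: inj_on_subset[OF inj])
    moreover have "f ` set ws \<inter> f ` set ?mi = {}"
    proof -
      have "f ` set ws \<inter> f ` set ?mi = f ` (set ws \<inter> set ?mi)"
        by (rule inj_on_image_Int[OF inj, symmetric]) auto
      also have "set ws \<inter> set ?mi = {}" using dist by auto
      finally show ?thesis by simp
    qed
    moreover have "distinct (map f ?mi)"
      using dist injq by (auto simp: distinct_map intro: inj_on_subset)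
    ultimately have "distinct (p' @ map f ws @ map f ?mi)"
      using new vp dp' by auto
    then have dus: "distinct (sems f g us)" by (simp add: us_def tp)
    have ck: "distinct us" "distinct (map base A)" "distinct (map base C)"
      "base ` set A \<subseteq> set us" "base ` set C \<subseteq> set us"
      "same_edges (chunks A @ chunks C @ map tedge J) (chunks tp @ map tedge N)"
      using c unfolding chk_cert_def Let_def tp_def[symmetric] us_def[symmetric]
      by (auto simp: list_all_iff)
    have dA: "distinct (sems f g A)" "distinct (sems f g C)"
      using distinct_sems[OF dus] ck by blast+
    have "mset (el (sems f g A)) + mset (el (sems f g C)) + selm f g (map tedge J) =
        mset (el p') + selm f g (map tedge N)"
      using same_edges_selm[OF ck(6), of f g] by (simp add: el_chunks[symmetric] tp add.assoc)
    moreover have "mset_set E' + selm f g (map tedge N) =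
        mset_set ((E' - im f J) \<union> im f N) + selm f g (map tedge J)"
    proof (rule mset_swap[OF ps(2) J N])
      show "sorted_pairs J" "sorted_pairs N" using chk by (auto simp: chk_trace_def)
      show "inj_on f (ends J)" "inj_on f (ends N)"
        using chk by (auto simp: chk_trace_def list_all_iff ends_def intro!: inj_on_subset[OF inj])
    qed
    moreover have "mset_set E' = mset (el p') + (\<Sum>p\<leftarrow>R. mset (el p))"
      using p'(1) by (simp add: decm_def)
    ultimately have "mset (el (sems f g A)) + mset (el (sems f g C)) + (\<Sum>p\<leftarrow>R. mset (el p)) =
        mset_set ((E' - im f J) \<union> im f N)"
      by (rule mset_exchange)
    then have "decm (sems f g A # sems f g C # R) (mset_set ((E' - im f J) \<union> im f N))"
      using dA p'(1) by (simp add: decm_def ac_simps)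
    moreover have "finite ((E' - im f J) \<union> im f N)" using ps(2) by (auto simp: im_def)
    ultimately show ?thesis
      using pnleI[of _ "sems f g A # sems f g C # R" "Suc m"] ps(1) p0(2) by simp
  qed
  obtain q1 g1 where q1: "set q1 \<subseteq> set qs" "\<forall>i\<in>set qs. f i \<in> set P1 \<longrightarrow> i \<in> set q1"
    "sems f g1 (mk 0 q1) = P1" using trace_exists[OF injq] by metis
  obtain q2 g2 where q2: "set q2 \<subseteq> set qs" "\<forall>i\<in>set qs. f i \<in> set P2 \<longrightarrow> i \<in> set q2"
    "sems f g2 (mk (Suc (length q1)) q2) = P2" using trace_exists[OF injq] by metis
  have "distinct (q1 @ q2)"
  proof -
    have "distinct q1" "distinct q2" using dp p q1(3) q2(3) by (auto intro: distinct_mk)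
    moreover have "f ` set q1 \<subseteq> set P1" "f ` set q2 \<subseteq> set P2"
      using set_mk[of f q1 g1 0] set_mk[of f q2 g2 "Suc (length q1)"] q1(3) q2(3) by auto
    moreover have "set P1 \<inter> set P2 = {}" using dp p by auto
    ultimately show ?thesis by auto
  qed
  then have "q1 @ q2 \<in> set (arrs qs)" using q1(1) q2(1) by (intro in_arrs) auto
  moreover have "list_all (\<lambda>l. list_all (\<lambda>i. (take i l, drop i l) \<in> fst ` set tab \<or>
      length mid = 1 \<and> (rev (drop i l), rev (take i l)) \<in> fst ` set tab) [0..<Suc (length l)]) (arrs qs)"
    using chk by (simp add: chk_trace_def)
  ultimately have LA: "list_all (\<lambda>i. (take i (q1 @ q2), drop i (q1 @ q2)) \<in> fst ` set tab \<or>
      length mid = 1 \<and> (rev (drop i (q1 @ q2)), rev (take i (q1 @ q2))) \<in> fst ` set tab)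
      [0..<Suc (length (q1 @ q2))]"
    unfolding list_all_iff[of _ "arrs qs"] by blast
  have mem: "length q1 \<in> set [0..<Suc (length (q1 @ q2))]" by simp
  have "(q1, q2) \<in> fst ` set tab \<or> length mid = 1 \<and> (rev q2, rev q1) \<in> fst ` set tab"
    using bspec[OF LA[unfolded list_all_iff] mem] by simp
  then show "pnle ((E' - im f J) \<union> im f N) (Suc m)"
  proof
    assume "(q1, q2) \<in> fst ` set tab"
    then show ?thesis using main[OF p q1 q2] by auto
  next
    \<comment> \<open>Only the opposite trace is in the table, so the argument is applied to the
      reversed path.\<close>
    assume r: "length mid = 1 \<and> (rev q2, rev q1) \<in> fst ` set tab"
    then have mm: "rev mid = mid" by (auto simp: length_Suc_conv)
    have p': "decm (rev p # R) (mset_set E')" "Suc 0 < length (rev p)"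
      "rev p = rev P2 @ map f mid @ rev P1"
      using decm_rev[OF p(1)] p(2) mm by (simp_all add: p(3) rev_map)
    obtain h1 where h1: "sems f h1 (mk 0 (rev q2)) = rev P2"
      using sems_mk_rev[of f 0 q2 g2] q2(3) by metis
    obtain h2 where h2: "sems f h2 (mk (Suc (length (rev q2))) (rev q1)) = rev P1"
      using sems_mk_rev[of f _ q1 g1 0] q1(3) by metis
    show ?thesis using main[OF p' _ _ h1 _ _ h2] q1 q2 r by auto
  qed
qed

section \<open>Subdividing edges\<close>

text \<open>The ends of the path are recorded because the halves of a cut path are prolonged at
  their ends after a subdivision.\<close>

definition subdiv :: "'a \<Rightarrow> 'a set \<Rightarrow> 'a list \<Rightarrow> 'a list \<Rightarrow> bool" where
  "subdiv v e p q \<longleftrightarrow> distinct q \<and> (q = p \<or>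
     e \<in> set (el p) \<and> hd q = hd p \<and> last q = last p \<and> set q = insert v (set p))"

lemma subdivD: "subdiv v e p q \<Longrightarrow>
    distinct q \<and> (q = p \<or> set q = insert v (set p) \<and> hd q = hd p \<and> last q = last p)"
  by (auto simp: subdiv_def)

lemma subdiv_refl: "distinct p \<Longrightarrow> subdiv v e p p"
  by (simp add: subdiv_def)

lemma list_all2_in2: "list_all2 R xs ys \<Longrightarrow> y \<in> set ys \<Longrightarrow> \<exists>x\<in>set xs. R x y"
  by (induction rule: list_all2_induct) auto

lemma subdivide:
  assumes "\<forall>p\<in>set ps. distinct p \<and> v \<notin> set p" "{y, z} \<in># (\<Sum>p\<leftarrow>ps. mset (el p))"
  shows "\<exists>qs. list_all2 (subdiv v {y, z}) ps qs \<and>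
    (\<Sum>p\<leftarrow>qs. mset (el p)) + {#{y, z}#} = (\<Sum>p\<leftarrow>ps. mset (el p)) + {#{y, v}, {v, z}#}"
  using assms
proof (induction ps)
  case (Cons p ps)
  show ?case
  proof (cases "{y, z} \<in> set (el p)")
    case True
    then obtain a b p1 p2 where p: "p = p1 @ [a, b] @ p2" "{y, z} = {a, b}" using el_split by metis
    have ab: "{#{y, v}, {v, z}#} = {#{a, v}, {v, b}#}"
    proof (cases "y = a")
      case False
      then have "{y, v} = {v, b}" "{v, z} = {a, v}" using p(2) by (auto simp: doubleton_eq_iff)
      then show ?thesis by (simp only: add_mset_commute)
    qed (use p(2) in \<open>auto simp: doubleton_eq_iff\<close>)
    obtain q where q: "q = p1 @ [a, v, b] @ p2" by simp
    have 1: "subdiv v {y, z} p q"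
      using Cons.prems(1) True unfolding p(1) q by (auto simp: subdiv_def hd_append)
    have 2: "list_all2 (subdiv v {y, z}) ps ps"
      using Cons.prems(1) by (auto simp: subdiv_def list_all2_conv_all_nth)
    have 3: "mset (el q) + {#{y, z}#} = mset (el p) + {#{y, v}, {v, z}#}"
      unfolding ab p q by (simp add: el_append[of p1 a "v # b # p2"] el_append[of p1 a "b # p2"])
    have "(\<Sum>p\<leftarrow>q # ps. mset (el p)) + {#{y, z}#} = (mset (el q) + {#{y, z}#}) + (\<Sum>p\<leftarrow>ps. mset (el p))"
      by simp
    also have "\<dots> = (\<Sum>p\<leftarrow>p # ps. mset (el p)) + {#{y, v}, {v, z}#}"
      unfolding 3 by simp
    finally show ?thesis using 1 2 by (intro exI[of _ "q # ps"]) simp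
  next
    case False
    then obtain qs where "list_all2 (subdiv v {y, z}) ps qs"
      "(\<Sum>p\<leftarrow>qs. mset (el p)) + {#{y, z}#} = (\<Sum>p\<leftarrow>ps. mset (el p)) + {#{y, v}, {v, z}#}"
      using Cons by auto
    then show ?thesis using Cons.prems
      by (intro exI[of _ "p # qs"]) (auto simp: subdiv_refl)
  qed
qed simp

text \<open>Trivial paths are excluded so that each vertex of a path lies on an edge; then
  \<open>v\<close> is new to all paths and can be inserted into any of them.\<close>

lemma decm_lift:
  assumes "decm ps (M + {#{y, z}#})" "v \<notin> \<Union> (set_mset (M + {#{y, z}#}))"
    "\<forall>p\<in>set ps. Suc 0 < length p"
  shows "\<exists>qs. length qs = length ps \<and> decm qs (M + {#{y, v}, {v, z}#}) \<and> (\<forall>p\<in>set qs. Suc 0 < length p)"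
proof -
  have M: "(\<Sum>p\<leftarrow>ps. mset (el p)) = M + {#{y, z}#}" using assms by (simp add: decm_def)
  have "v \<notin> set p" if p: "p \<in> set ps" for p
  proof -
    have "set (el p) \<subseteq> set_mset (\<Sum>p\<leftarrow>ps. mset (el p))" using p by (induction ps) auto
    moreover have "\<Union> (set (el p)) = set p" using p assms(3) by (simp add: Union_el)
    ultimately show ?thesis using assms(2) unfolding M by blast
  qed
  then obtain qs where qs: "list_all2 (subdiv v {y, z}) ps qs"
    "(\<Sum>p\<leftarrow>qs. mset (el p)) + {#{y, z}#} = (\<Sum>p\<leftarrow>ps. mset (el p)) + {#{y, v}, {v, z}#}"
    using subdivide[of ps v y z] assms(1) M by (auto simp: decm_def)
  have "distinct q \<and> Suc 0 < length q" if q: "q \<in> set qs" for q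
  proof -
    obtain p where p: "p \<in> set ps" "subdiv v {y, z} p q"
      using list_all2_in2[OF qs(1) q] by blast
    have "distinct q" "card (set p) = length p"
      using p assms(1) by (simp_all add: subdiv_def decm_def distinct_card)
    moreover have "card (set p) \<le> card (set q)" using p(2) by (auto simp: subdiv_def intro: card_mono)
    moreover have "Suc 0 < length p" using p assms(3) by blast
    ultimately show ?thesis by (metis distinct_card less_le_trans)
  qed
  then show ?thesis using qs M
    by (intro exI[of _ qs]) (auto simp: decm_def dest: list_all2_lengthD)
qed

lemma pnle_long:
  assumes "pnle E m"
  shows "\<exists>ps. length ps \<le> m \<and> finite E \<and> decm ps (mset_set E) \<and> (\<forall>p\<in>set ps. Suc 0 < length p)"
proof -
  obtain ps where ps: "length ps \<le> m" "finite E" "decm ps (mset_set E)"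
    using assms by (auto simp: pnle_def)
  have "el p = []" if "\<not> Suc 0 < length p" for p :: "'a list"
    using that by (cases p rule: el.cases) auto
  then have "(\<Sum>p\<leftarrow>filter (\<lambda>p. Suc 0 < length p) ps. mset (el p)) = (\<Sum>p\<leftarrow>ps. mset (el p))"
    by (induction ps) auto
  then have "decm (filter (\<lambda>p. Suc 0 < length p) ps) (mset_set E)"
    using ps(3) by (auto simp: decm_def)
  moreover have "length (filter (\<lambda>p. Suc 0 < length p) ps) \<le> m"
    using ps(1) length_filter_le le_trans by blast
  ultimately show ?thesis using ps(2) by (intro exI[of _ "filter (\<lambda>p. Suc 0 < length p) ps"]) auto
qed

definition lift_old :: "(nat \<times> nat \<times> nat) list \<Rightarrow> tok list list" where
  "lift_old ls = map (\<lambda>(i, v, j). [Pt i, Pt j]) ls"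

definition lift_new :: "(nat \<times> nat \<times> nat) list \<Rightarrow> tok list list" where
  "lift_new ls = concat (map (\<lambda>(i, v, j). [[Pt i, Pt v], [Pt v, Pt j]]) ls)"

text \<open>An entry \<open>(i, v, j)\<close> of \<open>ls\<close> subdivides the added edge
  \<open>i j\<close> by the new vertex \<open>v\<close>, and \<open>p\<close> is the one additional
  path. A new vertex may subdivide only once, because it must be absent from all paths at the moment
  of its insertion.\<close>

definition chk_lift :: "nat list \<Rightarrow> (nat \<times> nat) list \<Rightarrow> (nat \<times> nat) list \<Rightarrow> nat list \<Rightarrow>
    (nat \<times> nat \<times> nat) list \<Rightarrow> nat list \<Rightarrow> bool" where
  "chk_lift ws J N qs ls p \<longleftrightarrow>
     distinct (qs @ ws) \<and> sorted_pairs J \<and> sorted_pairs N \<and>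
     list_all (\<lambda>(i, j). i \<in> set qs \<and> j \<in> set qs) J \<and>
     list_all (\<lambda>(i, j). i \<in> set (qs @ ws) \<and> j \<in> set (qs @ ws)) N \<and>
     list_all (\<lambda>(i, v, j). i \<in> set qs \<and> v \<in> set ws \<and> j \<in> set qs) ls \<and>
     distinct (map (fst \<circ> snd) ls) \<and> distinct p \<and> list_all (\<lambda>i. i \<in> set (qs @ ws)) p \<and>
     same_edges (lift_old ls) (map tedge J) \<and>
     same_edges (lift_new ls @ chunks (map Pt p)) (map tedge N)"

lemma decm_lifts:
  assumes "decm ps (M + selm f g (lift_old ls))" "inj_on f (set (qs @ ws))" "distinct (qs @ ws)"
    "\<forall>(i, v, j)\<in>set ls. i \<in> set qs \<and> v \<in> set ws \<and> j \<in> set qs \<and> f v \<notin> \<Union> (set_mset M)"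
    "distinct (map (fst \<circ> snd) ls)" "\<forall>p\<in>set ps. Suc 0 < length p"
  shows "\<exists>qs. length qs = length ps \<and> decm qs (M + selm f g (lift_new ls)) \<and> (\<forall>p\<in>set qs. Suc 0 < length p)"
  using assms
proof (induction ls arbitrary: M ps)
  case Nil
  then show ?case by (auto simp: lift_old_def lift_new_def)
next
  case (Cons l ls)
  obtain i v j where l: "l = (i, v, j)" by (cases l)
  have lab: "i \<in> set qs" "v \<in> set ws" "j \<in> set qs" "f v \<notin> \<Union> (set_mset M)"
    using Cons.prems(4) l by auto
  have sep: "f k \<noteq> f w" if "k \<in> set qs" "w \<in> set ws" for k w
    using that Cons.prems(3) inj_onD[OF Cons.prems(2), of k w] by auto
  let ?O = "selm f g (lift_old ls)"
  have O: "x \<in> f ` set qs" if "e \<in># ?O" "x \<in> e" for e x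
    using that Cons.prems(4) unfolding lift_old_def by (induction ls) auto
  have "decm ps ((M + ?O) + {#{f i, f j}#})"
    using Cons.prems(1) l by (simp add: lift_old_def ac_simps)
  moreover have "f v \<notin> \<Union> (set_mset (M + ?O + {#{f i, f j}#}))"
    using lab O sep by auto (metis image_iff)+
  ultimately obtain ps' where ps': "length ps' = length ps"
    "decm ps' ((M + ?O) + {#{f i, f v}, {f v, f j}#})" "\<forall>p\<in>set ps'. Suc 0 < length p"
    using decm_lift Cons.prems(6) by metis
  have "\<exists>qs. length qs = length ps' \<and> decm qs ((M + {#{f i, f v}, {f v, f j}#}) + selm f g (lift_new ls))
      \<and> (\<forall>p\<in>set qs. Suc 0 < length p)"
  proof (rule Cons.IH)
    show "decm ps' (M + {#{f i, f v}, {f v, f j}#} + ?O)" using ps'(2) by (simp add: ac_simps)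
    have wv: "f w \<noteq> f v" if "(a, w, b) \<in> set ls" for a w b
    proof -
      have "w \<noteq> v" using Cons.prems(5) l that by force
      then show ?thesis using inj_onD[OF Cons.prems(2), of w v] Cons.prems(4) that lab(2) by auto
    qed
    then show "\<forall>(a, w, b)\<in>set ls. a \<in> set qs \<and> w \<in> set ws \<and> b \<in> set qs \<and>
        f w \<notin> \<Union> (set_mset (M + {#{f i, f v}, {f v, f j}#}))"
    proof (clarify)
      fix a w b assume m: "(a, w, b) \<in> set ls"
      then have "a \<in> set qs" "w \<in> set ws" "b \<in> set qs" "f w \<notin> \<Union> (set_mset M)"
        using Cons.prems(4) by auto
      moreover have "f w \<notin> {f i, f v, f j}" using lab sep[of i w] sep[of j w] wv[OF m] calculation by auto
      ultimately show "a \<in> set qs \<and> w \<in> set ws \<and> b \<in> set qs \<and>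
        f w \<notin> \<Union> (set_mset (M + {#{f i, f v}, {f v, f j}#}))" by simp
    qed
  qed (use Cons.prems ps' in auto)
  then show ?case using ps'(1) l by (simp add: lift_new_def ac_simps add_mset_commute)
qed

text \<open>Here \<open>M\<close> collects the edges common to both graphs, so that only the
  exchange of \<open>J\<close> for \<open>N\<close> remains to be treated.\<close>

lemma ext_by_multiset:
  assumes "sorted_pairs J" "sorted_pairs N" "inj_on f (ends J)" "inj_on f (ends N)"
    and step: "\<And>M ps. decm ps (M + selm f g (map tedge J)) \<Longrightarrow> \<forall>p\<in>set ps. Suc 0 < length p \<Longrightarrow>
      f ` set ws \<inter> \<Union> (set_mset M) = {} \<Longrightarrow>
      \<exists>qs. length qs \<le> Suc (length ps) \<and> decm qs (M + selm f g (map tedge N))"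
  shows "ext ws f J N E'"
  unfolding ext_def
proof (intro allI impI)
  fix m assume J: "im f J \<subseteq> E'" and N: "im f N \<inter> E' = {}" and ws: "f ` set ws \<inter> \<Union> E' = {}"
    and "pnle E' m"
  then obtain ps where ps: "length ps \<le> m" "finite E'" "decm ps (mset_set E')"
    "\<forall>p\<in>set ps. Suc 0 < length p" using pnle_long by metis
  let ?M = "mset_set (E' - im f J)"
  have gJ: "selm f g (map tedge J) = mset_set (im f J)" and gN: "selm f g (map tedge N) = mset_set (im f N)"
    using assms(1-4) by (simp_all add: mset_im[of _ f g])
  have fin: "finite (im f J)" "finite (im f N)" by (auto simp: im_def)
  have "mset_set E' = ?M + mset_set (im f J)"
    using mset_set_Union[of "E' - im f J" "im f J"] J ps(2) fin by (auto simp: Un_absorb2)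
  then have "decm ps (?M + selm f g (map tedge J))"
    using ps(3) gJ by simp
  moreover have "f ` set ws \<inter> \<Union> (set_mset ?M) = {}" using ws ps(2) by auto
  ultimately obtain qs where "length qs \<le> Suc (length ps)" "decm qs (?M + selm f g (map tedge N))"
    using step ps(4) by blast
  moreover have "mset_set (E' - im f J \<union> im f N) = ?M + mset_set (im f N)"
    using N ps(2) fin by (intro mset_set_Union) auto
  ultimately show "pnle (E' - im f J \<union> im f N) (Suc m)"
    using ps fin gN pnleI[of "E' - im f J \<union> im f N" qs "Suc m"] by simp
qed

lemma lift_ext:
  assumes chk: "chk_lift ws J N qs ls p" and inj: "inj_on f (set (qs @ ws))"
  shows "ext ws f J N E'"
\<comment> \<open>Edges between labels contain no segments, so any interpretation of segments will
  do.\<close>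
proof (rule ext_by_multiset[where g = "\<lambda>_. []"])
  show "sorted_pairs J" "sorted_pairs N" using chk by (auto simp: chk_lift_def)
  show "inj_on f (ends J)" "inj_on f (ends N)"
    using chk by (auto simp: chk_lift_def list_all_iff ends_def intro!: inj_on_subset[OF inj])
  fix M ps assume ps: "decm ps (M + selm f (\<lambda>_. []) (map tedge J))" "\<forall>p\<in>set ps. Suc 0 < length p"
    and ws: "f ` set ws \<inter> \<Union> (set_mset M) = {}"
  have "selm f (\<lambda>_. []) (map tedge J) = selm f (\<lambda>_. []) (lift_old ls)"
    using chk same_edges_selm by (metis chk_lift_def)
  with ps have "decm ps (M + selm f (\<lambda>_. []) (lift_old ls))" by simp
  moreover have "\<forall>(i, v, j)\<in>set ls. i \<in> set qs \<and> v \<in> set ws \<and> j \<in> set qs \<and> f v \<notin> \<Union> (set_mset M)"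
    using chk ws by (fastforce simp: chk_lift_def list_all_iff)
  ultimately obtain ps' where ps': "length ps' = length ps" "decm ps' (M + selm f (\<lambda>_. []) (lift_new ls))"
    using decm_lifts[of ps M f "\<lambda>_. []" ls qs ws] chk inj ps(2) by (auto simp: chk_lift_def)
  have "selm f (\<lambda>_. []) (map tedge N) = selm f (\<lambda>_. []) (lift_new ls @ chunks (map Pt p))"
    using chk same_edges_selm by (metis chk_lift_def)
  then have "selm f (\<lambda>_. []) (map tedge N) = selm f (\<lambda>_. []) (lift_new ls) + mset (el (map f p))"
    by (simp flip: el_chunks)
  moreover have "distinct (map f p)"
    using chk inj by (auto simp: chk_lift_def distinct_map list_all_iff intro: inj_on_subset)
  ultimately have "decm (map f p # ps') (M + selm f (\<lambda>_. []) (map tedge N))"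
    using ps'(2) by (simp add: decm_def ac_simps)
  with ps'(1) show "\<exists>qs. length qs \<le> Suc (length ps) \<and> decm qs (M + selm f (\<lambda>_. []) (map tedge N))"
    by (intro exI[of _ "map f p # ps'"]) simp
qed

text \<open>The path through \<open>x y\<close> is cut at this edge. The half ending in \<open>x\<close> avoids \<open>y\<close>, so it is not affected
  by the subdivision with \<open>w\<close>, and symmetrically for the other half.\<close>

lemma decm_double_lift:
  assumes ps: "decm ps (M + {#{z, x}, {x, y}, {y, t}#})" "\<forall>p\<in>set ps. Suc 0 < length p"
    and new: "v \<notin> \<Union> (set_mset M)" "w \<notin> \<Union> (set_mset M)"
    and dist: "distinct [x, y, v, w]" "z \<notin> {x, y, v, w}" "t \<notin> {x, y, v, w}"
  shows "\<exists>qs. length qs = Suc (length ps) \<and>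
    decm qs (M + {#{z, v}, {v, x}, {y, w}, {w, t}, {v, y}, {w, x}#})"
proof -
  obtain p R where p: "decm (p # R) (M + {#{z, x}, {x, y}, {y, t}#})" "length ps = Suc (length R)"
    "{x, y} \<in> set (el p)" "set (p # R) = set ps" using decm_in[OF ps(1), of "{x, y}"] by (metis add_mset_add_single union_iff union_single_eq_member multi_member_this)
  then obtain a b p1 p2 where ab: "p = p1 @ [a, b] @ p2" "{x, y} = {a, b}" using el_split by metis
  have "\<exists>P1 P2. decm ((P1 @ [x, y] @ P2) # R) (M + {#{z, x}, {x, y}, {y, t}#})"
  proof (cases "a = x")
    case True
    then show ?thesis using ab p(1) by (auto simp: doubleton_eq_iff)
  next
    case False
    then have "rev p = rev p2 @ [x, y] @ rev p1" using ab by (auto simp: doubleton_eq_iff)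
    then show ?thesis using decm_rev[OF p(1)] by metis
  qed
  then obtain P1 P2 where Pt: "decm ((P1 @ [x, y] @ P2) # R) (M + {#{z, x}, {x, y}, {y, t}#})" by blast
  let ?A = "P1 @ [x]" and ?C = "y # P2"
  have S: "(\<Sum>p\<leftarrow>?A # ?C # R. mset (el p)) = M + {#{z, x}, {y, t}#}"
  proof -
    have "add_mset {x, y} (\<Sum>p\<leftarrow>?A # ?C # R. mset (el p)) = (\<Sum>p\<leftarrow>(P1 @ [x, y] @ P2) # R. mset (el p))"
      by (simp add: el_append[of P1 x "y # P2"] add.assoc)
    also have "\<dots> = add_mset {x, y} (M + {#{z, x}, {y, t}#})"
      using Pt by (simp add: decm_def add_mset_commute)
    finally show ?thesis by simp
  qed
  have d: "\<forall>p\<in>set (?A # ?C # R). distinct p" "y \<notin> set ?A" "x \<notin> set ?C" using Pt by (auto simp: decm_def)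
  have vw: "v \<notin> set q" "w \<notin> set q" if q: "q \<in> set (?A # ?C # R)" for q
  proof -
    obtain r where r: "r \<in> set ((P1 @ [x, y] @ P2) # R)" "set q \<subseteq> set r" "Suc 0 < length r"
      using q ps(2) p(4) by fastforce
    have "set (el r) \<subseteq> set_mset (\<Sum>p\<leftarrow>(P1 @ [x, y] @ P2) # R. mset (el p))"
      using r(1) by (induction R) auto
    then have "set (el r) \<subseteq> set_mset (M + {#{z, x}, {x, y}, {y, t}#})"
      using Pt unfolding decm_def by metis
    then have "set r \<subseteq> \<Union> (set_mset (M + {#{z, x}, {x, y}, {y, t}#}))"
      using Union_el[OF r(3)] by blast
    moreover have "v \<notin> \<Union> (set_mset (M + {#{z, x}, {x, y}, {y, t}#}))"
      "w \<notin> \<Union> (set_mset (M + {#{z, x}, {x, y}, {y, t}#}))" using new dist by auto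
    ultimately show "v \<notin> set q" "w \<notin> set q" using r(2) by blast+
  qed
  obtain A C R1 where 1: "subdiv v {z, x} ?A A" "subdiv v {z, x} ?C C" "list_all2 (subdiv v {z, x}) R R1"
    "(\<Sum>p\<leftarrow>A # C # R1. mset (el p)) + {#{z, x}#} = M + {#{z, x}, {y, t}#} + {#{z, v}, {v, x}#}"
  proof -
    have "\<exists>qs. list_all2 (subdiv v {z, x}) (?A # ?C # R) qs \<and>
        (\<Sum>p\<leftarrow>qs. mset (el p)) + {#{z, x}#} = (\<Sum>p\<leftarrow>?A # ?C # R. mset (el p)) + {#{z, v}, {v, x}#}"
      by (rule subdivide) (use d(1) vw S in auto)
    then show ?thesis using that unfolding S by (auto simp: list_all2_Cons1)
  qed
  have C: "C = ?C" using 1(2) d(3) el_subset[of "{z, x}" ?C] by (auto simp: subdiv_def)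
  have A: "last A = x" "A \<noteq> []" "set A \<subseteq> insert v (set ?A)" "distinct A"
    using 1(1) by (auto simp: subdiv_def)
  have S1: "(\<Sum>p\<leftarrow>A # ?C # R1. mset (el p)) = M + {#{y, t}#} + {#{z, v}, {v, x}#}"
    using 1(4) C by simp
  have "{y, t} \<notin> set (el A)" using el_subset[of "{y, t}" A] A(3) d(2) dist(1) by auto
  moreover have "{y, t} \<in># (\<Sum>p\<leftarrow>A # ?C # R1. mset (el p))" unfolding S1 by simp
  ultimately have "{y, t} \<in># (\<Sum>p\<leftarrow>?C # R1. mset (el p))" by simp
  moreover have "\<forall>p\<in>set (?C # R1). distinct p \<and> w \<notin> set p"
  proof
    fix q assume "q \<in> set (?C # R1)"
    then obtain p where "p \<in> set (?C # R)" "subdiv v {z, x} p q"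
      using list_all2_in2[OF 1(3), of q] 1(2) C by auto
    then show "distinct q \<and> w \<notin> set q" using vw(2)[of p] d(1) dist(1) by (auto simp: subdiv_def)
  qed
  ultimately obtain C2 R2 where 2: "subdiv w {y, t} ?C C2" "list_all2 (subdiv w {y, t}) R1 R2"
    "(\<Sum>p\<leftarrow>C2 # R2. mset (el p)) + {#{y, t}#} = (\<Sum>p\<leftarrow>?C # R1. mset (el p)) + {#{y, w}, {w, t}#}"
    using subdivide[of "?C # R1" w y t] by (auto simp: list_all2_Cons1)
  have C2: "hd C2 = y" "C2 \<noteq> []" "v \<notin> set C2" "distinct C2"
  proof -
    have vC: "v \<notin> set ?C" "v \<noteq> w" using vw(1)[of ?C] dist(1) by simp_all
    have d: "C2 = ?C \<or> set C2 = insert w (set ?C) \<and> hd C2 = hd ?C" and "distinct C2"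
      using subdivD[OF 2(1)] by blast+
    show "distinct C2" by fact
    show "hd C2 = y" using d by (metis list.sel(1))
    show "C2 \<noteq> []" using d by (metis insert_not_empty list.distinct(1) list.set(1))
    show "v \<notin> set C2" using d vC by (metis insertE)
  qed
  \<comment> \<open>The remaining edges \<open>w x\<close> and \<open>v y\<close> prolong the halves
    at the cut: \<open>w\<close> is missing from the half ending in \<open>x\<close>, and
    \<open>v\<close> from the half beginning with \<open>y\<close>.\<close>
  have "distinct (A @ [w])" "distinct (v # C2)"
    using A C2 vw(2)[of ?A] dist(1) by auto
  moreover have "\<forall>p\<in>set R2. distinct p"
    using list_all2_in2[OF 2(2)] by (auto simp: subdiv_def)
  moreover have "mset (el (A @ [w])) = mset (el A) + {#{w, x}#}"
  proof -
    have "A = butlast A @ [x]" using A by (metis append_butlast_last_id)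
    then have "el (A @ [w]) = el A @ [{x, w}]"
      using el_append[of "butlast A" x "[w]"] by (metis append.assoc append_Cons append_Nil el.simps)
    then show ?thesis by (simp add: insert_commute)
  qed
  moreover have "mset (el (v # C2)) = mset (el C2) + {#{v, y}#}"
    using C2 by (simp add: el_Cons)
  moreover have "(\<Sum>p\<leftarrow>C2 # R2. mset (el p)) + mset (el A) = M + {#{z, v}, {v, x}, {y, w}, {w, t}#}"
  proof -
    have "(\<Sum>p\<leftarrow>C2 # R2. mset (el p)) + mset (el A) + {#{y, t}#} =
        ((\<Sum>p\<leftarrow>C2 # R2. mset (el p)) + {#{y, t}#}) + mset (el A)" by (simp only: ac_simps)
    also have "\<dots> = (\<Sum>p\<leftarrow>A # ?C # R1. mset (el p)) + {#{y, w}, {w, t}#}"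
      unfolding 2(3) by (simp add: ac_simps)
    also have "\<dots> = M + {#{z, v}, {v, x}, {y, w}, {w, t}#} + {#{y, t}#}"
      unfolding S1 by simp
    finally show ?thesis by simp
  qed
  ultimately have "decm ((A @ [w]) # (v # C2) # R2) (M + {#{z, v}, {v, x}, {y, w}, {w, t}#} + {#{w, x}#} + {#{v, y}#})"
    unfolding decm_def by (simp add: add.commute add.left_commute)
  then have "decm ((A @ [w]) # (v # C2) # R2) (M + {#{z, v}, {v, x}, {y, w}, {w, t}, {v, y}, {w, x}#})"
    by (simp add: add_mset_commute)
  moreover have "length ((A @ [w]) # (v # C2) # R2) = Suc (length ps)"
    using p(2) list_all2_lengthD[OF 1(3)] list_all2_lengthD[OF 2(2)] by simp
  ultimately show ?thesis by blast
qed

lemma double_lift_ext: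
  assumes "sorted_pairs J" "sorted_pairs N" "inj_on f (ends J)" "inj_on f (ends N)"
    and J: "same_edges [[Pt z, Pt x], [Pt x, Pt y], [Pt y, Pt t]] (map tedge J)"
    and N: "same_edges [[Pt z, Pt v], [Pt v, Pt x], [Pt y, Pt w], [Pt w, Pt t], [Pt v, Pt y], [Pt w, Pt x]] (map tedge N)"
    and dist: "distinct [f x, f y, f v, f w]" "f z \<notin> {f x, f y, f v, f w}" "f t \<notin> {f x, f y, f v, f w}"
  shows "ext [v, w] f J N E'"
proof (rule ext_by_multiset[where g = "\<lambda>_. []"])
  fix M ps assume ps: "decm ps (M + selm f (\<lambda>_. []) (map tedge J))" "\<forall>p\<in>set ps. Suc 0 < length p"
    and ws: "f ` set [v, w] \<inter> \<Union> (set_mset M) = {}"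
  have JN: "selm f (\<lambda>_. []) (map tedge J) = {#{f z, f x}, {f x, f y}, {f y, f t}#}"
    "selm f (\<lambda>_. []) (map tedge N) =
      {#{f z, f v}, {f v, f x}, {f y, f w}, {f w, f t}, {f v, f y}, {f w, f x}#}"
    using same_edges_selm[OF J, of f "\<lambda>_. []"] same_edges_selm[OF N, of f "\<lambda>_. []"] by (simp_all add: add_mset_commute)
  show "\<exists>qs. length qs \<le> Suc (length ps) \<and> decm qs (M + selm f (\<lambda>_. []) (map tedge N))"
    unfolding JN using decm_double_lift[OF ps(1)[unfolded JN] ps(2) _ _ dist] ws
    by (metis disjoint_iff image_eqI le_refl list.set_intros)
qed (use assms in auto)


section \<open>The exceptional graphs\<close>

definition all2 :: "'a set \<Rightarrow> 'a set set" where
  "all2 V = {e. e \<subseteq> V \<and> card e = 2}"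

definition exc :: "'a set \<Rightarrow> 'a set set \<Rightarrow> bool" where
  "exc V E \<longleftrightarrow> card V = 3 \<and> E = all2 V \<or> card V = 5 \<and> (\<exists>e\<in>all2 V. E = all2 V - {e})"

definition pairs :: "nat \<Rightarrow> (nat \<times> nat) list" where
  "pairs k = concat (map (\<lambda>j. map (\<lambda>i. (i, j)) [0..<j]) [0..<k])"

lemma set_pairs: "set (pairs k) = {(i, j). i < j \<and> j < k}"
  by (auto simp: pairs_def)

lemma im_pairs:
  assumes "bij_betw f {..<k} V"
  shows "im f (pairs k) = all2 V"
proof -
  have inj: "inj_on f {..<k}" and V: "V = f ` {..<k}" using assms by (auto simp: bij_betw_def)
  show ?thesis
  proof (intro equalityI subsetI)
    fix e assume "e \<in> im f (pairs k)"
    then obtain i j where "i < j" "j < k" "e = {f i, f j}" by (auto simp: im_def set_pairs)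
    then show "e \<in> all2 V"
      using inj_onD[OF inj, of i j] V by (auto simp: all2_def card_insert_if)
  next
    fix e assume "e \<in> all2 V"
    then obtain a b where "e = {a, b}" "a \<noteq> b" "a \<in> V" "b \<in> V"
      by (auto simp: all2_def card_2_iff)
    then obtain i j where ij: "i < k" "j < k" "e = {f i, f j}" "i \<noteq> j" using V by auto
    then have "(min i j, max i j) \<in> set (pairs k)" by (auto simp: set_pairs)
    moreover have "e = {f (min i j), f (max i j)}" using ij by (auto simp: min_def max_def)
    ultimately show "e \<in> im f (pairs k)" by (force simp: im_def)
  qed
qed

definition chk_paths :: "nat list \<Rightarrow> nat list list \<Rightarrow> (nat \<times> nat) list \<Rightarrow> (nat \<times> nat) list \<Rightarrow> bool" where
  "chk_paths ls ps M N \<longleftrightarrow> list_all (\<lambda>p. distinct p \<and> list_all (\<lambda>i. i \<in> set ls) p) ps \<and>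
     same_edges (concat (map (\<lambda>p. chunks (map Pt p)) ps) @ map tedge M) (map tedge N)"

text \<open>Labels below \<open>k\<close> name all vertices of the exceptional graph, those below
  \<open>q\<close> the vertices on which the reduction acts; new labels start at 5 to stay apart. A
  missing edge is irrelevant if it belongs to \<open>J\<close>, or if an edge of \<open>N\<close>
  between old vertices is present; every other one needs an entry in \<open>tab\<close>. As
  \<open>k\<close> is odd, \<open>(k + 1) div 2\<close> is half the order of the enlarged graph,
  rounded down, for one new vertex as well as for two.\<close>

definition chk_exc :: "nat list \<Rightarrow> (nat \<times> nat) list \<Rightarrow> (nat \<times> nat) list \<Rightarrow> nat \<Rightarrow> nat \<Rightarrow>
    ((nat \<times> nat) list \<times> nat list list) list \<Rightarrow> bool" where
  "chk_exc ws J N q k tab \<longleftrightarrow>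
     q \<le> k \<and> k \<le> 5 \<and> sorted_pairs (pairs k) \<and> distinct ws \<and> list_all (\<lambda>i. 5 \<le> i) ws \<and> sorted_pairs J \<and> sorted_pairs N \<and>
     list_all (\<lambda>(i, j). i < q \<and> j < q) J \<and>
     list_all (\<lambda>(i, j). (i < q \<or> i \<in> set ws) \<and> (j < q \<or> j \<in> set ws)) N \<and>
     list_all (\<lambda>(ms, ps). length ps \<le> (k + 1) div 2 \<and> chk_paths ([0..<k] @ ws) ps (J @ ms) (pairs k @ N)) tab \<and>
     list_all (\<lambda>ms. list_ex (\<lambda>e. e \<in> set ms) J \<or>
         list_ex (\<lambda>(i, j). i < k \<and> j < k \<and> (i, j) \<notin> set ms) N \<or> ms \<in> set (map fst tab))
       (if k = 5 then map (\<lambda>e. [e]) (pairs k) else [[]])"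

text \<open>The vertices without label are numbered arbitrarily, which is harmless because the table
  treats every possible missing edge. The entry itself is part of the conclusion, since
  \<open>exc_split\<close> needs the shape of its paths.\<close>

lemma exc_decm:
  assumes chk: "chk_exc ws J N q k tab"
    and inj: "inj_on f ({..<q} \<union> set ws)" and V: "f ` {..<q} \<subseteq> V" "f ` set ws \<inter> V = {}"
    and ex: "exc V E'" "card V = k"
    and J: "im f J \<subseteq> E'" and N: "im f N \<inter> E' = {}"
  shows "\<exists>f' ms ps. (ms, ps) \<in> set tab \<and> (\<forall>i<q. f' i = f i) \<and>
    decm (map (map f') ps) (mset_set ((E' - im f J) \<union> im f N))"
proof -
  have qk: "q \<le> k" "k \<le> 5" and ws5: "\<And>i. i \<in> set ws \<Longrightarrow> 5 \<le> i"
    using chk by (auto simp: chk_exc_def list_all_iff)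
  have fin: "finite V" using ex by (auto simp: exc_def intro: card_ge_0_finite)
  have "card (V - f ` {..<q}) = card {q..<k}"
    using V(1) fin ex(2) inj by (subst card_Diff_subset) (auto simp: card_image inj_on_Un)
  then obtain h where h: "bij_betw h {q..<k} (V - f ` {..<q})"
    using fin by (metis finite_Diff finite_atLeastLessThan finite_same_card_bij)
  define f' where "f' = (\<lambda>i. if q \<le> i \<and> i < k then h i else f i)"
  have f'f: "f' i = f i" if "i < q \<or> i \<in> set ws" for i
    using that qk ws5[of i] by (auto simp: f'_def)
  have "bij_betw f' ({..<q} \<union> {q..<k}) (f ` {..<q} \<union> (V - f ` {..<q}))"
  proof (rule bij_betw_combine)
    show "bij_betw f' {..<q} (f ` {..<q})"
      using inj f'f by (auto simp: bij_betw_def inj_on_def)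
    show "bij_betw f' {q..<k} (V - f ` {..<q})"
      using h by (rule bij_betw_cong[THEN iffD1, rotated]) (auto simp: f'_def)
  qed auto
  moreover have "{..<q} \<union> {q..<k} = {..<k}" using qk by auto
  moreover have "f ` {..<q} \<union> (V - f ` {..<q}) = V" using V by auto
  ultimately have bij: "bij_betw f' {..<k} V" by simp
  have injw: "inj_on f' ({..<k} \<union> set ws)"
  proof -
    have "f' ` {..<k} \<inter> f' ` set ws = {}"
      using bij V(2) f'f by (auto simp: bij_betw_def)
    moreover have "inj_on f' (set ws)" using inj f'f by (auto simp: inj_on_def)
    ultimately show ?thesis using bij by (auto simp: inj_on_Un bij_betw_def)
  qed
  have JN: "\<forall>(i, j)\<in>set J. i < q \<and> j < q"
    "\<forall>(i, j)\<in>set N. (i < q \<or> i \<in> set ws) \<and> (j < q \<or> j \<in> set ws)" "sorted_pairs J" "sorted_pairs N"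
    using chk by (auto simp: chk_exc_def list_all_iff)
  have imJ: "im f J = im f' J" and imN: "im f N = im f' N"
    unfolding im_def by (rule image_cong[OF refl]; use JN f'f in \<open>auto simp: split_beta\<close>)+
  have "\<exists>ms. E' = all2 V - im f' ms \<and> ms \<in> set (if k = 5 then map (\<lambda>e. [e]) (pairs k) else [[]])"
  proof (cases "card V = 3")
    case True
    then show ?thesis using ex by (intro exI[of _ "[]"]) (auto simp: exc_def im_def)
  next
    case False
    then obtain e where e: "e \<in> all2 V" "E' = all2 V - {e}" "k = 5" using ex by (auto simp: exc_def)
    have "e \<in> im f' (pairs k)" using e(1) im_pairs[OF bij] by simp
    then obtain i j where "e = {f' i, f' j}" "(i, j) \<in> set (pairs k)"
      by (auto simp: im_def)
    then have "E' = all2 V - im f' [(i, j)]" "[(i, j)] \<in> set (map (\<lambda>e. [e]) (pairs k))"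
      using e(2) by (simp_all add: im_def)
    then show ?thesis unfolding if_P[OF e(3)] by blast
  qed
  then obtain ms where ms: "E' = all2 V - im f' ms" "ms \<in> set (if k = 5 then map (\<lambda>e. [e]) (pairs k) else [[]])"
    by blast
  have msp: "set ms \<subseteq> set (pairs k)" "sorted_pairs ms"
    using ms(2) by (auto simp: sorted_pairs_def set_pairs split: if_splits)
  have bad1: "\<not> list_ex (\<lambda>e. e \<in> set ms) J"
  proof
    assume "list_ex (\<lambda>e. e \<in> set ms) J"
    then obtain e where "e \<in> set ms" "e \<in> set J" by (auto simp: list_ex_iff)
    then have "(\<lambda>(i, j). {f' i, f' j}) e \<in> im f' ms \<inter> im f' J" unfolding im_def by blast
    then show False using J ms(1) unfolding imJ by blast
  qed
  have bad2: "\<not> list_ex (\<lambda>(i, j). i < k \<and> j < k \<and> (i, j) \<notin> set ms) N"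
  proof
    assume "list_ex (\<lambda>(i, j). i < k \<and> j < k \<and> (i, j) \<notin> set ms) N"
    then obtain i j where ij: "(i, j) \<in> set N" "i < k" "j < k" "(i, j) \<notin> set ms"
      by (auto simp: list_ex_iff)
    moreover have lij: "i < j" using ij(1) JN(4) by (auto simp: sorted_pairs_def)
    ultimately have "{f' i, f' j} \<in> im f' (pairs k)"
      by (force simp: im_def set_pairs)
    then have "{f' i, f' j} \<in> all2 V" using im_pairs[OF bij] by simp
    moreover have "{f' i, f' j} \<notin> im f' ms"
    proof
      assume "{f' i, f' j} \<in> im f' ms"
      then obtain a b where ab: "(a, b) \<in> set ms" "{f' i, f' j} = {f' a, f' b}" by (auto simp: im_def)
      then have lt: "a < b" "b < k" using msp by (auto simp: set_pairs)
      have "inj_on f' {..<k}" using bij by (simp add: bij_betw_def)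
      then have "f' i = f' a \<longleftrightarrow> i = a" "f' i = f' b \<longleftrightarrow> i = b" "f' j = f' a \<longleftrightarrow> j = a" "f' j = f' b \<longleftrightarrow> j = b"
        using lt ij by (auto dest: inj_onD)
      then have "i = a \<and> j = b" using ab(2) lt lij by (auto simp: doubleton_eq_iff)
      then show False using ij ab by simp
    qed
    ultimately have "{f' i, f' j} \<in> E'" using ms(1) by blast
    then show False using N ij(1) unfolding imN by (force simp: im_def)
  qed
  have "ms \<in> set (map fst tab)"
    using chk ms(2) bad1 bad2 unfolding chk_exc_def list_all_iff by blast
  then obtain ps where tab: "(ms, ps) \<in> set tab" by auto
  then have ps: "length ps \<le> (k + 1) div 2" "chk_paths ([0..<k] @ ws) ps (J @ ms) (pairs k @ N)"
    using chk by (auto simp: chk_exc_def list_all_iff)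
  have inj2: "inj_on f' (ends es)" if "\<forall>(i, j)\<in>set es. i \<in> {..<k} \<union> set ws \<and> j \<in> {..<k} \<union> set ws" for es
    using that by (auto simp: ends_def intro!: inj_on_subset[OF injw])
  let ?g = "\<lambda>_. []"
  have sp: "sorted_pairs (pairs k)"
    using chk by (simp add: chk_exc_def)
  have fins: "finite (im f' es)" for es by (simp add: im_def)
  have 1: "mset_set (im f' J) = selm f' ?g (map tedge J)" "mset_set (im f' N) = selm f' ?g (map tedge N)"
    "mset_set (im f' ms) = selm f' ?g (map tedge ms)" "mset_set (im f' (pairs k)) = selm f' ?g (map tedge (pairs k))"
    by (rule mset_im; use JN sp msp qk in \<open>fastforce intro!: inj2 simp: set_pairs\<close>)+
  have finE: "finite E'" using ms(1) fins[of "pairs k"] im_pairs[OF bij] by simp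
  have "im f' ms \<subseteq> all2 V" using msp(1) im_pairs[OF bij] by (auto simp: im_def)
  then have 2: "mset_set (all2 V) = mset_set E' + mset_set (im f' ms)"
    using mset_set_Union[of E' "im f' ms"] ms(1) finE fins by (auto simp: Un_absorb2)
  have 3: "mset_set E' = mset_set (E' - im f' J) + mset_set (im f' J)"
    using mset_set_Union[of "E' - im f' J" "im f' J"] J finE fins unfolding imJ by (auto simp: Un_absorb2)
  have 4: "mset_set ((E' - im f' J) \<union> im f' N) = mset_set (E' - im f' J) + mset_set (im f' N)"
    using N finE fins unfolding imN by (intro mset_set_Union) auto
  have "selm f' ?g (concat (map (\<lambda>p. chunks (map Pt p)) ps)) = (\<Sum>p\<leftarrow>map (map f') ps. mset (el p))"
    by (induction ps) (simp_all flip: el_chunks)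
  then have "(\<Sum>p\<leftarrow>map (map f') ps. mset (el p)) + (mset_set (im f' J) + mset_set (im f' ms)) =
      mset_set (all2 V) + mset_set (im f' N)"
    using ps(2) same_edges_selm[of _ _ f' ?g] unfolding chk_paths_def 1 im_pairs[OF bij, symmetric]
    by fastforce
  then have "(\<Sum>p\<leftarrow>map (map f') ps. mset (el p)) = mset_set ((E' - im f' J) \<union> im f' N)"
    unfolding 2 3 4 by (simp add: add.commute add.left_commute)
  moreover have "\<forall>p\<in>set (map (map f') ps). distinct p"
    using ps(2) qk by (auto simp: chk_paths_def list_all_iff distinct_map intro!: inj_on_subset[OF injw])
  ultimately have "decm (map (map f') ps) (mset_set ((E' - im f J) \<union> im f N))"
    unfolding imJ imN by (simp add: decm_def)
  then show ?thesis using tab f'f by blast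
qed

lemma exc_ext:
  assumes chk: "chk_exc ws J N q k tab"
    and "inj_on f ({..<q} \<union> set ws)" "f ` {..<q} \<subseteq> V" "f ` set ws \<inter> V = {}"
    and ex: "exc V E'" "card V = k"
    and "im f J \<subseteq> E'" "im f N \<inter> E' = {}"
  shows "pnle ((E' - im f J) \<union> im f N) ((k + 1) div 2)"
proof -
  obtain f' ms ps where *: "(ms, ps) \<in> set tab"
    "decm (map (map f') ps) (mset_set ((E' - im f J) \<union> im f N))"
    using exc_decm[OF assms] by blast
  have "finite V" using ex by (auto simp: exc_def intro: card_ge_0_finite)
  then have "finite E'" using ex(1) by (auto simp: exc_def all2_def)
  moreover have "length ps \<le> (k + 1) div 2" using chk *(1) by (auto simp: chk_exc_def list_all_iff)
  ultimately show ?thesis using *(2) by (intro pnleI[of _ "map (map f') ps"]) (auto simp: im_def)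
qed

section \<open>The table of reductions\<close>

text \<open>\<open>V\<close>, \<open>E'\<close> is the smaller graph. The list \<open>ks\<close> restricts the exceptional graphs for which the bound is
  claimed: two of the reductions below also turn \<open>K\<^sub>3\<close> into \<open>K\<^sub>5\<^sup>-\<close>.\<close>

definition reducible :: "nat list \<Rightarrow> (nat \<times> nat) list \<Rightarrow> (nat \<times> nat) list \<Rightarrow> nat \<Rightarrow> nat list \<Rightarrow> (nat \<Rightarrow> 'a) \<Rightarrow> bool" where
  "reducible ws J N q ks f \<longleftrightarrow> (\<forall>V E'.
     inj_on f ({..<q} \<union> set ws) \<longrightarrow> f ` {..<q} \<subseteq> V \<longrightarrow> f ` set ws \<inter> V = {} \<longrightarrow>
     E' \<subseteq> all2 V \<longrightarrow> V \<subseteq> \<Union> E' \<longrightarrow> im f J \<subseteq> E' \<longrightarrow> im f N \<inter> E' = {} \<longrightarrow>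
     (\<forall>m. pnle E' m \<longrightarrow> pnle ((E' - im f J) \<union> im f N) (Suc m)) \<and>
     (exc V E' \<longrightarrow> card V \<in> set ks \<longrightarrow> pnle ((E' - im f J) \<union> im f N) ((card V + 1) div 2)))"

text \<open>With more than three old labels the smaller graph cannot be a triangle, and no table of
  order 3 is required.\<close>

lemma reducibleI:
  assumes ext: "\<And>V E'. inj_on f ({..<q} \<union> set ws) \<Longrightarrow> f ` {..<q} \<subseteq> V \<Longrightarrow> E' \<subseteq> all2 V \<Longrightarrow> V \<subseteq> \<Union> E' \<Longrightarrow>
      im f J \<subseteq> E' \<Longrightarrow> ext ws f J N E'"
    and 5: "chk_exc ws J N q 5 tab5" and 3: "3 < q \<or> 3 \<notin> set ks \<or> chk_exc ws J N q 3 tab3"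
  shows "reducible ws J N q ks f"
  unfolding reducible_def
proof (intro allI impI conjI)
  fix V E' m
  assume *: "inj_on f ({..<q} \<union> set ws)" "f ` {..<q} \<subseteq> V" "f ` set ws \<inter> V = {}"
    "E' \<subseteq> all2 V" "V \<subseteq> \<Union> E'" "im f J \<subseteq> E'" "im f N \<inter> E' = {}"
  {
    assume "pnle E' m"
    moreover have "f ` set ws \<inter> \<Union> E' = {}" using *(3,4) by (auto simp: all2_def)
    ultimately show "pnle ((E' - im f J) \<union> im f N) (Suc m)"
      using ext[OF *(1,2,4-6)] *(6,7) unfolding ext_def by blast
  next
    assume e: "exc V E'" and k: "card V \<in> set ks"
    have "q \<le> card V"
    proof -
      have "finite V" using e by (auto simp: exc_def intro: card_ge_0_finite)
      moreover have "card (f ` {..<q}) = q" using *(1) by (simp add: card_image inj_on_Un)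
      ultimately show ?thesis using *(2) card_mono by metis
    qed
    moreover have "card V = 3 \<or> card V = 5" using e by (auto simp: exc_def)
    ultimately have "\<exists>tab. chk_exc ws J N q (card V) tab" using 5 3 k by auto
    then show "pnle ((E' - im f J) \<union> im f N) ((card V + 1) div 2)"
      using exc_ext[OF _ *(1-3) e refl *(6,7)] by blast
  }
qed

text \<open>A path through \<open>mid\<close> exists because the smaller graph has no isolated
  vertex, or because \<open>mid\<close> is one of the added edges.\<close>

lemma reducible_trace:
  assumes chk: "chk_trace ws J N qs mid tab"
    and mid: "length mid = 1 \<or> length mid = 2 \<and> (hd mid, last mid) \<in> set J"
    and q: "list_all (\<lambda>i. i < q) (mid @ qs)"
    and 5: "chk_exc ws J N q 5 tab5" and 3: "3 < q \<or> 3 \<notin> set ks \<or> chk_exc ws J N q 3 tab3"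
  shows "reducible ws J N q ks f"
proof (rule reducibleI[OF _ 5 3])
  fix V E' assume *: "inj_on f ({..<q} \<union> set ws)" "f ` {..<q} \<subseteq> V" "E' \<subseteq> all2 V" "V \<subseteq> \<Union> E'" "im f J \<subseteq> E'"
  show "ext ws f J N E'"
  proof (rule trace_ext[OF chk])
    show "inj_on f (set (mid @ qs @ ws))"
      using q by (intro inj_on_subset[OF *(1)]) (auto simp: list_all_iff)
    show "card e = 2" if "e \<in> E'" for e using that *(3) by (auto simp: all2_def)
    show "(\<exists>m. mid = [m] \<and> f m \<in> \<Union> E') \<or> (\<exists>p q. mid = [p, q] \<and> {f p, f q} \<in> E')"
      using mid
    proof
      assume "length mid = 1"
      then obtain m where m: "mid = [m]" by (auto simp: length_Suc_conv)
      then have "f m \<in> \<Union> E'" using q *(2,4) by auto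
      then show ?thesis using m by blast
    next
      assume "length mid = 2 \<and> (hd mid, last mid) \<in> set J"
      then obtain a b where m: "mid = [a, b]" "(a, b) \<in> set J"
        by (auto simp: numeral_2_eq_2 length_Suc_conv)
      then have "{f a, f b} \<in> im f J" by (force simp: im_def)
      then show ?thesis using m *(5) by blast
    qed
  qed
qed

lemma reducible_lift:
  assumes "chk_lift ws J N qs ls p" "list_all (\<lambda>i. i < q) qs"
    and 5: "chk_exc ws J N q 5 tab5" and 3: "3 < q \<or> 3 \<notin> set ks \<or> chk_exc ws J N q 3 tab3"
  shows "reducible ws J N q ks f"
proof (rule reducibleI[OF _ 5 3])
  fix V E' assume *: "inj_on f ({..<q} \<union> set ws)"
  show "ext ws f J N E'"
    by (rule lift_ext[OF assms(1) inj_on_subset[OF *]]) (use assms(2) in \<open>auto simp: list_all_iff\<close>)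
qed

lemma reducible_double:
  assumes "same_edges [[Pt z, Pt x], [Pt x, Pt y], [Pt y, Pt t]] (map tedge J)"
    "same_edges [[Pt z, Pt v], [Pt v, Pt x], [Pt y, Pt w], [Pt w, Pt t], [Pt v, Pt y], [Pt w, Pt x]] (map tedge N)"
    "distinct [x, y, v, w]" "z \<notin> {x, y, v, w}" "t \<notin> {x, y, v, w}" "list_all (\<lambda>i. i < q) [x, y, z, t]"
    and 5: "chk_exc [v, w] J N q 5 tab5" and 3: "3 < q \<or> 3 \<notin> set ks \<or> chk_exc [v, w] J N q 3 tab3"
  shows "reducible [v, w] J N q ks f"
proof (rule reducibleI[OF _ 5 3])
  fix V E' assume *: "inj_on f ({..<q} \<union> set [v, w])"
  have JN: "sorted_pairs J" "sorted_pairs N" "\<forall>(i, j)\<in>set J. i < q \<and> j < q"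
    "\<forall>(i, j)\<in>set N. (i < q \<or> i \<in> {v, w}) \<and> (j < q \<or> j \<in> {v, w})"
    using 5 by (auto simp: chk_exc_def list_all_iff)
  have eq: "f a = f b \<longleftrightarrow> a = b" if "a \<in> {..<q} \<union> {v, w}" "b \<in> {..<q} \<union> {v, w}" for a b
    using that inj_on_eq_iff[OF *] by simp
  show "ext [v, w] f J N E'"
  proof (rule double_lift_ext[OF JN(1,2) _ _ assms(1,2)])
    show "inj_on f (ends J)" "inj_on f (ends N)"
      using JN(3,4) by (auto simp: ends_def intro!: inj_on_subset[OF *])
  qed (use assms(3-6) in \<open>simp_all add: eq\<close>)
qed

section \<open>Reductions: a pendant vertex together with its neighbour\<close>

text \<open>The tables were found by computer search. Labels below 5 are old vertices, 5 and 6 are new ones. The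
  exceptional graphs on labels \<open>0..<5\<close> or \<open>0..<3\<close> are listed by their missing edge.\<close>

lemma red_leafpend2_add: "reducible [5, 6] [(0, 1)]
    [(5, 6), (0, 5), (1, 5)] 2 [3, 5] f"
  by (rule reducible_lift[where qs = "[0, 1]" and ls = "[(0, 5, 1)]" and p = "[5, 6]"
   and ?tab5.0 = "[([(0, 2)], [[2, 1], [0, 3, 2, 4, 1, 5], [1, 3, 4, 0, 5, 6]]),
      ([(1, 2)], [[2, 0], [0, 3, 2, 4, 1, 5], [1, 3, 4, 0, 5, 6]]),
      ([(0, 3)], [[0, 2], [2, 1, 3, 4, 0, 5], [3, 2, 4, 1, 5, 6]]),
      ([(1, 3)], [[1, 2], [2, 0, 3, 4, 1, 5], [3, 2, 4, 0, 5, 6]]),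
      ([(2, 3)], [[2, 0], [0, 3, 4, 1, 5], [3, 1, 2, 4, 0, 5, 6]]),
      ([(0, 4)], [[0, 2], [2, 1, 4, 3, 0, 5], [4, 2, 3, 1, 5, 6]]),
      ([(1, 4)], [[1, 2], [2, 0, 4, 3, 1, 5], [4, 2, 3, 0, 5, 6]]),
      ([(2, 4)], [[2, 0], [0, 4, 3, 1, 5], [4, 1, 2, 3, 0, 5, 6]]),
      ([(3, 4)], [[3, 0], [0, 4, 2, 1, 5], [4, 1, 3, 2, 0, 5, 6]])]"
   and ?tab3.0 = "[([], [[5, 0], [0, 2, 1, 5, 6]])]"])
    code_simp+

text \<open>The reduction also deletes the old edge \<open>0 1\<close>. If the smaller graph is
  exceptional, this must be its missing edge: one graph of order 5 remains and no triangle, as a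
  triangle lacks no edge. The same holds for all later tables with a single entry.\<close>

lemma red_leafpend2: "reducible [5, 6] []
    [(5, 6), (0, 5), (1, 5), (0, 1)] 2 [3, 5] f"
  by (rule reducible_trace[where mid = "[0]" and qs = "[1]" and ?tab = "[(([], []), ([Pt 5, Pt 0, Bw 0],
      [Pt 6, Pt 5, Pt 1, Pt 0, Fw 1])),
      (([], [1]), ([Pt 5, Pt 0, Pt 1, Fw 2],
      [Pt 6, Pt 5, Pt 1, Bw 1, Pt 0, Bw 0]))]"
   and ?tab5.0 = "[([(0, 1)], [[0, 2, 1], [5, 0, 3, 1, 4, 2], [2, 3, 4, 0, 1, 5, 6]])]"
   and ?tab3.0 = "[]"])
    code_simp+

lemma red_leafpend3_add: "reducible [5, 6] [(1, 2)]
    [(5, 6), (0, 5), (1, 5), (2, 5)] 3 [3, 5] f"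
  by (rule reducible_lift[where qs = "[0, 1, 2]" and ls = "[(1, 5, 2)]" and p = "[0, 5, 6]"
   and ?tab5.0 = "[([(0, 1)], [[1, 3], [3, 0, 4, 2, 5, 1], [1, 4, 3, 2, 0, 5, 6]]),
      ([(0, 2)], [[2, 3], [3, 0, 4, 1, 5, 2], [2, 4, 3, 1, 0, 5, 6]]),
      ([(0, 3)], [[3, 1], [1, 0, 5, 2, 4, 3], [3, 2, 0, 4, 1, 5, 6]]),
      ([(1, 3)], [[0, 1], [3, 0, 4, 2, 5, 1], [1, 4, 3, 2, 0, 5, 6]]),
      ([(2, 3)], [[0, 1], [2, 0, 4, 3, 1, 5, 6], [3, 0, 5, 2, 4, 1]]),
      ([(0, 4)], [[4, 1], [1, 0, 5, 2, 3, 4], [4, 2, 0, 3, 1, 5, 6]]),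
      ([(1, 4)], [[0, 1], [4, 0, 3, 2, 5, 1], [1, 3, 4, 2, 0, 5, 6]]),
      ([(2, 4)], [[0, 1], [2, 0, 3, 4, 1, 5, 6], [1, 3, 2, 5, 0, 4]]),
      ([(3, 4)], [[0, 1], [3, 0, 2, 4, 1, 5, 6], [1, 3, 2, 5, 0, 4]])]"
   and ?tab3.0 = "[([], [[0, 1, 5, 2], [2, 0, 5, 6]])]"])
    code_simp+

lemma red_leafpend3: "reducible [5, 6] []
    [(5, 6), (0, 5), (1, 5), (2, 5), (1, 2)] 3 [3, 5] f"
  by (rule reducible_trace[where mid = "[1]" and qs = "[0, 2]" and ?tab = "[(([], []), ([Pt 6, Pt 5, Pt 1, Bw 0],
      [Pt 0, Pt 5, Pt 2, Pt 1, Fw 1])),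
      (([], [0]), ([Pt 6, Pt 5, Pt 1, Fw 1, Pt 0],
      [Fw 0, Pt 1, Pt 2, Pt 5, Pt 0, Fw 2])),
      (([], [2]), ([Pt 6, Pt 5, Pt 1, Pt 2, Fw 2],
      [Pt 0, Pt 5, Pt 2, Bw 1, Pt 1, Bw 0])),
      (([], [0, 2]), ([Pt 6, Pt 5, Pt 0, Bw 1, Pt 1, Pt 2, Fw 3],
      [Fw 0, Pt 1, Pt 5, Pt 2, Bw 2, Pt 0])),
      (([0], [2]), ([Pt 6, Pt 5, Pt 2, Pt 1, Bw 1, Pt 0],
      [Fw 0, Pt 0, Pt 5, Pt 1, Fw 2, Pt 2, Fw 3])),
      (([0, 2], []), ([Pt 6, Pt 5, Pt 1, Pt 2, Bw 1, Pt 0],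
      [Fw 0, Pt 0, Pt 5, Pt 2, Fw 2, Pt 1, Fw 3]))]"
   and ?tab5.0 = "[([(1, 2)], [[0, 1, 3, 2], [1, 4, 2, 5, 0, 3], [3, 4, 0, 2, 1, 5, 6]])]"
   and ?tab3.0 = "[]"])
    code_simp+

section \<open>Reductions: two nonadjacent vertices\<close>

lemma red_tail_add: "reducible [5, 6] [(1, 2)]
    [(0, 5), (1, 5), (2, 5), (0, 6)] 3 [3, 5] f"
  by (rule reducible_lift[where qs = "[0, 1, 2]" and ls = "[(1, 5, 2)]" and p = "[5, 0, 6]"
   and ?tab5.0 = "[([(0, 1)], [[0, 2], [1, 3, 0, 4, 2, 5], [2, 3, 4, 1, 5, 0, 6]]),
      ([(0, 2)], [[0, 1], [1, 3, 0, 4, 2, 5], [2, 3, 4, 1, 5, 0, 6]]),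
      ([(0, 3)], [[0, 1], [1, 3, 2, 4, 0, 5], [3, 4, 1, 5, 2, 0, 6]]),
      ([(1, 3)], [[1, 0, 2], [3, 0, 4, 2, 5], [2, 3, 4, 1, 5, 0, 6]]),
      ([(2, 3)], [[2, 0, 1], [3, 0, 4, 1, 5], [1, 3, 4, 2, 5, 0, 6]]),
      ([(0, 4)], [[0, 1], [1, 3, 0, 5, 2, 4], [5, 1, 4, 3, 2, 0, 6]]),
      ([(1, 4)], [[1, 0, 2], [2, 3, 1, 5, 0, 4], [5, 2, 4, 3, 0, 6]]),
      ([(2, 4)], [[2, 0, 1], [1, 3, 2, 5, 0, 4], [5, 1, 4, 3, 0, 6]]),
      ([(3, 4)], [[3, 0, 1], [1, 3, 2, 4, 0, 5], [4, 1, 5, 2, 0, 6]])]"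
   and ?tab3.0 = "[([], [[5, 0, 1], [1, 5, 2, 0, 6]])]"])
    code_simp+

lemma red_tail: "reducible [5, 6] []
    [(0, 5), (1, 5), (2, 5), (0, 6), (1, 2)] 3 [3, 5] f"
  by (rule reducible_trace[where mid = "[1]" and qs = "[0, 2]" and ?tab = "[(([], []), ([Pt 5, Pt 1, Bw 0],
      [Pt 6, Pt 0, Pt 5, Pt 2, Pt 1, Fw 1])),
      (([], [0]), ([Pt 5, Pt 1, Fw 1, Pt 0, Pt 6],
      [Fw 0, Pt 1, Pt 2, Pt 5, Pt 0, Fw 2])),
      (([], [2]), ([Pt 5, Pt 1, Pt 2, Fw 2],
      [Pt 6, Pt 0, Pt 5, Pt 2, Bw 1, Pt 1, Bw 0])),
      (([], [0, 2]), ([Pt 5, Pt 0, Bw 1, Pt 1, Pt 2, Fw 3],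
      [Pt 6, Pt 0, Fw 2, Pt 2, Pt 5, Pt 1, Bw 0])),
      (([0], [2]), ([Pt 5, Pt 2, Pt 1, Bw 1, Pt 0, Pt 6],
      [Fw 0, Pt 0, Pt 5, Pt 1, Fw 2, Pt 2, Fw 3])),
      (([0, 2], []), ([Pt 5, Pt 1, Pt 2, Bw 1, Pt 0, Pt 6],
      [Fw 0, Pt 0, Pt 5, Pt 2, Fw 2, Pt 1, Fw 3]))]"
   and ?tab5.0 = "[([(1, 2)], [[1, 0, 2, 3], [3, 0, 4, 1, 2, 5], [2, 4, 3, 1, 5, 0, 6]])]"
   and ?tab3.0 = "[]"])
    code_simp+

lemma red_pend_deg2: "reducible [5, 6] []
    [(0, 6), (0, 5), (1, 5)] 2 [3, 5] f"
  by (rule reducible_lift[where qs = "[0, 1]" and ls = "[]" and p = "[6, 0, 5, 1]"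
   and ?tab5.0 = "[([(0, 1)], [[0, 2], [2, 1, 3, 4, 0, 5], [6, 0, 3, 2, 4, 1, 5]]),
      ([(0, 2)], [[0, 1], [2, 1, 3, 4, 0, 5], [6, 0, 3, 2, 4, 1, 5]]),
      ([(1, 2)], [[2, 0, 1], [1, 3, 0, 4, 2], [2, 3, 4, 1, 5, 0, 6]]),
      ([(0, 3)], [[0, 1], [3, 1, 2, 4, 0, 5], [6, 0, 2, 3, 4, 1, 5]]),
      ([(1, 3)], [[3, 0, 1], [1, 2, 0, 4, 3], [3, 2, 4, 1, 5, 0, 6]]),
      ([(2, 3)], [[1, 0, 2], [3, 0, 4, 1, 2], [2, 4, 3, 1, 5, 0, 6]]),
      ([(0, 4)], [[0, 1], [4, 1, 2, 3, 0, 5], [6, 0, 2, 4, 3, 1, 5]]),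
      ([(1, 4)], [[4, 0, 1], [1, 2, 0, 3, 4], [4, 2, 3, 1, 5, 0, 6]]),
      ([(2, 4)], [[1, 0, 2], [4, 0, 3, 1, 2], [2, 3, 4, 1, 5, 0, 6]]),
      ([(3, 4)], [[1, 0, 2], [2, 1, 3, 0, 4], [3, 2, 4, 1, 5, 0, 6]])]"
   and ?tab3.0 = "[([], [[1, 0, 2], [2, 1, 5, 0, 6]])]"])
    code_simp+

lemma red_twin2: "reducible [5, 6] []
    [(0, 5), (1, 5), (0, 6), (1, 6)] 2 [3, 5] f"
  by (rule reducible_trace[where mid = "[0]" and qs = "[1]" and ?tab = "[(([], []), ([Fw 0, Pt 0, Pt 5],
      [Pt 5, Pt 1, Pt 6, Pt 0, Fw 1])),
      (([], [1]), ([Fw 0, Pt 0, Pt 5, Pt 1, Pt 6],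
      [Pt 6, Pt 0, Fw 1, Pt 1, Fw 2]))]"
   and ?tab5.0 = "[([(0, 1)], [[0, 2, 1], [2, 3, 0, 4, 1, 5], [2, 4, 3, 1, 6, 0, 5]]),
      ([(0, 2)], [[0, 1, 2], [2, 3, 0, 4, 1, 5], [2, 4, 3, 1, 6, 0, 5]]),
      ([(1, 2)], [[1, 0, 2], [2, 3, 0, 4, 1, 5], [2, 4, 3, 1, 6, 0, 5]]),
      ([(0, 3)], [[0, 1, 2], [2, 0, 4, 3, 1, 5], [3, 2, 4, 1, 6, 0, 5]]),
      ([(1, 3)], [[1, 0, 2], [2, 1, 4, 3, 0, 5], [3, 2, 4, 0, 6, 1, 5]]),
      ([(2, 3)], [[2, 0, 1, 3], [2, 1, 4, 0, 5], [2, 4, 3, 0, 6, 1, 5]]),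
      ([(0, 4)], [[0, 1, 2], [2, 0, 3, 4, 1, 5], [4, 2, 3, 1, 6, 0, 5]]),
      ([(1, 4)], [[1, 0, 2], [2, 1, 3, 4, 0, 5], [4, 2, 3, 0, 6, 1, 5]]),
      ([(2, 4)], [[2, 0, 1, 3], [3, 0, 4, 1, 5], [4, 3, 2, 1, 6, 0, 5]]),
      ([(3, 4)], [[3, 0, 1, 2], [2, 0, 4, 1, 5], [4, 2, 3, 1, 6, 0, 5]])]"
   and ?tab3.0 = "[([], [[2, 0, 1, 5], [2, 1, 6, 0, 5]])]"])
    code_simp+

lemma red_share2: "reducible [5, 6] []
    [(0, 5), (1, 5), (1, 6), (2, 6)] 3 [3, 5] f"
  by (rule reducible_lift[where qs = "[0, 1, 2]" and ls = "[]" and p = "[0, 5, 1, 6, 2]"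
   and ?tab5.0 = "[([(0, 1)], [[2, 0, 3, 1], [3, 2, 1, 4, 0], [3, 4, 2, 6, 1, 5, 0]]),
      ([(0, 2)], [[0, 1, 2], [0, 3, 1, 4, 2, 6], [2, 3, 4, 0, 5, 1, 6]]),
      ([(1, 2)], [[0, 1], [5, 0, 2, 3, 4, 1, 6], [5, 1, 3, 0, 4, 2, 6]]),
      ([(0, 3)], [[2, 0, 1, 3], [3, 2, 1, 4, 0], [3, 4, 2, 6, 1, 5, 0]]),
      ([(1, 3)], [[0, 1, 2], [3, 0, 2, 4, 1, 5], [5, 0, 4, 3, 2, 6, 1]]),
      ([(2, 3)], [[0, 1, 2], [2, 0, 3, 4, 1, 5], [3, 1, 6, 2, 4, 0, 5]]),
      ([(0, 4)], [[2, 0, 1, 3], [3, 0, 5, 1, 4, 2, 6], [4, 3, 2, 1, 6]]),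
      ([(1, 4)], [[0, 1, 2], [1, 3, 0, 4, 2, 6], [4, 3, 2, 0, 5, 1, 6]]),
      ([(2, 4)], [[0, 1, 2], [2, 0, 3, 4, 1, 6], [4, 0, 5, 1, 3, 2, 6]]),
      ([(3, 4)], [[0, 1, 2], [3, 0, 2, 4, 1, 6], [4, 0, 5, 1, 3, 2, 6]])]"
   and ?tab3.0 = "[([], [[0, 1, 2, 6], [2, 0, 5, 1, 6]])]"])
    code_simp+

lemma red_disj2: "reducible [5, 6] []
    [(0, 5), (1, 5), (2, 6), (3, 6), (1, 2)] 4 [3, 5] f"
  by (rule reducible_lift[where qs = "[0, 1, 2, 3]" and ls = "[]" and p = "[0, 5, 1, 2, 6, 3]"
   and ?tab5.0 = "[([(1, 2)], [[0, 1, 3, 2], [3, 0, 2, 4, 1, 5], [5, 0, 4, 3, 6, 2, 1]])]"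
   and ?tab3.0 = "[]"])
    code_simp+

lemma red_sub32: "reducible [5, 6] []
    [(0, 5), (1, 5), (2, 5), (0, 6), (1, 6)] 3 [3, 5] f"
  by (rule reducible_trace[where mid = "[0]" and qs = "[1, 2]" and ?tab = "[(([], []), ([Pt 5, Pt 0, Bw 0],
      [Pt 2, Pt 5, Pt 1, Pt 6, Pt 0, Fw 1])),
      (([], [1]), ([Pt 5, Pt 0, Pt 6, Pt 1, Fw 2],
      [Pt 2, Pt 5, Pt 1, Bw 1, Pt 0, Bw 0])),
      (([], [2]), ([Pt 5, Pt 0, Fw 1, Pt 2],
      [Fw 0, Pt 0, Pt 6, Pt 1, Pt 5, Pt 2, Fw 2])),
      (([], [1, 2]), ([Pt 5, Pt 0, Pt 6, Pt 1, Fw 2, Pt 2],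
      [Fw 0, Pt 0, Fw 1, Pt 1, Pt 5, Pt 2, Fw 3])),
      (([1], [2]), ([Pt 5, Pt 1, Pt 6, Pt 0, Fw 2, Pt 2],
      [Fw 0, Pt 1, Fw 1, Pt 0, Pt 5, Pt 2, Fw 3])),
      (([1, 2], []), ([Pt 5, Pt 0, Pt 6, Pt 1, Fw 1, Pt 2],
      [Fw 0, Pt 1, Pt 5, Pt 2, Fw 2, Pt 0, Fw 3]))]"
   and ?tab5.0 = "[([(0, 1)], [[0, 2, 1], [2, 3, 4, 0, 5, 1, 6], [5, 2, 4, 1, 3, 0, 6]]),
      ([(0, 2)], [[0, 1, 2], [2, 3, 4, 0, 5, 1, 6], [5, 2, 4, 1, 3, 0, 6]]),
      ([(1, 2)], [[1, 0, 2], [2, 3, 4, 0, 5, 1, 6], [5, 2, 4, 1, 3, 0, 6]]),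
      ([(0, 3)], [[0, 1, 2], [3, 1, 5, 2, 4, 0, 6], [5, 0, 2, 3, 4, 1, 6]]),
      ([(1, 3)], [[1, 0, 2], [3, 0, 5, 2, 4, 1, 6], [5, 1, 2, 3, 4, 0, 6]]),
      ([(2, 3)], [[3, 0, 1, 2], [2, 0, 5, 1, 4, 3], [3, 1, 6, 0, 4, 2, 5]]),
      ([(0, 4)], [[0, 1, 2], [4, 1, 5, 2, 3, 0, 6], [5, 0, 2, 4, 3, 1, 6]]),
      ([(1, 4)], [[1, 0, 2], [4, 0, 5, 2, 3, 1, 6], [5, 1, 2, 4, 3, 0, 6]]),
      ([(2, 4)], [[4, 0, 1, 2], [2, 0, 5, 1, 3, 4], [4, 1, 6, 0, 3, 2, 5]]),
      ([(3, 4)], [[2, 0, 1, 3], [4, 0, 5, 1, 2, 3], [3, 0, 6, 1, 4, 2, 5]])]"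
   and ?tab3.0 = "[([], [[2, 0, 5, 1, 6], [5, 2, 1, 0, 6]])]"])
    code_simp+

lemma red_cross32_add: "reducible [5, 6] [(1, 2)]
    [(0, 5), (1, 5), (2, 5), (0, 6), (3, 6)] 4 [3, 5] f"
  by (rule reducible_lift[where qs = "[0, 1, 2, 3]" and ls = "[(1, 5, 2)]" and p = "[5, 0, 6, 3]"
   and ?tab5.0 = "[([(0, 1)], [[0, 2, 3], [1, 3, 4, 2, 5, 0, 6], [5, 1, 4, 0, 3, 6]]),
      ([(0, 2)], [[0, 1, 3], [2, 3, 4, 1, 5, 0, 6], [5, 2, 4, 0, 3, 6]]),
      ([(0, 3)], [[0, 1], [1, 3, 4, 2, 5, 0, 6], [5, 1, 4, 0, 2, 3, 6]]),
      ([(1, 3)], [[1, 0, 2], [2, 3, 4, 1, 5, 0, 6], [5, 2, 4, 0, 3, 6]]),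
      ([(2, 3)], [[2, 0, 1], [1, 3, 4, 2, 5, 0, 6], [5, 1, 4, 0, 3, 6]]),
      ([(0, 4)], [[0, 1, 3], [4, 1, 5, 0, 2, 3, 6], [5, 2, 4, 3, 0, 6]]),
      ([(1, 4)], [[1, 0, 2, 3], [4, 0, 3, 1, 5, 2], [2, 4, 3, 6, 0, 5]]),
      ([(2, 4)], [[2, 0, 1, 3], [4, 0, 3, 2, 5, 1], [1, 4, 3, 6, 0, 5]]),
      ([(3, 4)], [[4, 0, 1], [1, 3, 2, 5, 0, 6], [5, 1, 4, 2, 0, 3, 6]])]"
   and ?tab3.0 = "[]"])
    code_simp+

lemma red_cross32: "reducible [5, 6] []
    [(0, 5), (1, 5), (2, 5), (0, 6), (3, 6), (1, 2)] 4 [3, 5] f"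
  by (rule reducible_trace[where mid = "[1]" and qs = "[0, 2, 3]" and ?tab = "[(([], []), ([Pt 5, Pt 1, Bw 0],
      [Pt 3, Pt 6, Pt 0, Pt 5, Pt 2, Pt 1, Fw 1])),
      (([], [0]), ([Pt 5, Pt 1, Fw 1, Pt 0, Pt 6, Pt 3],
      [Fw 0, Pt 1, Pt 2, Pt 5, Pt 0, Fw 2])),
      (([], [2]), ([Pt 5, Pt 1, Pt 2, Fw 2],
      [Pt 3, Pt 6, Pt 0, Pt 5, Pt 2, Bw 1, Pt 1, Bw 0])),
      (([], [3]), ([Pt 5, Pt 1, Fw 1, Pt 3],
      [Fw 0, Pt 1, Pt 2, Pt 5, Pt 0, Pt 6, Pt 3, Fw 2])),
      (([], [0, 2]), ([Pt 5, Pt 0, Bw 1, Pt 1, Pt 2, Fw 3],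
      [Pt 3, Pt 6, Pt 0, Fw 2, Pt 2, Pt 5, Pt 1, Bw 0])),
      (([0], [2]), ([Pt 5, Pt 2, Pt 1, Bw 1, Pt 0, Pt 6, Pt 3],
      [Fw 0, Pt 0, Pt 5, Pt 1, Fw 2, Pt 2, Fw 3])),
      (([0, 2], []), ([Pt 5, Pt 1, Pt 2, Bw 1, Pt 0, Pt 6, Pt 3],
      [Fw 0, Pt 0, Pt 5, Pt 2, Fw 2, Pt 1, Fw 3])),
      (([], [0, 3]), ([Pt 5, Pt 1, Fw 1, Pt 0, Pt 6, Pt 3],
      [Fw 0, Pt 1, Pt 2, Pt 5, Pt 0, Fw 2, Pt 3, Fw 3])),
      (([0], [3]), ([Pt 5, Pt 1, Bw 1, Pt 0, Pt 6, Pt 3],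
      [Fw 0, Pt 0, Pt 5, Pt 2, Pt 1, Fw 2, Pt 3, Fw 3])),
      (([0, 3], []), ([Pt 5, Pt 1, Bw 2, Pt 3, Pt 6, Pt 0, Bw 0],
      [Pt 3, Bw 1, Pt 0, Pt 5, Pt 2, Pt 1, Fw 3])),
      (([], [2, 3]), ([Pt 5, Pt 1, Pt 2, Fw 2, Pt 3],
      [Fw 0, Pt 1, Fw 1, Pt 2, Pt 5, Pt 0, Pt 6, Pt 3, Fw 3])),
      (([2], [3]), ([Pt 5, Pt 2, Pt 1, Fw 2, Pt 3],
      [Fw 0, Pt 2, Fw 1, Pt 1, Pt 5, Pt 0, Pt 6, Pt 3, Fw 3])),
      (([2, 3], []), ([Pt 5, Pt 0, Pt 6, Pt 3, Bw 1, Pt 2, Pt 1, Fw 3],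
      [Fw 0, Pt 2, Pt 5, Pt 1, Bw 2, Pt 3])),
      (([], [0, 2, 3]), ([Pt 5, Pt 0, Bw 1, Pt 1, Pt 2, Fw 3, Pt 3],
      [Fw 0, Pt 1, Pt 5, Pt 2, Bw 2, Pt 0, Pt 6, Pt 3, Fw 4])),
      (([0], [2, 3]), ([Pt 5, Pt 2, Pt 1, Bw 1, Pt 0, Pt 6, Pt 3],
      [Fw 0, Pt 0, Pt 5, Pt 1, Fw 2, Pt 2, Fw 3, Pt 3, Fw 4])),
      (([0, 2], [3]), ([Pt 5, Pt 1, Pt 2, Bw 1, Pt 0, Pt 6, Pt 3],
      [Fw 0, Pt 0, Pt 5, Pt 2, Fw 2, Pt 1, Fw 3, Pt 3, Fw 4])),
      (([0, 2, 3], []), ([Pt 5, Pt 0, Pt 6, Pt 3, Bw 2, Pt 2, Pt 1, Fw 4],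
      [Fw 0, Pt 0, Fw 1, Pt 2, Pt 5, Pt 1, Bw 3, Pt 3])),
      (([], [0, 3, 2]), ([Pt 5, Pt 0, Pt 6, Pt 3, Fw 3, Pt 2, Pt 1, Bw 0],
      [Pt 3, Bw 2, Pt 0, Bw 1, Pt 1, Pt 5, Pt 2, Fw 4])),
      (([0], [3, 2]), ([Pt 5, Pt 0, Pt 6, Pt 3, Bw 2, Pt 1, Pt 2, Fw 4],
      [Fw 0, Pt 0, Fw 1, Pt 1, Pt 5, Pt 2, Bw 3, Pt 3])),
      (([0, 3], [2]), ([Pt 5, Pt 2, Pt 1, Bw 2, Pt 3, Pt 6, Pt 0, Bw 0],
      [Pt 3, Bw 1, Pt 0, Pt 5, Pt 1, Fw 3, Pt 2, Fw 4])),
      (([0, 3, 2], []), ([Pt 5, Pt 1, Pt 2, Bw 2, Pt 3, Pt 6, Pt 0, Bw 0],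
      [Pt 3, Bw 1, Pt 0, Pt 5, Pt 2, Fw 3, Pt 1, Fw 4])),
      (([], [2, 0, 3]), ([Pt 5, Pt 1, Pt 2, Fw 2, Pt 0, Pt 6, Pt 3],
      [Fw 0, Pt 1, Fw 1, Pt 2, Pt 5, Pt 0, Fw 3, Pt 3, Fw 4])),
      (([2], [0, 3]), ([Pt 5, Pt 2, Pt 1, Fw 2, Pt 0, Pt 6, Pt 3],
      [Fw 0, Pt 2, Fw 1, Pt 1, Pt 5, Pt 0, Fw 3, Pt 3, Fw 4])),
      (([2, 0], [3]), ([Pt 5, Pt 0, Bw 1, Pt 2, Pt 1, Fw 3, Pt 3],
      [Fw 0, Pt 2, Pt 5, Pt 1, Bw 2, Pt 0, Pt 6, Pt 3, Fw 4])),
      (([2, 0, 3], []), ([Pt 5, Pt 0, Pt 6, Pt 3, Fw 3, Pt 1, Pt 2, Bw 0],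
      [Pt 3, Bw 2, Pt 0, Bw 1, Pt 2, Pt 5, Pt 1, Fw 4]))]"
   and ?tab5.0 = "[([(1, 2)], [[1, 0, 2, 3], [2, 4, 0, 5, 1, 3, 6], [5, 2, 1, 4, 3, 0, 6]])]"
   and ?tab3.0 = "[]"])
    code_simp+

text \<open>Over a triangle the result is \<open>K_5\<close> without the edge between the new
  vertices; hence 3 is missing from the list of orders.\<close>

lemma red_same3: "reducible [5, 6] []
    [(0, 5), (1, 5), (2, 5), (0, 6), (1, 6), (2, 6)] 3 [5] f"
  by (rule reducible_trace[where mid = "[0]" and qs = "[1, 2]" and ?tab = "[(([], []), ([Pt 5, Pt 1, Pt 6, Pt 0, Bw 0],
      [Pt 6, Pt 2, Pt 5, Pt 0, Fw 1])),
      (([], [1]), ([Pt 5, Pt 0, Pt 6, Pt 1, Fw 2],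
      [Pt 6, Pt 2, Pt 5, Pt 1, Bw 1, Pt 0, Bw 0])),
      (([], [2]), ([Pt 5, Pt 0, Pt 6, Pt 2, Fw 2],
      [Pt 6, Pt 1, Pt 5, Pt 2, Bw 1, Pt 0, Bw 0])),
      (([], [1, 2]), ([Pt 5, Pt 0, Pt 6, Pt 1, Fw 2, Pt 2, Fw 3],
      [Pt 6, Pt 2, Pt 5, Pt 1, Bw 1, Pt 0, Bw 0])),
      (([1], [2]), ([Pt 5, Pt 0, Bw 1, Pt 1, Pt 6, Pt 2, Fw 3],
      [Pt 6, Pt 0, Fw 2, Pt 2, Pt 5, Pt 1, Bw 0])),
      (([1, 2], []), ([Pt 5, Pt 0, Pt 6, Pt 2, Bw 1, Pt 1, Bw 0],
      [Pt 6, Pt 1, Pt 5, Pt 2, Fw 2, Pt 0, Fw 3]))]"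
   and ?tab5.0 = "[([(0, 1)], [[0, 2, 1, 3], [3, 0, 4, 2, 5, 1, 6], [1, 4, 3, 2, 6, 0, 5]]),
      ([(0, 2)], [[0, 1, 2, 3], [3, 0, 4, 1, 5, 2, 6], [2, 4, 3, 1, 6, 0, 5]]),
      ([(1, 2)], [[1, 0, 2, 3], [3, 0, 4, 1, 5, 2, 6], [2, 4, 3, 1, 6, 0, 5]]),
      ([(0, 3)], [[0, 1, 2, 3], [5, 0, 2, 6, 1, 4, 3], [3, 1, 5, 2, 4, 0, 6]]),
      ([(1, 3)], [[1, 0, 2, 3], [5, 0, 6, 1, 2, 4, 3], [3, 0, 4, 1, 5, 2, 6]]),
      ([(2, 3)], [[2, 0, 1, 3], [5, 0, 6, 1, 2, 4, 3], [3, 0, 4, 1, 5, 2, 6]]),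
      ([(0, 4)], [[0, 1, 2, 3], [3, 0, 5, 1, 4, 2, 6], [4, 3, 1, 6, 0, 2, 5]]),
      ([(1, 4)], [[1, 0, 2, 3], [3, 0, 4, 2, 5, 1, 6], [4, 3, 1, 2, 6, 0, 5]]),
      ([(2, 4)], [[2, 0, 1, 3], [3, 0, 4, 1, 5, 2, 6], [4, 3, 2, 1, 6, 0, 5]]),
      ([(3, 4)], [[3, 0, 1, 2, 4], [5, 0, 2, 6, 1, 3], [3, 2, 5, 1, 4, 0, 6]])]"
   and ?tab3.0 = "[]"])
    code_simp+

lemma red_same3_path: "reducible [5, 6] [(0, 2), (1, 2)]
    [(0, 5), (1, 5), (2, 5), (0, 6), (1, 6), (2, 6), (0, 1)] 3 [3, 5] f"
  by (rule reducible_lift[where qs = "[0, 1, 2]" and ls = "[(0, 5, 2), (1, 6, 2)]" and p = "[5, 1, 0, 6]"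
   and ?tab5.0 = "[([(0, 1)], [[0, 3, 1], [5, 0, 4, 1, 6, 2, 3], [3, 4, 2, 5, 1, 0, 6]])]"
   and ?tab3.0 = "[]"])
    code_simp+

text \<open>The added triangle is read as the closed walk 1, 0, 2, 1: the double subdivision permits
  its outer ends \<open>z\<close> and \<open>t\<close> to coincide.\<close>

lemma red_same3_tri: "reducible [5, 6] [(0, 2), (1, 2), (0, 1)]
    [(0, 5), (1, 5), (2, 5), (0, 6), (1, 6), (2, 6)] 3 [3, 5] f"
  by (rule reducible_double[where z = 1 and x = 0 and y = 2 and t = 1
   and ?tab5.0 = "[([(0, 3)], [[3, 1], [0, 4, 2, 5, 1, 6], [1, 4, 3, 2, 6, 0, 5]]),
      ([(1, 3)], [[3, 0], [0, 4, 2, 5, 1, 6], [1, 4, 3, 2, 6, 0, 5]]),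
      ([(2, 3)], [[3, 0], [0, 4, 1, 5, 2, 6], [2, 4, 3, 1, 6, 0, 5]]),
      ([(0, 4)], [[0, 3], [3, 1, 4, 2, 5, 0, 6], [4, 3, 2, 6, 1, 5]]),
      ([(1, 4)], [[1, 3], [3, 0, 4, 2, 5, 1, 6], [4, 3, 2, 6, 0, 5]]),
      ([(2, 4)], [[2, 3], [3, 0, 4, 1, 5, 2, 6], [4, 3, 1, 6, 0, 5]]),
      ([(3, 4)], [[3, 0], [0, 4, 1, 5, 2, 6], [4, 2, 3, 1, 6, 0, 5]])]"
   and ?tab3.0 = "[([], [[5, 0, 6, 1], [1, 5, 2, 6]])]"])
    code_simp+

text \<open>The new vertices share the neighbours 0 and 1 and have the private neighbours 2 and 3.
  The five variants differ in the edges that are added or deleted among the old vertices; which one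
  keeps the graph connected depends on the edges present.\<close>

lemma red_type_I_add3: "reducible [5, 6] [(0, 2), (0, 1), (1, 3)]
    [(0, 5), (1, 5), (2, 5), (0, 6), (1, 6), (3, 6)] 4 [3, 5] f"
  by (rule reducible_double[where z = 2 and x = 0 and y = 1 and t = 3
   and ?tab5.0 = "[([(1, 2)], [[2, 3], [3, 0, 4, 2, 5, 1, 6], [1, 4, 3, 6, 0, 5]]),
      ([(0, 3)], [[3, 2], [2, 1, 4, 3, 6, 0, 5], [0, 4, 2, 5, 1, 6]]),
      ([(2, 3)], [[2, 1], [3, 0, 4, 2, 5, 1, 6], [1, 4, 3, 6, 0, 5]]),
      ([(0, 4)], [[0, 3], [3, 2, 4, 1, 5, 0, 6], [4, 3, 6, 1, 2, 5]]),
      ([(1, 4)], [[1, 2], [2, 3, 4, 0, 6, 1, 5], [4, 2, 5, 0, 3, 6]]),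
      ([(2, 4)], [[2, 1], [4, 0, 3, 2, 5, 1, 6], [1, 4, 3, 6, 0, 5]]),
      ([(3, 4)], [[3, 0], [0, 4, 1, 5, 2, 3, 6], [4, 2, 1, 6, 0, 5]])]"
   and ?tab3.0 = "[]"])
    code_simp+

lemma red_type_I_add2: "reducible [5, 6] [(0, 2), (0, 3)]
    [(0, 5), (1, 5), (2, 5), (0, 6), (1, 6), (3, 6)] 4 [3, 5] f"
  by (rule reducible_lift[where qs = "[0, 1, 2, 3]" and ls = "[(2, 5, 0), (0, 6, 3)]" and p = "[5, 1, 6]"
   and ?tab5.0 = "[([(0, 1)], [[1, 2], [2, 3, 4, 0, 5, 1, 6], [5, 2, 4, 1, 3, 6, 0]]),
      ([(1, 2)], [[1, 0], [2, 3, 4, 0, 5, 1, 6], [5, 2, 4, 1, 3, 6, 0]]),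
      ([(1, 3)], [[1, 0], [3, 2, 4, 0, 5, 1, 6], [5, 2, 1, 4, 3, 6, 0]]),
      ([(2, 3)], [[2, 1, 0], [3, 1, 4, 2, 5, 0, 6], [0, 4, 3, 6, 1, 5]]),
      ([(0, 4)], [[0, 1, 2], [2, 3, 4, 1, 6, 0, 5], [4, 2, 5, 1, 3, 6]]),
      ([(1, 4)], [[1, 0], [0, 4, 2, 3, 6, 1, 5], [4, 3, 1, 2, 5, 0, 6]]),
      ([(2, 4)], [[2, 1, 0], [0, 4, 1, 5, 2, 3, 6], [4, 3, 1, 6, 0, 5]]),
      ([(3, 4)], [[3, 1, 0], [0, 4, 1, 5, 2, 3, 6], [4, 2, 1, 6, 0, 5]])]"
   and ?tab3.0 = "[]"])
    code_simp+

lemma red_type_I_add: "reducible [5, 6] [(2, 3)]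
    [(0, 5), (1, 5), (2, 5), (0, 6), (1, 6), (3, 6)] 4 [3, 5] f"
  by (rule reducible_trace[where mid = "[2, 3]" and qs = "[0, 1]" and ?tab = "[(([], []), ([Pt 5, Pt 0, Pt 6],
      [Fw 0, Pt 2, Pt 5, Pt 1, Pt 6, Pt 3, Fw 1])),
      (([], [0]), ([Pt 5, Pt 0, Pt 6],
      [Fw 0, Pt 2, Pt 5, Pt 1, Pt 6, Pt 3, Fw 1, Pt 0, Fw 2])),
      (([0], []), ([Pt 5, Pt 0, Pt 6],
      [Fw 0, Pt 0, Fw 1, Pt 2, Pt 5, Pt 1, Pt 6, Pt 3, Fw 2])),
      (([], [1]), ([Pt 5, Pt 0, Pt 6, Pt 1, Fw 2],
      [Pt 6, Pt 3, Fw 1, Pt 1, Pt 5, Pt 2, Bw 0])),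
      (([1], []), ([Pt 5, Pt 1, Pt 6],
      [Fw 0, Pt 1, Fw 1, Pt 2, Pt 5, Pt 0, Pt 6, Pt 3, Fw 2])),
      (([], [0, 1]), ([Pt 5, Pt 0, Pt 6, Pt 1, Fw 3],
      [Pt 6, Pt 3, Fw 1, Pt 0, Fw 2, Pt 1, Pt 5, Pt 2, Bw 0])),
      (([0], [1]), ([Pt 5, Pt 0, Pt 6, Pt 1, Fw 3],
      [Pt 6, Pt 3, Fw 2, Pt 1, Pt 5, Pt 2, Bw 1, Pt 0, Bw 0])),
      (([0, 1], []), ([Pt 5, Pt 1, Bw 1, Pt 0, Pt 6],
      [Fw 0, Pt 0, Pt 5, Pt 2, Bw 2, Pt 1, Pt 6, Pt 3, Fw 3])),
      (([], [1, 0]), ([Pt 5, Pt 0, Bw 2, Pt 1, Pt 6],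
      [Fw 0, Pt 2, Pt 5, Pt 1, Bw 1, Pt 3, Pt 6, Pt 0, Fw 3])),
      (([1], [0]), ([Pt 5, Pt 1, Pt 6, Pt 0, Fw 3],
      [Pt 6, Pt 3, Fw 2, Pt 0, Pt 5, Pt 2, Bw 1, Pt 1, Bw 0])),
      (([1, 0], []), ([Pt 5, Pt 0, Bw 1, Pt 1, Pt 6],
      [Fw 0, Pt 1, Pt 5, Pt 2, Bw 2, Pt 0, Pt 6, Pt 3, Fw 3]))]"
   and ?tab5.0 = "[([(0, 1)], [[0, 2, 1], [5, 0, 3, 6, 1, 4, 2], [2, 5, 1, 3, 4, 0, 6]]),
      ([(0, 2)], [[0, 1, 2], [5, 0, 3, 6, 1, 4, 2], [2, 5, 1, 3, 4, 0, 6]]),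
      ([(1, 2)], [[1, 0, 2], [5, 0, 3, 6, 1, 4, 2], [2, 5, 1, 3, 4, 0, 6]]),
      ([(0, 3)], [[0, 1, 2], [2, 0, 4, 3, 6, 1, 5], [3, 1, 4, 2, 5, 0, 6]]),
      ([(1, 3)], [[1, 0, 2], [2, 1, 4, 3, 6, 0, 5], [3, 0, 4, 2, 5, 1, 6]]),
      ([(0, 4)], [[0, 1, 2], [2, 0, 5, 1, 6, 3, 4], [5, 2, 4, 1, 3, 0, 6]]),
      ([(1, 4)], [[1, 0, 2], [2, 1, 5, 0, 6, 3, 4], [5, 2, 4, 0, 3, 1, 6]]),
      ([(2, 4)], [[2, 0, 1, 3], [3, 4, 0, 6, 1, 2, 5], [4, 1, 5, 0, 3, 6]]),
      ([(3, 4)], [[3, 0, 1, 2], [2, 4, 0, 5, 1, 3, 6], [4, 1, 6, 0, 2, 5]])]"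
   and ?tab3.0 = "[]"])
    code_simp+

lemma red_type_I: "reducible [5, 6] []
    [(0, 5), (1, 5), (2, 5), (0, 6), (1, 6), (3, 6), (2, 3)] 4 [3, 5] f"
  by (rule reducible_trace[where mid = "[0]" and qs = "[1, 2, 3]" and ?tab = "[(([], []), ([Pt 5, Pt 1, Pt 6, Pt 0, Bw 0],
      [Pt 6, Pt 3, Pt 2, Pt 5, Pt 0, Fw 1])),
      (([], [1]), ([Pt 5, Pt 0, Pt 6, Pt 1, Fw 2],
      [Pt 6, Pt 3, Pt 2, Pt 5, Pt 1, Bw 1, Pt 0, Bw 0])),
      (([], [2]), ([Pt 5, Pt 0, Pt 6, Pt 3, Pt 2, Fw 2],
      [Pt 6, Pt 1, Pt 5, Pt 2, Bw 1, Pt 0, Bw 0])),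
      (([], [3]), ([Pt 5, Pt 0, Pt 6, Pt 3, Fw 2],
      [Pt 6, Pt 1, Pt 5, Pt 2, Pt 3, Bw 1, Pt 0, Bw 0])),
      (([], [1, 2]), ([Pt 5, Pt 0, Pt 6, Pt 1, Fw 2, Pt 2, Fw 3],
      [Pt 6, Pt 3, Pt 2, Pt 5, Pt 1, Bw 1, Pt 0, Bw 0])),
      (([1], [2]), ([Pt 5, Pt 0, Bw 1, Pt 1, Pt 6, Pt 3, Pt 2, Fw 3],
      [Pt 6, Pt 0, Fw 2, Pt 2, Pt 5, Pt 1, Bw 0])),
      (([1, 2], []), ([Pt 5, Pt 0, Pt 6, Pt 3, Pt 2, Bw 1, Pt 1, Bw 0],
      [Pt 6, Pt 1, Pt 5, Pt 2, Fw 2, Pt 0, Fw 3])),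
      (([], [1, 3]), ([Pt 5, Pt 0, Pt 6, Pt 1, Fw 2, Pt 3, Fw 3],
      [Pt 6, Pt 3, Pt 2, Pt 5, Pt 1, Bw 1, Pt 0, Bw 0])),
      (([1], [3]), ([Pt 5, Pt 0, Bw 1, Pt 1, Pt 6, Pt 3, Fw 3],
      [Pt 6, Pt 0, Fw 2, Pt 3, Pt 2, Pt 5, Pt 1, Bw 0])),
      (([1, 3], []), ([Pt 5, Pt 0, Pt 6, Pt 3, Bw 1, Pt 1, Bw 0],
      [Pt 6, Pt 1, Pt 5, Pt 2, Pt 3, Fw 2, Pt 0, Fw 3])),
      (([], [2, 3]), ([Pt 5, Pt 0, Fw 1, Pt 2, Pt 3, Pt 6],
      [Fw 0, Pt 0, Pt 6, Pt 1, Pt 5, Pt 2, Fw 2, Pt 3, Fw 3])),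
      (([2], [3]), ([Pt 5, Pt 0, Pt 6, Pt 3, Pt 2, Bw 0],
      [Pt 6, Pt 1, Pt 5, Pt 2, Fw 1, Pt 0, Fw 2, Pt 3, Fw 3])),
      (([2, 3], []), ([Pt 5, Pt 0, Pt 6, Pt 3, Pt 2, Bw 0],
      [Pt 6, Pt 1, Pt 5, Pt 2, Fw 1, Pt 3, Fw 2, Pt 0, Fw 3])),
      (([], [1, 2, 3]), ([Pt 5, Pt 0, Pt 6, Pt 1, Fw 2, Pt 2, Pt 3, Fw 4],
      [Pt 6, Pt 3, Bw 3, Pt 2, Pt 5, Pt 1, Bw 1, Pt 0, Bw 0])),
      (([1], [2, 3]), ([Pt 5, Pt 0, Fw 2, Pt 2, Pt 3, Pt 6, Pt 1, Bw 0],
      [Pt 6, Pt 0, Bw 1, Pt 1, Pt 5, Pt 2, Fw 3, Pt 3, Fw 4])),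
      (([1, 2], [3]), ([Pt 5, Pt 0, Pt 6, Pt 1, Fw 1, Pt 2, Pt 3, Fw 4],
      [Pt 6, Pt 3, Bw 3, Pt 0, Bw 2, Pt 2, Pt 5, Pt 1, Bw 0])),
      (([1, 2, 3], []), ([Pt 5, Pt 0, Pt 6, Pt 3, Pt 2, Bw 1, Pt 1, Bw 0],
      [Pt 6, Pt 1, Pt 5, Pt 2, Fw 2, Pt 3, Fw 3, Pt 0, Fw 4])),
      (([], [1, 3, 2]), ([Pt 5, Pt 0, Pt 6, Pt 1, Fw 2, Pt 3, Pt 2, Fw 4],
      [Pt 6, Pt 3, Fw 3, Pt 2, Pt 5, Pt 1, Bw 1, Pt 0, Bw 0])),
      (([1], [3, 2]), ([Pt 5, Pt 0, Bw 1, Pt 1, Pt 6, Pt 3, Pt 2, Fw 4],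
      [Pt 6, Pt 0, Fw 2, Pt 3, Fw 3, Pt 2, Pt 5, Pt 1, Bw 0])),
      (([1, 3], [2]), ([Pt 5, Pt 0, Pt 6, Pt 1, Fw 1, Pt 3, Pt 2, Fw 4],
      [Pt 6, Pt 3, Fw 2, Pt 0, Fw 3, Pt 2, Pt 5, Pt 1, Bw 0])),
      (([1, 3, 2], []), ([Pt 5, Pt 0, Bw 3, Pt 2, Pt 3, Bw 1, Pt 1, Pt 6],
      [Fw 0, Pt 1, Pt 5, Pt 2, Bw 2, Pt 3, Pt 6, Pt 0, Fw 4])),
      (([], [2, 1, 3]), ([Pt 5, Pt 0, Pt 6, Pt 1, Bw 2, Pt 2, Pt 3, Fw 4],
      [Pt 6, Pt 3, Bw 3, Pt 1, Pt 5, Pt 2, Bw 1, Pt 0, Bw 0])),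
      (([2], [1, 3]), ([Pt 5, Pt 0, Bw 1, Pt 2, Pt 3, Bw 3, Pt 1, Pt 6],
      [Fw 0, Pt 2, Pt 5, Pt 1, Bw 2, Pt 0, Pt 6, Pt 3, Fw 4])),
      (([2, 1], [3]), ([Pt 5, Pt 0, Pt 6, Pt 1, Bw 1, Pt 2, Pt 3, Fw 4],
      [Pt 6, Pt 3, Bw 3, Pt 0, Bw 2, Pt 1, Pt 5, Pt 2, Bw 0])),
      (([2, 1, 3], []), ([Pt 5, Pt 0, Pt 6, Pt 3, Bw 2, Pt 1, Bw 1, Pt 2, Bw 0],
      [Pt 6, Pt 1, Pt 5, Pt 2, Pt 3, Fw 3, Pt 0, Fw 4]))]"
   and ?tab5.0 = "[([(2, 3)], [[2, 0, 1, 3, 4], [3, 0, 4, 2, 5, 1, 6], [4, 1, 2, 3, 6, 0, 5]])]"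
   and ?tab3.0 = "[]"])
    code_simp+

text \<open>The smaller graph has \<open>0 3\<close> in place of the edge \<open>0 2\<close>, and
  the path through \<open>0 3\<close> is cut at that edge.\<close>

lemma red_type_I_move: "reducible [5, 6] [(0, 3)]
    [(0, 5), (1, 5), (2, 5), (0, 6), (1, 6), (3, 6), (0, 2)] 4 [3, 5] f"
  by (rule reducible_trace[where mid = "[0, 3]" and qs = "[1, 2]" and ?tab = "[(([], []), ([Pt 5, Pt 0, Pt 6],
      [Fw 0, Pt 0, Pt 2, Pt 5, Pt 1, Pt 6, Pt 3, Fw 1])),
      (([], [1]), ([Pt 5, Pt 0, Pt 6, Pt 1, Fw 2],
      [Pt 6, Pt 3, Fw 1, Pt 1, Pt 5, Pt 2, Pt 0, Bw 0])),
      (([1], []), ([Pt 5, Pt 0, Bw 1, Pt 1, Pt 6],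
      [Fw 0, Pt 1, Pt 5, Pt 2, Pt 0, Pt 6, Pt 3, Fw 2])),
      (([], [2]), ([Pt 5, Pt 0, Pt 6, Pt 3, Fw 1, Pt 2, Fw 2],
      [Pt 6, Pt 1, Pt 5, Pt 2, Pt 0, Bw 0])),
      (([2], []), ([Pt 5, Pt 2, Pt 0, Pt 6],
      [Fw 0, Pt 2, Fw 1, Pt 0, Pt 5, Pt 1, Pt 6, Pt 3, Fw 2])),
      (([], [1, 2]), ([Pt 5, Pt 0, Pt 6, Pt 1, Fw 2, Pt 2, Fw 3],
      [Pt 6, Pt 3, Fw 1, Pt 1, Pt 5, Pt 2, Pt 0, Bw 0])),
      (([1], [2]), ([Pt 5, Pt 0, Pt 2, Bw 2, Pt 3, Pt 6, Pt 1, Bw 0],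
      [Pt 6, Pt 0, Bw 1, Pt 1, Pt 5, Pt 2, Fw 3])),
      (([1, 2], []), ([Pt 5, Pt 0, Pt 2, Bw 1, Pt 1, Pt 6],
      [Fw 0, Pt 1, Pt 5, Pt 2, Fw 2, Pt 0, Pt 6, Pt 3, Fw 3])),
      (([], [2, 1]), ([Pt 5, Pt 0, Pt 6, Pt 3, Fw 1, Pt 2, Fw 2, Pt 1, Fw 3],
      [Pt 6, Pt 1, Pt 5, Pt 2, Pt 0, Bw 0])),
      (([2], [1]), ([Pt 5, Pt 2, Pt 0, Pt 6, Pt 1, Fw 3],
      [Pt 6, Pt 3, Fw 2, Pt 1, Pt 5, Pt 0, Bw 1, Pt 2, Bw 0])),
      (([2, 1], []), ([Pt 5, Pt 0, Pt 2, Fw 1, Pt 1, Pt 6],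
      [Fw 0, Pt 2, Pt 5, Pt 1, Fw 2, Pt 0, Pt 6, Pt 3, Fw 3]))]"
   and ?tab5.0 = "[([(0, 2)], [[0, 1, 2, 3], [3, 1, 4, 2, 5, 0, 6], [5, 1, 6, 3, 4, 0, 2]])]"
   and ?tab3.0 = "[]"])
    code_simp+

section \<open>Reductions: two adjacent vertices\<close>

lemma red_adj23: "reducible [5, 6] []
    [(5, 6), (0, 5), (0, 6), (1, 6)] 2 [3, 5] f"
  by (rule reducible_trace[where mid = "[0]" and qs = "[1]" and ?tab = "[(([], []), ([Pt 6, Pt 5, Pt 0, Bw 0],
      [Pt 1, Pt 6, Pt 0, Fw 1])),
      (([], [1]), ([Pt 6, Pt 5, Pt 0, Fw 1, Pt 1],
      [Fw 0, Pt 0, Pt 6, Pt 1, Fw 2]))]"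
   and ?tab5.0 = "[([(0, 1)], [[0, 2], [2, 1, 3, 4, 0, 6, 5], [5, 0, 3, 2, 4, 1, 6]]),
      ([(0, 2)], [[0, 1], [2, 1, 3, 4, 0, 6, 5], [5, 0, 3, 2, 4, 1, 6]]),
      ([(1, 2)], [[2, 0, 1], [1, 3, 2, 4, 0, 6, 5], [5, 0, 3, 4, 1, 6]]),
      ([(0, 3)], [[0, 1], [3, 1, 2, 4, 0, 6, 5], [5, 0, 2, 3, 4, 1, 6]]),
      ([(1, 3)], [[3, 0, 1], [1, 2, 3, 4, 0, 6, 5], [5, 0, 2, 4, 1, 6]]),
      ([(2, 3)], [[1, 0, 2], [3, 0, 5, 6, 1, 4, 2], [2, 1, 3, 4, 0, 6]]),
      ([(0, 4)], [[0, 1], [4, 1, 2, 3, 0, 6, 5], [5, 0, 2, 4, 3, 1, 6]]),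
      ([(1, 4)], [[4, 0, 1], [1, 2, 3, 0, 6, 5], [5, 0, 2, 4, 3, 1, 6]]),
      ([(2, 4)], [[1, 0, 2], [4, 0, 5, 6, 1, 3, 2], [2, 1, 4, 3, 0, 6]]),
      ([(3, 4)], [[1, 0, 2], [2, 3, 0, 5, 6, 1, 4], [3, 1, 2, 4, 0, 6]])]"
   and ?tab3.0 = "[([], [[1, 0, 6, 5], [5, 0, 2, 1, 6]])]"])
    code_simp+

lemma red_adj23_add: "reducible [5, 6] [(0, 1)]
    [(5, 6), (0, 5), (0, 6), (1, 6)] 2 [3, 5] f"
  by (rule reducible_lift[where qs = "[0, 1]" and ls = "[(0, 6, 1)]" and p = "[6, 5, 0]"
   and ?tab5.0 = "[([(0, 2)], [[2, 1], [1, 3, 2, 4, 0, 6, 5], [5, 0, 3, 4, 1, 6]]),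
      ([(1, 2)], [[0, 2], [1, 3, 2, 4, 0, 6, 5], [5, 0, 3, 4, 1, 6]]),
      ([(0, 3)], [[3, 1], [1, 2, 3, 4, 0, 6, 5], [5, 0, 2, 4, 1, 6]]),
      ([(1, 3)], [[0, 2], [1, 2, 3, 4, 0, 5, 6], [3, 0, 6, 1, 4, 2]]),
      ([(2, 3)], [[0, 2], [3, 0, 5, 6, 1, 4, 2], [2, 1, 3, 4, 0, 6]]),
      ([(0, 4)], [[4, 1], [1, 2, 3, 0, 6, 5], [5, 0, 2, 4, 3, 1, 6]]),
      ([(1, 4)], [[0, 2], [1, 2, 4, 3, 0, 5, 6], [2, 3, 1, 6, 0, 4]]),
      ([(2, 4)], [[0, 2], [4, 0, 5, 6, 1, 3, 2], [2, 1, 4, 3, 0, 6]]),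
      ([(3, 4)], [[0, 2], [2, 3, 0, 5, 6, 1, 4], [3, 1, 2, 4, 0, 6]])]"
   and ?tab3.0 = "[([], [[0, 2, 1, 6, 5], [5, 0, 6]])]"])
    code_simp+

lemma red_adj24: "reducible [5, 6] []
    [(5, 6), (0, 5), (1, 5), (2, 5), (0, 6)] 3 [3, 5] f"
  by (rule reducible_trace[where mid = "[0]" and qs = "[1, 2]" and ?tab = "[(([], []), ([Pt 1, Pt 5, Pt 6, Pt 0, Bw 0],
      [Pt 2, Pt 5, Pt 0, Fw 1])),
      (([], [1]), ([Pt 1, Pt 5, Pt 6, Pt 0, Bw 0],
      [Pt 2, Pt 5, Pt 0, Fw 1, Pt 1, Fw 2])),
      (([], [2]), ([Pt 1, Pt 5, Pt 6, Pt 0, Fw 1, Pt 2],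
      [Fw 0, Pt 0, Pt 5, Pt 2, Fw 2])),
      (([], [1, 2]), ([Pt 1, Bw 1, Pt 0, Pt 5, Pt 2],
      [Fw 0, Pt 0, Pt 6, Pt 5, Pt 1, Fw 2, Pt 2, Fw 3])),
      (([1], [2]), ([Pt 1, Pt 5, Pt 6, Pt 0, Fw 2, Pt 2],
      [Fw 0, Pt 1, Fw 1, Pt 0, Pt 5, Pt 2, Fw 3])),
      (([1, 2], []), ([Pt 1, Pt 5, Pt 6, Pt 0, Bw 2, Pt 2],
      [Fw 0, Pt 1, Fw 1, Pt 2, Pt 5, Pt 0, Fw 3]))]"
   and ?tab5.0 = "[([(0, 1)], [[0, 2, 1], [1, 3, 0, 4, 2, 5, 6], [2, 3, 4, 1, 5, 0, 6]]),
      ([(0, 2)], [[0, 1, 2], [1, 3, 0, 4, 2, 5, 6], [2, 3, 4, 1, 5, 0, 6]]),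
      ([(1, 2)], [[1, 0, 2], [1, 3, 0, 4, 2, 5, 6], [2, 3, 4, 1, 5, 0, 6]]),
      ([(0, 3)], [[0, 1, 2], [1, 3, 2, 4, 0, 5, 6], [3, 4, 1, 5, 2, 0, 6]]),
      ([(1, 3)], [[2, 0, 1], [1, 2, 4, 3, 0, 5, 6], [3, 2, 5, 1, 4, 0, 6]]),
      ([(2, 3)], [[1, 0, 2], [2, 1, 4, 3, 0, 5, 6], [3, 1, 5, 2, 4, 0, 6]]),
      ([(0, 4)], [[0, 1, 2], [1, 3, 4, 2, 0, 5, 6], [4, 1, 5, 2, 3, 0, 6]]),
      ([(1, 4)], [[2, 0, 1], [1, 2, 3, 4, 0, 5, 6], [4, 2, 5, 1, 3, 0, 6]]),
      ([(2, 4)], [[1, 0, 2], [2, 1, 3, 4, 0, 5, 6], [4, 1, 5, 2, 3, 0, 6]]),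
      ([(3, 4)], [[1, 0, 2], [3, 0, 4, 1, 2, 5, 6], [4, 2, 3, 1, 5, 0, 6]])]"
   and ?tab3.0 = "[([], [[1, 0, 2, 5, 6], [2, 1, 5, 0, 6]])]"])
    code_simp+

lemma red_adj33_ab: "reducible [5, 6] []
    [(5, 6), (0, 5), (1, 5), (0, 6), (1, 6)] 2 [3, 5] f"
  by (rule reducible_trace[where mid = "[0]" and qs = "[1]" and ?tab = "[(([], []), ([Pt 5, Pt 6, Pt 0, Bw 0],
      [Pt 6, Pt 1, Pt 5, Pt 0, Fw 1])),
      (([], [1]), ([Pt 5, Pt 6, Pt 0, Fw 1, Pt 1, Fw 2],
      [Pt 6, Pt 1, Pt 5, Pt 0, Bw 0]))]"
   and ?tab5.0 = "[([(0, 1)], [[0, 2, 1], [5, 6, 0, 3, 1, 4, 2], [2, 3, 4, 0, 5, 1, 6]]),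
      ([(0, 2)], [[0, 1, 2], [5, 6, 0, 3, 1, 4, 2], [2, 3, 4, 0, 5, 1, 6]]),
      ([(1, 2)], [[1, 0, 2], [5, 6, 0, 3, 1, 4, 2], [2, 3, 4, 0, 5, 1, 6]]),
      ([(0, 3)], [[0, 1, 2], [2, 0, 4, 3, 1, 5, 6], [3, 2, 4, 1, 6, 0, 5]]),
      ([(1, 3)], [[1, 0, 2], [2, 1, 4, 3, 0, 5, 6], [3, 2, 4, 0, 6, 1, 5]]),
      ([(2, 3)], [[2, 0, 1, 3], [5, 6, 0, 3, 4, 1, 2], [2, 4, 0, 5, 1, 6]]),
      ([(0, 4)], [[0, 1, 2], [2, 0, 3, 4, 1, 5, 6], [4, 2, 3, 1, 6, 0, 5]]),
      ([(1, 4)], [[1, 0, 2], [2, 1, 3, 4, 0, 5, 6], [4, 2, 3, 0, 6, 1, 5]]),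
      ([(2, 4)], [[2, 0, 1, 3], [3, 0, 4, 1, 5, 6], [4, 3, 2, 1, 6, 0, 5]]),
      ([(3, 4)], [[3, 0, 1, 2], [2, 0, 4, 1, 5, 6], [4, 2, 3, 1, 6, 0, 5]])]"
   and ?tab3.0 = "[([], [[5, 6, 0, 1, 2], [2, 0, 5, 1, 6]])]"])
    code_simp+

text \<open>The adjacent vertices 5 and 6 share the neighbour 0 and have the private neighbours 2
  and 1. Again the variants differ in the edges among the old vertices.\<close>

lemma red_adj33_ac_add2: "reducible [5, 6] [(0, 1), (0, 2)]
    [(5, 6), (0, 5), (2, 5), (0, 6), (1, 6)] 3 [3, 5] f"
  by (rule reducible_lift[where qs = "[0, 1, 2]" and ls = "[(1, 6, 0), (0, 5, 2)]" and p = "[5, 6]"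
   and ?tab5.0 = "[([(1, 2)], [[1, 3], [3, 0, 4, 2, 5, 6], [2, 3, 4, 1, 6, 0, 5]]),
      ([(0, 3)], [[3, 1], [1, 2, 3, 4, 0, 5, 6], [5, 2, 4, 1, 6, 0]]),
      ([(1, 3)], [[1, 2], [3, 0, 4, 2, 5, 6], [2, 3, 4, 1, 6, 0, 5]]),
      ([(2, 3)], [[2, 1], [3, 0, 4, 1, 6, 5], [1, 3, 4, 2, 5, 0, 6]]),
      ([(0, 4)], [[0, 3], [3, 1, 4, 2, 5, 6], [4, 3, 2, 1, 6, 0, 5]]),
      ([(1, 4)], [[1, 2], [2, 3, 1, 6, 5, 0, 4], [5, 2, 4, 3, 0, 6]]),
      ([(2, 4)], [[2, 1], [1, 3, 2, 5, 6, 0, 4], [5, 0, 3, 4, 1, 6]]),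
      ([(3, 4)], [[3, 0], [0, 4, 1, 2, 5, 6], [4, 2, 3, 1, 6, 0, 5]])]"
   and ?tab3.0 = "[([], [[5, 6, 0], [0, 5, 2, 1, 6]])]"])
    code_simp+

lemma red_adj33_ac_add: "reducible [5, 6] [(1, 2)]
    [(5, 6), (0, 5), (2, 5), (0, 6), (1, 6)] 3 [3, 5] f"
  by (rule reducible_trace[where mid = "[1, 2]" and qs = "[0]" and ?tab = "[(([], []), ([Pt 5, Pt 6],
      [Fw 0, Pt 1, Pt 6, Pt 0, Pt 5, Pt 2, Fw 1])),
      (([], [0]), ([Pt 5, Pt 0, Pt 6],
      [Fw 0, Pt 1, Pt 6, Pt 5, Pt 2, Fw 1, Pt 0, Fw 2])),
      (([0], []), ([Pt 5, Pt 6, Pt 0, Bw 0],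
      [Pt 6, Pt 1, Bw 1, Pt 0, Pt 5, Pt 2, Fw 2]))]"
   and ?tab5.0 = "[([(0, 1)], [[0, 2], [1, 3, 0, 4, 2, 5, 6], [2, 3, 4, 1, 6, 0, 5]]),
      ([(0, 2)], [[0, 1], [1, 3, 0, 4, 2, 5, 6], [2, 3, 4, 1, 6, 0, 5]]),
      ([(0, 3)], [[0, 1], [1, 3, 2, 4, 0, 5, 6], [3, 4, 1, 6, 0, 2, 5]]),
      ([(1, 3)], [[1, 0, 2], [3, 0, 4, 2, 5, 6], [2, 3, 4, 1, 6, 0, 5]]),
      ([(2, 3)], [[2, 0, 1], [3, 0, 4, 1, 6, 5], [1, 3, 4, 2, 5, 0, 6]]),
      ([(0, 4)], [[0, 1], [1, 3, 0, 6, 5, 2, 4], [5, 0, 2, 3, 4, 1, 6]]),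
      ([(1, 4)], [[1, 0, 2], [2, 3, 1, 6, 5, 0, 4], [5, 2, 4, 3, 0, 6]]),
      ([(2, 4)], [[2, 0, 1], [1, 3, 2, 5, 6, 0, 4], [5, 0, 3, 4, 1, 6]]),
      ([(3, 4)], [[3, 0, 1], [1, 3, 2, 4, 0, 5, 6], [4, 1, 6, 0, 2, 5]])]"
   and ?tab3.0 = "[([], [[5, 6, 0, 2], [2, 5, 0, 1, 6]])]"])
    code_simp+

lemma red_adj33_ac_move: "reducible [5, 6] [(0, 2)]
    [(5, 6), (0, 5), (2, 5), (0, 6), (1, 6), (0, 1)] 3 [3, 5] f"
  by (rule reducible_trace[where mid = "[0, 2]" and qs = "[1]" and ?tab = "[(([], []), ([Pt 5, Pt 6, Pt 0, Bw 0],
      [Pt 6, Pt 1, Pt 0, Pt 5, Pt 2, Fw 1])),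
      (([], [1]), ([Pt 5, Pt 6, Pt 0, Pt 1, Fw 2],
      [Pt 6, Pt 1, Bw 1, Pt 2, Pt 5, Pt 0, Bw 0])),
      (([1], []), ([Pt 5, Pt 6, Pt 0, Pt 1, Bw 0],
      [Pt 6, Pt 1, Fw 1, Pt 0, Pt 5, Pt 2, Fw 2]))]"
   and ?tab5.0 = "[([(0, 1)], [[1, 2, 3, 0], [5, 6, 0, 4, 1, 3], [3, 4, 2, 5, 0, 1, 6]])]"
   and ?tab3.0 = "[]"])
    code_simp+

lemma red_adj33_ac: "reducible [5, 6] []
    [(5, 6), (0, 5), (2, 5), (0, 6), (1, 6), (1, 2)] 3 [3, 5] f"
  by (rule reducible_trace[where mid = "[0]" and qs = "[1, 2]" and ?tab = "[(([], []), ([Pt 5, Pt 6, Pt 0, Bw 0],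
      [Pt 6, Pt 1, Pt 2, Pt 5, Pt 0, Fw 1])),
      (([], [1]), ([Pt 5, Pt 6, Pt 0, Fw 1, Pt 1, Fw 2],
      [Pt 6, Pt 1, Pt 2, Pt 5, Pt 0, Bw 0])),
      (([], [2]), ([Pt 5, Pt 6, Pt 0, Fw 1, Pt 2, Fw 2],
      [Pt 6, Pt 1, Pt 2, Pt 5, Pt 0, Bw 0])),
      (([], [1, 2]), ([Pt 5, Pt 6, Pt 0, Fw 1, Pt 1, Pt 2, Fw 3],
      [Pt 6, Pt 1, Fw 2, Pt 2, Pt 5, Pt 0, Bw 0])),
      (([1], [2]), ([Pt 5, Pt 6, Pt 0, Fw 2, Pt 2, Pt 1, Bw 0],
      [Pt 6, Pt 1, Fw 1, Pt 0, Pt 5, Pt 2, Fw 3])),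
      (([1, 2], []), ([Pt 5, Pt 6, Pt 0, Bw 2, Pt 2, Pt 1, Bw 0],
      [Pt 6, Pt 1, Fw 1, Pt 2, Pt 5, Pt 0, Fw 3]))]"
   and ?tab5.0 = "[([(1, 2)], [[1, 0, 2, 3], [3, 0, 4, 1, 2, 5, 6], [2, 4, 3, 1, 6, 0, 5]])]"
   and ?tab3.0 = "[]"])
    code_simp+

text \<open>Over a triangle the result is \<open>K_5\<close> without the edge \<open>2 6\<close>;
  hence 3 is missing from the list of orders.\<close>

lemma red_adj34: "reducible [5, 6] []
    [(5, 6), (0, 5), (1, 5), (2, 5), (0, 6), (1, 6)] 3 [5] f"
  by (rule reducible_trace[where mid = "[0]" and qs = "[1, 2]" and ?tab = "[(([], []), ([Pt 6, Pt 5, Pt 0, Bw 0],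
      [Pt 2, Pt 5, Pt 1, Pt 6, Pt 0, Fw 1])),
      (([], [1]), ([Pt 6, Pt 5, Pt 0, Fw 1, Pt 1, Fw 2],
      [Pt 2, Pt 5, Pt 1, Pt 6, Pt 0, Bw 0])),
      (([], [2]), ([Pt 6, Pt 5, Pt 0, Fw 1, Pt 2],
      [Fw 0, Pt 0, Pt 6, Pt 1, Pt 5, Pt 2, Fw 2])),
      (([], [1, 2]), ([Pt 6, Pt 5, Pt 0, Fw 1, Pt 1, Fw 2, Pt 2],
      [Fw 0, Pt 0, Pt 6, Pt 1, Pt 5, Pt 2, Fw 3])),
      (([1], [2]), ([Pt 6, Pt 5, Pt 1, Fw 1, Pt 0, Fw 2, Pt 2],
      [Fw 0, Pt 1, Pt 6, Pt 0, Pt 5, Pt 2, Fw 3])),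
      (([1, 2], []), ([Pt 6, Pt 5, Pt 0, Bw 2, Pt 2, Bw 1, Pt 1, Bw 0],
      [Pt 2, Pt 5, Pt 1, Pt 6, Pt 0, Fw 3]))]"
   and ?tab5.0 = "[([(0, 1)], [[0, 2, 1, 3], [3, 0, 4, 2, 5, 6, 1], [2, 3, 4, 1, 5, 0, 6]]),
      ([(0, 2)], [[0, 1, 2, 3], [3, 0, 4, 1, 6, 5, 2], [2, 4, 3, 1, 5, 0, 6]]),
      ([(1, 2)], [[1, 0, 2, 3], [3, 0, 4, 1, 6, 5, 2], [2, 4, 3, 1, 5, 0, 6]]),
      ([(0, 3)], [[0, 1, 2, 3], [2, 0, 5, 6, 1, 4, 3], [3, 1, 5, 2, 4, 0, 6]]),
      ([(1, 3)], [[1, 0, 2, 3], [2, 1, 5, 6, 0, 4, 3], [3, 0, 5, 2, 4, 1, 6]]),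
      ([(2, 3)], [[3, 0, 1, 2], [2, 0, 5, 6, 1, 4, 3], [3, 1, 5, 2, 4, 0, 6]]),
      ([(0, 4)], [[0, 1, 2, 3], [2, 0, 3, 4, 1, 5, 6], [3, 1, 6, 0, 5, 2, 4]]),
      ([(1, 4)], [[1, 0, 2, 3], [2, 1, 3, 4, 0, 5, 6], [3, 0, 6, 1, 5, 2, 4]]),
      ([(2, 4)], [[4, 0, 1, 2], [2, 0, 5, 6, 1, 3, 4], [4, 1, 5, 2, 3, 0, 6]]),
      ([(3, 4)], [[2, 0, 1, 3], [4, 0, 6, 5, 1, 2, 3], [3, 0, 5, 2, 4, 1, 6]])]"
   and ?tab3.0 = "[]"])
    code_simp+

lemma red_one1: "reducible [5] []
    [(0, 5)] 1 [3, 5] f"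
  by (rule reducible_lift[where qs = "[0]" and ls = "[]" and p = "[5, 0]"
   and ?tab5.0 = "[([(0, 1)], [[1, 2], [2, 0, 3, 4, 1], [1, 3, 2, 4, 0, 5]]),
      ([(0, 2)], [[2, 1], [1, 0, 3, 4, 2], [2, 3, 1, 4, 0, 5]]),
      ([(1, 2)], [[0, 1], [2, 0, 3, 4, 1], [1, 3, 2, 4, 0, 5]]),
      ([(0, 3)], [[3, 1], [1, 0, 2, 4, 3], [3, 2, 1, 4, 0, 5]]),
      ([(1, 3)], [[0, 1], [3, 0, 2, 4, 1], [1, 2, 3, 4, 0, 5]]),
      ([(2, 3)], [[0, 1], [2, 0, 3, 4, 1], [3, 1, 2, 4, 0, 5]]),
      ([(0, 4)], [[4, 1], [1, 0, 2, 3, 4], [4, 2, 1, 3, 0, 5]]),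
      ([(1, 4)], [[0, 1], [4, 0, 2, 3, 1], [1, 2, 4, 3, 0, 5]]),
      ([(2, 4)], [[0, 1], [2, 0, 3, 1, 4], [1, 2, 3, 4, 0, 5]]),
      ([(3, 4)], [[0, 1], [1, 2, 3, 0, 4], [3, 1, 4, 2, 0, 5]])]"
   and ?tab3.0 = "[([], [[0, 1], [1, 2, 0, 5]])]"])
    code_simp+

lemma red_one2: "reducible [5] []
    [(0, 5), (1, 5)] 2 [3, 5] f"
  by (rule reducible_lift[where qs = "[0, 1]" and ls = "[]" and p = "[0, 5, 1]"
   and ?tab5.0 = "[([(0, 1)], [[0, 2], [2, 1, 3, 4, 0, 5], [0, 3, 2, 4, 1, 5]]),
      ([(0, 2)], [[1, 0], [2, 1, 3, 4, 0, 5], [0, 3, 2, 4, 1, 5]]),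
      ([(1, 2)], [[0, 1], [2, 0, 3, 4, 1, 5], [1, 3, 2, 4, 0, 5]]),
      ([(0, 3)], [[1, 0], [0, 2, 3, 4, 1, 5], [3, 1, 2, 4, 0, 5]]),
      ([(1, 3)], [[0, 1], [1, 2, 3, 4, 0, 5], [3, 0, 2, 4, 1, 5]]),
      ([(2, 3)], [[0, 1], [2, 0, 3, 4, 1, 5], [3, 1, 2, 4, 0, 5]]),
      ([(0, 4)], [[1, 0], [0, 2, 3, 4, 1, 5], [4, 2, 1, 3, 0, 5]]),
      ([(1, 4)], [[0, 1], [1, 2, 3, 4, 0, 5], [4, 2, 0, 3, 1, 5]]),
      ([(2, 4)], [[0, 1], [2, 0, 4, 3, 1, 5], [4, 1, 2, 3, 0, 5]]),
      ([(3, 4)], [[0, 1], [3, 0, 4, 2, 1, 5], [4, 1, 3, 2, 0, 5]])]"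
   and ?tab3.0 = "[([], [[0, 1, 2], [2, 0, 5, 1]])]"])
    code_simp+

lemma red_one3_add: "reducible [5] [(1, 2)]
    [(0, 5), (1, 5), (2, 5)] 3 [3, 5] f"
  by (rule reducible_lift[where qs = "[0, 1, 2]" and ls = "[(1, 5, 2)]" and p = "[0, 5]"
   and ?tab5.0 = "[([(0, 1)], [[1, 3], [3, 0, 4, 2, 5, 1], [1, 4, 3, 2, 0, 5]]),
      ([(0, 2)], [[2, 3], [3, 0, 4, 1, 5, 2], [2, 4, 3, 1, 0, 5]]),
      ([(0, 3)], [[3, 1], [1, 0, 5, 2, 4, 3], [3, 2, 0, 4, 1, 5]]),
      ([(1, 3)], [[0, 1], [3, 0, 4, 2, 5, 1], [1, 4, 3, 2, 0, 5]]),
      ([(2, 3)], [[0, 1], [2, 0, 4, 3, 1, 5], [3, 0, 5, 2, 4, 1]]),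
      ([(0, 4)], [[4, 1], [1, 0, 5, 2, 3, 4], [4, 2, 0, 3, 1, 5]]),
      ([(1, 4)], [[0, 1], [4, 0, 3, 2, 5, 1], [1, 3, 4, 2, 0, 5]]),
      ([(2, 4)], [[0, 1], [2, 0, 3, 4, 1, 5], [1, 3, 2, 5, 0, 4]]),
      ([(3, 4)], [[0, 1], [3, 0, 2, 4, 1, 5], [1, 3, 2, 5, 0, 4]])]"
   and ?tab3.0 = "[([], [[0, 1, 5, 2], [2, 0, 5]])]"])
    code_simp+

lemma red_one3: "reducible [5] []
    [(0, 5), (1, 5), (2, 5), (1, 2)] 3 [3, 5] f"
  by (rule reducible_trace[where mid = "[1]" and qs = "[0, 2]" and ?tab = "[(([], []), ([Pt 0, Pt 5, Pt 1, Bw 0],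
      [Pt 5, Pt 2, Pt 1, Fw 1])),
      (([], [0]), ([Pt 0, Pt 5, Pt 1, Bw 0],
      [Pt 5, Pt 2, Pt 1, Fw 1, Pt 0, Fw 2])),
      (([], [2]), ([Pt 0, Pt 5, Pt 1, Pt 2, Fw 2],
      [Pt 5, Pt 2, Bw 1, Pt 1, Bw 0])),
      (([], [0, 2]), ([Pt 0, Pt 5, Pt 1, Pt 2, Fw 3],
      [Pt 5, Pt 2, Bw 2, Pt 0, Bw 1, Pt 1, Bw 0])),
      (([0], [2]), ([Pt 0, Pt 5, Pt 1, Pt 2, Fw 3],
      [Pt 5, Pt 2, Bw 2, Pt 1, Bw 1, Pt 0, Bw 0])),
      (([0, 2], []), ([Pt 0, Pt 5, Pt 2, Pt 1, Fw 3],
      [Pt 5, Pt 1, Bw 2, Pt 2, Bw 1, Pt 0, Bw 0]))]"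
   and ?tab5.0 = "[([(1, 2)], [[0, 1, 3, 2], [1, 4, 2, 5, 0, 3], [3, 4, 0, 2, 1, 5]])]"
   and ?tab3.0 = "[]"])
    code_simp+

section \<open>Minimal counterexamples\<close>

definition nb :: "'a set set \<Rightarrow> 'a \<Rightarrow> 'a set" where
  "nb E v = {u. {v, u} \<in> E}"

definition closed_in :: "'a set set \<Rightarrow> 'a set \<Rightarrow> bool" where
  "closed_in E S \<longleftrightarrow> (\<forall>a b. {a, b} \<in> E \<longrightarrow> (a \<in> S \<longleftrightarrow> b \<in> S))"

text \<open>Connectedness by cuts instead of walks: to see that a reduction keeps the graph
  connected, one set closed under the remaining edges is followed through the few vertices
  concerned.\<close>

definition conn :: "'a set \<Rightarrow> 'a set set \<Rightarrow> bool" where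
  "conn V E \<longleftrightarrow> (\<forall>S. closed_in E S \<longrightarrow> V \<subseteq> S \<or> V \<inter> S = {})"

definition clique :: "'a set set \<Rightarrow> 'a set \<Rightarrow> bool" where
  "clique T S \<longleftrightarrow> (\<forall>a\<in>S. \<forall>b\<in>S. a \<noteq> b \<longrightarrow> {a, b} \<in> T)"

text \<open>A form of chordality with small cliques that, unlike being a 3-tree, passes to subsets of \<open>V\<close>.\<close>

definition good :: "'a set \<Rightarrow> 'a set set \<Rightarrow> bool" where
  "good V T \<longleftrightarrow> (\<forall>e\<in>T. card e = 2) \<and> (\<forall>S\<subseteq>V. S \<noteq> {} \<longrightarrow>
     (\<exists>s\<in>S. card (nb T s \<inter> S) \<le> 3 \<and> clique T (nb T s \<inter> S)))"

lemma good_mono: "good V T \<Longrightarrow> V' \<subseteq> V \<Longrightarrow> good V' T"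
  unfolding good_def by blast

lemma closed_inD: "closed_in E S \<Longrightarrow> {a, b} \<in> E \<Longrightarrow> a \<in> S \<longleftrightarrow> b \<in> S"
  unfolding closed_in_def by blast

lemma connD: "conn V E \<Longrightarrow> closed_in E S \<Longrightarrow> V \<subseteq> S \<or> V \<inter> S = {}"
  unfolding conn_def by blast

lemma all2_edge: "{a, b} \<in> all2 V \<longleftrightarrow> a \<in> V \<and> b \<in> V \<and> a \<noteq> b"
  by (auto simp: all2_def card_insert_if)

text \<open>All edges that are lost lie within \<open>K\<close> and \<open>W\<close>, and
  \<open>K\<close> is on one side of every closed set. Putting \<open>W\<close> on that side makes
  the set closed in the original graph.\<close>

lemma conn_delete:
  assumes c: "conn V E" and W: "W \<subseteq> V"
    and E': "\<And>e. e \<in> E' \<Longrightarrow> e \<subseteq> V - W"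
    and out: "\<And>e. e \<in> E - E' \<Longrightarrow> e \<subseteq> K \<union> W"
    and link: "\<And>S. closed_in E' S \<Longrightarrow> K \<subseteq> S \<or> K \<inter> S = {}"
  shows "conn (V - W) E'"
  unfolding conn_def
proof (intro allI impI)
  fix S assume S: "closed_in E' S"
  define S' where "S' = (S - W) \<union> (if K \<subseteq> S then W else {})"
  have "closed_in E S'"
    unfolding closed_in_def
  proof (intro allI impI)
    fix a b assume ab: "{a, b} \<in> E"
    show "a \<in> S' \<longleftrightarrow> b \<in> S'"
    proof (cases "{a, b} \<in> E'")
      case True
      then have "a \<notin> W" "b \<notin> W" "a \<in> S \<longleftrightarrow> b \<in> S" using E' closed_inD[OF S] by auto
      then show ?thesis by (simp add: S'_def)
    next
      case False
      then have "a \<in> K \<union> W" "b \<in> K \<union> W" using out[of "{a, b}"] ab by auto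
      then show ?thesis using link[OF S] by (cases "K \<subseteq> S") (auto simp: S'_def)
    qed
  qed
  from connD[OF c this] show "V - W \<subseteq> S \<or> (V - W) \<inter> S = {}"
    by (auto simp: S'_def split: if_splits)
qed

lemma conn_nonisolated:
  assumes "conn V E" "2 \<le> card V" "E \<subseteq> all2 V"
  shows "V \<subseteq> \<Union> E"
proof
  fix v assume v: "v \<in> V"
  show "v \<in> \<Union> E"
  proof (rule ccontr)
    assume n: "v \<notin> \<Union> E"
    have "closed_in E {v}" unfolding closed_in_def using n by blast
    then have "V \<subseteq> {v}" using connD[OF assms(1)] v by blast
    then show False using assms(2) card_mono[of "{v}" V] by simp
  qed
qed

text \<open>Serves to exclude that a graph with a pendant edge is exceptional.\<close>

lemma exc_degree:
  assumes "exc V E" "x \<in> V"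
  shows "\<exists>a b. a \<noteq> b \<and> {x, a} \<in> E \<and> {x, b} \<in> E"
proof -
  obtain m where m: "all2 V - {m} \<subseteq> E" "card V = 3 \<longrightarrow> all2 V \<subseteq> E" "card V = 3 \<or> card V = 5"
  proof (cases "card V = 3")
    case True
    then show ?thesis using assms(1) that[of "{}"] by (auto simp: exc_def)
  next
    case False
    then obtain e where "E = all2 V - {e}" "card V = 5" using assms(1) by (auto simp: exc_def)
    then show ?thesis using that[of e] by simp
  qed
  have "card (V - {x}) = card V - 1" using assms(2) by simp
  then have "2 \<le> card (V - {x})" using m(3) by linarith
  then obtain D where "D \<subseteq> V - {x}" "card D = 2" by (meson obtain_subset_with_card_n)
  then obtain a b where ab: "a \<in> V - {x}" "b \<in> V - {x}" "a \<noteq> b" by (auto simp: card_2_iff)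
  show ?thesis
  proof (cases "card V = 3")
    case True
    then show ?thesis using ab m(2) assms(2) by (intro exI[of _ a] exI[of _ b]) (auto simp: all2_edge)
  next
    case False
    then have "card (V - {x, a, b}) = 2"
      using m(3) ab assms(2) by (subst card_Diff_subset) (auto simp: card_insert_if)
    then have "V - {x, a, b} \<noteq> {}" by (metis card.empty zero_neq_numeral)
    then obtain c where c: "c \<in> V - {x, a, b}" by blast
    have *: "{x, d} \<in> E \<or> m = {x, d}" if "d \<in> {a, b, c}" for d
      using subsetD[OF m(1), of "{x, d}"] that ab c assms(2) by (auto simp: all2_edge)
    have "{x, a} \<noteq> {x, b}" "{x, b} \<noteq> {x, c}" "{x, a} \<noteq> {x, c}"
      using ab c by (auto simp: doubleton_eq_iff)
    then show ?thesis using *[of a] *[of b] *[of c] ab c by (metis DiffE insertCI)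
  qed
qed

text \<open>The substitute, for an exceptional part at a cut vertex, for cutting a path there:
  within the number of paths allowed to an exceptional graph, two of them can be made to start at
  any given vertex.\<close>

lemma exc_split:
  assumes "exc V E" "v \<in> V"
  shows "\<exists>p q R. decm ((v # p) # (v # q) # R) (mset_set E) \<and> length R + 2 \<le> (card V + 1) div 2"
proof -
  \<comment> \<open>Tables of an empty reduction, with label 0 for \<open>v\<close>; in each entry
    the first two paths start at 0.\<close>
  let ?t5 = "[([(0, 1)], [[0, 2, 1, 3, 4], [0, 3, 2, 4, 1], [0, 4]]),
      ([(0, 2)], [[0, 1, 2, 3, 4], [0, 3, 1, 4, 2], [0, 4]]),
      ([(1, 2)], [[0, 1, 3, 2, 4], [0, 3, 4, 1], [2, 0, 4]]),
      ([(0, 3)], [[0, 1, 2, 3, 4], [0, 2, 4, 1, 3], [0, 4]]),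
      ([(1, 3)], [[0, 1, 2, 3, 4], [0, 2, 4, 1], [3, 0, 4]]),
      ([(2, 3)], [[0, 1, 2, 4, 3], [0, 3, 1, 4], [2, 0, 4]]),
      ([(0, 4)], [[0, 1, 2, 3, 4], [0, 2, 4, 1, 3], [0, 3]]),
      ([(1, 4)], [[0, 1, 2, 3, 4], [0, 2, 4], [1, 3, 0, 4]]),
      ([(2, 4)], [[0, 1, 2, 3, 4], [0, 3, 1, 4], [2, 0, 4]]),
      ([(3, 4)], [[0, 1, 3, 2, 4], [0, 2, 1, 4], [3, 0, 4]])]"
  let ?t3 = "[([], [[0, 1, 2], [0, 2]])]"
  let ?P = "\<lambda>ps::nat list list. \<exists>p q R. ps = (0 # p) # (0 # q) # R \<and> length R + 2 \<le> (card V + 1) div 2"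
  have main: "\<exists>p q R. decm ((v # p) # (v # q) # R) (mset_set E) \<and> length R + 2 \<le> (card V + 1) div 2"
    if chk: "chk_exc [] [] [] 1 (card V) tab" and sh: "\<forall>(ms, ps)\<in>set tab. ?P ps" for tab
  proof -
    have "\<exists>f' ms ps. (ms, ps) \<in> set tab \<and> (\<forall>i<1. f' i = (\<lambda>_. v) i) \<and>
        decm (map (map f') ps) (mset_set ((E - im (\<lambda>_. v) []) \<union> im (\<lambda>_. v) []))"
      by (rule exc_decm[OF chk]) (use assms in \<open>auto simp: im_def lessThan_Suc\<close>)
    then obtain f' ms ps where *: "(ms, ps) \<in> set tab" "f' 0 = v" "decm (map (map f') ps) (mset_set E)"
      by (auto simp: im_def)
    then obtain p q R where ps: "ps = (0 # p) # (0 # q) # R" "length R + 2 \<le> (card V + 1) div 2"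
      using sh by fast
    then show ?thesis using *
      by (intro exI[of _ "map f' p"] exI[of _ "map f' q"] exI[of _ "map (map f') R"]) simp
  qed
  consider "card V = 3" | "card V = 5" using assms(1) by (auto simp: exc_def)
  then show ?thesis
  proof cases
    case 1
    have "chk_exc [] [] [] 1 (card V) ?t3" unfolding 1 by code_simp
    moreover have "\<forall>(ms, ps)\<in>set ?t3. ?P ps" using 1 by simp
    ultimately show ?thesis by (rule main)
  next
    case 2
    have "chk_exc [] [] [] 1 (card V) ?t5" unfolding 2 by code_simp
    moreover have "\<forall>(ms, ps)\<in>set ?t5. ?P ps" using 2 by simp
    ultimately show ?thesis by (rule main)
  qed
qed

lemma exc_pnle:
  assumes "exc V E"
  shows "pnle E ((card V + 1) div 2)"
proof -
  have "V \<noteq> {}" using assms by (auto simp: exc_def)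
  then obtain v where "v \<in> V" by blast
  from exc_split[OF assms this] obtain p q R where
    *: "decm ((v # p) # (v # q) # R) (mset_set E)" "length R + 2 \<le> (card V + 1) div 2" by blast
  have "finite V" using assms by (auto simp: exc_def intro: card_ge_0_finite)
  then have "finite E" using assms by (auto simp: exc_def all2_def)
  then show ?thesis using * by (intro pnleI[of _ "(v # p) # (v # q) # R"]) auto
qed

lemma decm_glue:
  assumes A: "decm ((v # p) # R) M" and B: "decm ((v # q) # R') M'"
    and "set p \<inter> set q = {}"
  shows "decm ((rev p @ v # q) # R @ R') (M + M')"
proof -
  have "mset (el (rev p @ v # q)) = mset (el (v # p)) + mset (el (v # q))"
    using el_append[of "rev p" v q] mset_el_rev[of "v # p"] by simp
  then show ?thesis
    using assms by (auto simp: decm_def mset_el_rev ac_simps)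
qed

lemma decm_vertices:
  assumes "decm (p # R) M" "p \<noteq> [v]" "v \<in> set p"
  shows "set p \<subseteq> \<Union> (set_mset M)"
proof -
  have "Suc 0 < length p" using assms(2,3) by (cases p rule: el.cases) auto
  moreover have "set (el p) \<subseteq> set_mset M" using assms(1) by (auto simp: decm_def)
  ultimately show ?thesis using Union_el by blast
qed

text \<open>The hypothesis \<open>IH\<close> quantifies over \<open>T'\<close> because one
  application of \<open>suppress\<close> changes \<open>T\<close>. As \<open>T\<close> may have
  edges outside \<open>V\<close>, it serves for smaller vertex sets unchanged.\<close>

locale mincx =
  fixes V :: "'a set" and E T
  assumes finV: "finite V" and EV: "E \<subseteq> all2 V" and ET: "E \<subseteq> T" and good: "good V T"
    and conn: "conn V E" and ncx: "\<not> pnle E (card V div 2)" and nexc: "\<not> exc V E"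
    and IH: "\<And>(V' :: 'a set) E' T'. card V' < card V \<Longrightarrow> finite V' \<Longrightarrow> E' \<subseteq> all2 V' \<Longrightarrow> E' \<subseteq> T' \<Longrightarrow> good V' T' \<Longrightarrow>
      conn V' E' \<Longrightarrow> pnle E' (card V' div 2) \<or> exc V' E'"
begin

lemma finE: "finite E"
proof (rule finite_subset)
  show "E \<subseteq> Pow V" using EV unfolding all2_def by blast
qed (simp add: finV)

lemma edge: "{a, b} \<in> E \<Longrightarrow> a \<in> V \<and> b \<in> V \<and> a \<noteq> b"
  using subsetD[OF EV, of "{a, b}"] by (simp add: all2_edge)

lemma nbV: "nb E v \<subseteq> V - {v}"
  using edge by (auto simp: nb_def)

lemma in_nb: "u \<in> nb E v \<longleftrightarrow> {v, u} \<in> E"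
  by (simp add: nb_def)

lemma T2: "e \<in> T \<Longrightarrow> card e = 2"
  using good by (simp add: good_def)

text \<open>By \<open>cover\<close> no edge is left at the removed vertices, by \<open>link\<close>
  the smaller graph is connected, and added edges in \<open>T\<close> keep it within reach of
  \<open>IH\<close>. The last assumption concerns a smaller graph on three vertices: either the
  tables cover the triangle, or nothing was added and that triangle is not in
  \<open>E\<close>.\<close>

lemma reduce:
  fixes f ws
  defines "W \<equiv> f ` set ws"
  assumes red: "reducible ws J N q ks f"
    and inj: "inj_on f ({..<q} \<union> set ws)" and Q: "f ` {..<q} \<subseteq> V" "W \<subseteq> V"
    and N: "im f N \<subseteq> E" and J: "im f J \<inter> E = {}" "im f J \<subseteq> T"
    and lab: "\<forall>(i, j)\<in>set J. i < q \<and> j < q" "\<forall>(i, j)\<in>set N. i \<in> {..<q} \<union> set ws \<and> j \<in> {..<q} \<union> set ws"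
      "{..<q} \<inter> set ws = {}"
    and cover: "\<And>i u. i \<in> set ws \<Longrightarrow> {f i, u} \<in> E \<Longrightarrow> {f i, u} \<in> im f N"
    and link: "\<And>S. closed_in ((E - im f N) \<union> im f J) S \<Longrightarrow> f ` {..<q} \<subseteq> S \<or> f ` {..<q} \<inter> S = {}"
    and size: "distinct ws" "length ws = 2 \<or> length ws = 1 \<and> even (card V)" "length ws + 2 \<le> card V"
    and ks: "5 \<in> set ks" "card V = length ws + 3 \<Longrightarrow> 3 \<in> set ks \<or> J = [] \<and> \<not> all2 (V - W) \<subseteq> E"
  shows False
proof -
  define E' where "E' = (E - im f N) \<union> im f J"
  have disj: "f ` {..<q} \<inter> W = {}"
    unfolding W_def using inj_on_image_Int[OF inj, of "{..<q}" "set ws"] lab(3) by auto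
  have W: "card W = length ws" "finite W"
    using inj size(1) unfolding W_def by (auto simp: card_image inj_on_Un distinct_card)
  have cV: "card (V - W) = card V - length ws" using W Q(2) by (simp add: card_Diff_subset)
  have E'2: "E' \<subseteq> all2 (V - W)"
  proof
    fix e assume "e \<in> E'"
    then consider "e \<in> E" "e \<notin> im f N" | "e \<in> im f J" by (auto simp: E'_def)
    then show "e \<in> all2 (V - W)"
    proof cases
      case 1
      then obtain a b where ab: "e = {a, b}" using EV by (auto simp: all2_def card_2_iff)
      have "a \<notin> W" "b \<notin> W"
        using cover[of _ b] cover[of _ a] 1 ab by (auto simp: W_def insert_commute)
      then show ?thesis using 1 EV ab by (auto simp: all2_def)
    next
      case 2
      then have "e \<subseteq> f ` {..<q}" using lab(1) by (fastforce simp: im_def)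
      moreover have "card e = 2" using 2 J(2) T2 by blast
      ultimately show ?thesis using disj Q by (auto simp: all2_def)
    qed
  qed
  have c: "conn (V - W) E'"
  proof (rule conn_delete[OF conn Q(2), where K = "f ` {..<q}"])
    show "e \<subseteq> V - W" if "e \<in> E'" for e using that E'2 by (auto simp: all2_def)
    show "e \<subseteq> f ` {..<q} \<union> W" if "e \<in> E - E'" for e
      using that lab(2) by (fastforce simp: E'_def W_def im_def)
  qed (use link in \<open>simp add: E'_def\<close>)
  have "pnle E' (card (V - W) div 2) \<or> exc (V - W) E'"
  proof (rule IH[where T' = T])
    show "card (V - W) < card V" using cV size(2,3) by auto
    show "E' \<subseteq> T" using ET J(2) by (auto simp: E'_def)
    show "good (V - W) T" using good good_mono by blast
    show "E' \<subseteq> all2 (V - W)" by (rule E'2)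
    show "conn (V - W) E'" by (rule c)
  qed (use finV in auto)
  moreover have restore: "(E' - im f J) \<union> im f N = E" using N J(1) by (auto simp: E'_def)
  moreover have "(\<forall>m. pnle E' m \<longrightarrow> pnle ((E' - im f J) \<union> im f N) (Suc m)) \<and>
      (exc (V - W) E' \<longrightarrow> card (V - W) \<in> set ks \<longrightarrow>
       pnle ((E' - im f J) \<union> im f N) ((card (V - W) + 1) div 2))"
  proof -
    have "V - W \<subseteq> \<Union> E'" using conn_nonisolated[OF c _ E'2] cV size(3) by simp
    moreover have "im f J \<subseteq> E'" "im f N \<inter> E' = {}" using N J(1) by (auto simp: E'_def)
    moreover have "f ` {..<q} \<subseteq> V - W" "f ` set ws \<inter> (V - W) = {}" using Q disj by (auto simp: W_def)
    ultimately show ?thesis using red[unfolded reducible_def] inj E'2 by blast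
  qed
  ultimately have "pnle E (Suc (card (V - W) div 2)) \<or>
      exc (V - W) E' \<and> (card (V - W) \<in> set ks \<longrightarrow> pnle E ((card (V - W) + 1) div 2))"
    by auto
  then show False
  proof
    assume "pnle E (Suc (card (V - W) div 2))"
    moreover have "Suc (card (V - W) div 2) \<le> card V div 2" using cV size(2,3) by (auto elim!: evenE)
    ultimately show False using pnle_mono ncx by blast
  next
    assume e: "exc (V - W) E' \<and> (card (V - W) \<in> set ks \<longrightarrow> pnle E ((card (V - W) + 1) div 2))"
    then consider "card (V - W) = 3" "E' = all2 (V - W)" | "card (V - W) = 5" unfolding exc_def by blast
    then have "card (V - W) \<in> set ks"
    proof cases
      case 1
      moreover have "J = [] \<Longrightarrow> E' \<subseteq> E" by (simp add: E'_def im_def)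
      moreover have "card V = length ws + 3" using 1(1) cV size(3) by linarith
      ultimately show ?thesis using ks(2) by auto
    qed (use ks in simp)
    moreover have "(card (V - W) + 1) div 2 \<le> card V div 2" using cV size(2,3) by auto
    ultimately show False using e pnle_mono ncx by blast
  qed
qed

end

section \<open>Cut vertices and vertices of degree two\<close>

context mincx
begin

text \<open>Adding a pendant edge at a vertex forces some path to end there.\<close>

lemma pendant_decomposition:
  assumes A: "finite A" "v \<notin> A" "insert v A \<subseteq> V" "card A + 2 < card V"
    and b: "b \<in> V" "b \<notin> insert v A" "{v, b} \<in> E"
    and EA: "EA \<subseteq> E" "EA \<subseteq> all2 (insert v A)" and c: "conn (insert v A) EA"
  shows "\<exists>p R. decm ((v # p) # R) (mset_set EA) \<and> Suc (length R) \<le> (card A + 2) div 2"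
proof -
  \<comment> \<open>The pendant vertex \<open>b\<close> is a neighbour of \<open>v\<close> on the
    other side, so the enlarged graph is still part of \<open>E\<close> and the same
    \<open>T\<close> serves.\<close>
  let ?V = "insert b (insert v A)" and ?E = "insert {v, b} EA"
  have cV: "card ?V = card A + 2" using A b by simp
  have fin: "finite EA" using EA(1) finE finite_subset by blast
  have vb: "v \<noteq> b" using b by auto
  have E2: "?E \<subseteq> all2 ?V" using EA(2) vb by (auto simp: all2_def)
  have only: "a = v" if "{a, b} \<in> ?E" for a
    using that EA(2) b vb by (auto simp: all2_edge doubleton_eq_iff)
  have "conn ?V ?E"
    unfolding conn_def
  proof (intro allI impI)
    fix S assume S: "closed_in ?E S"
    then have "closed_in EA S" by (simp add: closed_in_def)
    then have "insert v A \<subseteq> S \<or> insert v A \<inter> S = {}" using connD[OF c] by blast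
    moreover have "v \<in> S \<longleftrightarrow> b \<in> S" using closed_inD[OF S] by blast
    ultimately show "?V \<subseteq> S \<or> ?V \<inter> S = {}" by auto
  qed
  then have "pnle ?E (card ?V div 2) \<or> exc ?V ?E"
    using IH[of ?V ?E T] cV A b E2 EA(1) ET good_mono[OF good, of ?V] by auto
  moreover have "\<not> exc ?V ?E"
  proof
    assume "exc ?V ?E"
    from exc_degree[OF this, of b] obtain x y where "x \<noteq> y" "{b, x} \<in> ?E" "{b, y} \<in> ?E" by auto
    then show False using only[of x] only[of y] by (simp add: insert_commute)
  qed
  ultimately obtain ps where ps: "length ps \<le> (card A + 2) div 2" "decm ps (mset_set ?E)"
    using cV by (auto simp: pnle_def)
  have new: "{v, b} \<notin> EA" using EA(2) b by (auto simp: all2_def)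
  then have M: "mset_set ?E = add_mset {v, b} (mset_set EA)" using fin by simp
  obtain p R where p: "decm (p # R) (mset_set ?E)" "length ps = Suc (length R)" "{v, b} \<in> set (el p)"
    using decm_in[OF ps(2), of "{v, b}"] M by (metis union_single_eq_member add_mset_add_single union_commute)
  have eE: "e \<in> ?E" if "decm (q # R) (mset_set ?E)" "e \<in> set (el q)" for e q
  proof -
    have "mset_set ?E = mset (el q) + (\<Sum>p\<leftarrow>R. mset (el p))" using that(1) by (simp add: decm_def)
    then have "e \<in># mset_set ?E" using that(2) by simp
    then show ?thesis using fin by simp
  qed
  \<comment> \<open>A vertex in front of \<open>b\<close> would be a neighbour of \<open>b\<close>,
    hence \<open>v\<close> once more, against distinctness.\<close>
  have head: "r1 = []" if q: "decm ((r1 @ [b, v] @ r2) # R) (mset_set ?E)" for r1 r2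
  proof (cases r1 rule: rev_cases)
    case (snoc r a)
    have "{a, b} \<in> set (el (r1 @ [b, v] @ r2))"
      using el_append[of r a "b # v # r2"] snoc by simp
    then have "a = v" using eE[OF q] only by blast
    then show ?thesis using q snoc by (auto simp: decm_def)
  qed
  obtain r1 x y r2 where r: "p = r1 @ [x, y] @ r2" "{v, b} = {x, y}" using el_split[OF p(3)] by blast
  have "\<exists>q. decm ((b # v # q) # R) (mset_set ?E)"
  proof (cases "x = b")
    case True
    then have "decm ((r1 @ [b, v] @ r2) # R) (mset_set ?E)" using r p(1) by (auto simp: doubleton_eq_iff)
    then show ?thesis using head by fastforce
  next
    case False
    then have "rev p = rev r2 @ [b, v] @ rev r1" using r by (auto simp: doubleton_eq_iff)
    then have "decm ((rev r2 @ [b, v] @ rev r1) # R) (mset_set ?E)" using decm_rev[OF p(1)] by simp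
    then show ?thesis using head by fastforce
  qed
  then obtain q where q: "decm ((b # v # q) # R) (mset_set ?E)" by blast
  then have "decm ((v # q) # R) (mset_set EA)"
    unfolding M by (simp add: decm_def insert_commute)
  then show ?thesis using ps(1) p(2) by (intro exI[of _ q] exI[of _ R]) simp
qed

text \<open>The side has odd order \<open>card A + 1\<close>. Either it has at most
  \<open>card A div 2\<close> paths, and cutting one of them at \<open>v\<close> yields one more, or
  it is exceptional and \<open>exc_split\<close> gives the same number.\<close>

lemma split_decomposition:
  assumes A: "finite A" "v \<notin> A" "insert v A \<subseteq> V" "Suc (card A) < card V" "even (card A)" "A \<noteq> {}"
    and EA: "EA \<subseteq> E" "EA \<subseteq> all2 (insert v A)" and c: "conn (insert v A) EA"
  shows "\<exists>p q R. decm ((v # p) # (v # q) # R) (mset_set EA) \<and> length R + 2 \<le> (card A + 2) div 2"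
proof -
  let ?V = "insert v A"
  have cV: "card ?V = card A + 1" using A by simp
  have fin: "finite EA" using EA(1) finE finite_subset by blast
  have "pnle EA (card ?V div 2) \<or> exc ?V EA"
    using IH[of ?V EA T] cV A EA c ET good_mono[OF good, of ?V] by auto
  then show ?thesis
  proof
    assume "exc ?V EA"
    from exc_split[OF this, of v] show ?thesis using cV by simp
  next
    assume "pnle EA (card ?V div 2)"
    then obtain ps where ps: "length ps \<le> (card A + 1) div 2" "decm ps (mset_set EA)"
      using cV by (auto simp: pnle_def)
    have "1 \<le> card A" using A(1,6) by (simp add: Suc_leI card_gt_0_iff)
    then have "v \<in> \<Union> EA" using conn_nonisolated[OF c _ EA(2)] cV by auto
    then obtain e where e: "e \<in> EA" "v \<in> e" by blast
    obtain p R where p: "decm (p # R) (mset_set EA)" "length ps = Suc (length R)" "e \<in> set (el p)"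
      using decm_in[OF ps(2), of e] e fin by (metis finite_set_mset_mset_set)
    have "v \<in> set p" using el_subset[OF p(3)] e by blast
    then obtain p1 p2 where pp: "p = p1 @ v # p2" by (meson split_list)
    have "mset (el (v # rev p1)) = mset (el (p1 @ [v]))" using mset_el_rev[of "p1 @ [v]"] by simp
    then have "decm ((v # rev p1) # (v # p2) # R) (mset_set EA)"
      using p(1) el_append[of p1 v p2] unfolding pp by (simp add: decm_def add.assoc)
    then show ?thesis using ps(1) p(2) A(5)
      by (intro exI[of _ "rev p1"] exI[of _ p2] exI[of _ R]) (auto elim!: evenE)
  qed
qed

lemma decm_tail:
  assumes d: "decm ((v # p) # R) (mset_set EA)" and EA: "EA \<subseteq> E" "EA \<subseteq> all2 (insert v A)"
  shows "set p \<subseteq> A"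
proof (cases "p = []")
  case False
  have "finite EA" using EA(1) finE finite_subset by blast
  then have "set (v # p) \<subseteq> \<Union> EA" using decm_vertices[OF d, of v] False by auto
  also have "\<dots> \<subseteq> insert v A" using EA(2) by (auto simp: all2_def)
  finally show ?thesis using d by (auto simp: decm_def)
qed simp

text \<open>Unless both \<open>card A\<close> and \<open>card B\<close> are even, on each side some path can be made to end at \<open>v\<close>, and
  gluing saves one path. If both are even, on each side two paths can be made to end at \<open>v\<close>, and gluing saves two.\<close>

lemma cut:
  assumes v: "v \<in> V" and AB: "A \<union> B = V - {v}" "A \<inter> B = {}" "2 \<le> card A" "2 \<le> card B"
    and no: "\<And>a b. a \<in> A \<Longrightarrow> b \<in> B \<Longrightarrow> {a, b} \<notin> E"
  shows False
proof -
  have fin: "finite A" "finite B" using AB finV by (metis finite_Diff finite_Un)+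
  have vAB: "v \<notin> A" "v \<notin> B" using AB(1) by auto
  have cV: "card V = card A + card B + 1"
  proof -
    have "card (V - {v}) = card A + card B" using AB(1,2) fin by (metis card_Un_disjoint)
    moreover have "0 < card V" using v finV by (auto simp: card_gt_0_iff)
    ultimately show ?thesis using v by simp
  qed
  define EA where "EA = {e\<in>E. e \<subseteq> insert v A}"
  define EB where "EB = {e\<in>E. e \<subseteq> insert v B}"
  have sub: "EA \<subseteq> E" "EB \<subseteq> E" "EA \<subseteq> all2 (insert v A)" "EB \<subseteq> all2 (insert v B)"
    using EV by (auto simp: EA_def EB_def all2_def)
  have inAB: "{a, b} \<in> EA \<or> {a, b} \<in> EB" if ab: "{a, b} \<in> E" for a b
    using edge[OF ab] no[of a b] no[of b a] ab AB(1) by (auto simp: EA_def EB_def insert_commute)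
  have E: "EA \<union> EB = E"
  proof
    show "E \<subseteq> EA \<union> EB"
    proof
      fix e assume e: "e \<in> E"
      then obtain a b where "e = {a, b}" using EV by (auto simp: all2_def card_2_iff)
      then show "e \<in> EA \<union> EB" using inAB e by auto
    qed
  qed (use sub in auto)
  have disj: "EA \<inter> EB = {}"
  proof -
    have "e = {}  \<or> e = {v}" if "e \<in> EA \<inter> EB" for e
      using that AB(2) by (auto simp: EA_def EB_def)
    then show ?thesis using sub(3) by (force simp: all2_def)
  qed
  \<comment> \<open>A set closed on the side \<open>X\<close> extends to a closed set of the whole
    graph: \<open>Y\<close> is put on the side of \<open>v\<close>.\<close>
  have conn_side: "conn (insert v X) {e\<in>E. e \<subseteq> insert v X}"
    if XY: "X \<union> Y = V - {v}" "X \<inter> Y = {}" "\<And>a b. a \<in> X \<Longrightarrow> b \<in> Y \<Longrightarrow> {a, b} \<notin> E" for X Y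
    unfolding conn_def
  proof (intro allI impI)
    fix S assume S: "closed_in {e\<in>E. e \<subseteq> insert v X} S"
    define S' where "S' = (S \<inter> insert v X) \<union> (if v \<in> S then Y else {})"
    have "closed_in E S'"
      unfolding closed_in_def
    proof (intro allI impI)
      fix a b assume ab: "{a, b} \<in> E"
      show "a \<in> S' \<longleftrightarrow> b \<in> S'"
      proof (cases "{a, b} \<subseteq> insert v X")
        case True
        then have "a \<in> S \<longleftrightarrow> b \<in> S" using closed_inD[OF S, of a b] ab by blast
        moreover have "a \<notin> Y \<and> b \<notin> Y" using True XY by auto
        ultimately show ?thesis using True by (auto simp: S'_def)
      next
        case False
        then have "a \<in> insert v Y \<and> b \<in> insert v Y"
          using edge[OF ab] XY(1) XY(3)[of a b] XY(3)[of b a] ab by (auto simp: insert_commute)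
        moreover have "v \<notin> X" "v \<notin> Y" using XY(1) by auto
        ultimately show ?thesis using XY(2) by (auto simp: S'_def)
      qed
    qed
    from connD[OF conn this] show "insert v X \<subseteq> S \<or> insert v X \<inter> S = {}"
      using XY v by (auto simp: S'_def split: if_splits)
  qed
  have cA: "conn (insert v A) EA" using conn_side[of A B] AB no by (simp add: EA_def)
  have cB: "conn (insert v B) EB"
    using conn_side[of B A] AB(1,2) no unfolding EB_def by (metis Int_commute Un_commute insert_commute)
  have nbr: "\<exists>b\<in>X. {v, b} \<in> E"
    if "X \<noteq> {}" "X \<subseteq> V - {v}" "\<And>a b. a \<in> X \<Longrightarrow> b \<in> V - {v} - X \<Longrightarrow> {a, b} \<notin> E" for X
  proof (rule ccontr)
    assume n: "\<not> ?thesis"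
    have "closed_in E X"
      unfolding closed_in_def
    proof (intro allI impI)
      fix a b assume ab: "{a, b} \<in> E"
      then have "{b, a} \<in> E" by (simp add: insert_commute)
      then show "a \<in> X \<longleftrightarrow> b \<in> X" using edge[OF ab] that(3)[of a b] that(3)[of b a] ab n by blast
    qed
    then show False using connD[OF conn] that(1,2) v by blast
  qed
  obtain b where b: "b \<in> B" "{v, b} \<in> E"
  proof -
    have "{x, y} \<notin> E" if "x \<in> B" "y \<in> V - {v} - B" for x y
      using that no[of y x] AB(1) by (auto simp: insert_commute)
    moreover have "B \<noteq> {}" "B \<subseteq> V - {v}" using AB by auto
    ultimately show ?thesis using nbr[of B] that by blast
  qed
  obtain a where a: "a \<in> A" "{v, a} \<in> E"
  proof -
    have "{x, y} \<notin> E" if "x \<in> A" "y \<in> V - {v} - A" for x y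
      using that no[of x y] AB(1) by auto
    moreover have "A \<noteq> {}" "A \<subseteq> V - {v}" using AB by auto
    ultimately show ?thesis using nbr[of A] that by blast
  qed
  have M: "mset_set E = mset_set EA + mset_set EB"
    using mset_set_Union[of EA EB] disj E finE by (metis finite_Un)
  have VAB: "insert v A \<subseteq> V" "insert v B \<subseteq> V" using AB(1) v by auto
  have ab: "a \<in> V" "a \<notin> insert v B" "b \<in> V" "b \<notin> insert v A" using a(1) b(1) AB(1,2) by auto
  show False
  proof (cases "even (card A) \<and> even (card B)")
    case False
    obtain p R where p: "decm ((v # p) # R) (mset_set EA)" "Suc (length R) \<le> (card A + 2) div 2"
      using pendant_decomposition[OF fin(1) vAB(1) VAB(1) _ ab(3,4) b(2) sub(1,3) cA] cV AB(4) by auto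
    obtain q R' where q: "decm ((v # q) # R') (mset_set EB)" "Suc (length R') \<le> (card B + 2) div 2"
      using pendant_decomposition[OF fin(2) vAB(2) VAB(2) _ ab(1,2) a(2) sub(2,4) cB] cV AB(3) by auto
    have "set p \<inter> set q = {}" using decm_tail[OF p(1) sub(1,3)] decm_tail[OF q(1) sub(2,4)] AB(2) by blast
    from decm_glue[OF p(1) q(1) this] have "decm ((rev p @ v # q) # R @ R') (mset_set E)" by (simp add: M)
    moreover have "length ((rev p @ v # q) # R @ R') \<le> card V div 2"
    proof -
      \<comment> \<open>If both numbers were even, the left side would be too large by one; this is
        why that case needs a second gluing.\<close>
      have "(card A + 2) div 2 + (card B + 2) div 2 \<le> Suc (card V div 2)"
        using False cV by (auto elim!: evenE oddE)
      then show ?thesis using p(2) q(2) by simp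
    qed
    ultimately show False using pnleI finE ncx by blast
  next
    case True
    obtain p p' R where p: "decm ((v # p) # (v # p') # R) (mset_set EA)" "length R + 2 \<le> (card A + 2) div 2"
      using split_decomposition[OF fin(1) vAB(1) VAB(1) _ _ _ sub(1,3) cA] cV AB(3,4) True by force
    obtain q q' R' where q: "decm ((v # q) # (v # q') # R') (mset_set EB)" "length R' + 2 \<le> (card B + 2) div 2"
      using split_decomposition[OF fin(2) vAB(2) VAB(2) _ _ _ sub(2,4) cB] cV AB(3,4) True by force
    have rot: "decm ((v # r') # (v # r) # S) M" if "decm ((v # r) # (v # r') # S) M" for r r' S and M :: "'a set multiset"
      using that by (auto simp: decm_def ac_simps)
    have t: "set p \<subseteq> A" "set p' \<subseteq> A" "set q \<subseteq> B" "set q' \<subseteq> B"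
      using decm_tail[OF p(1) sub(1,3)] decm_tail[OF rot[OF p(1)] sub(1,3)]
        decm_tail[OF q(1) sub(2,4)] decm_tail[OF rot[OF q(1)] sub(2,4)] by blast+
    have "set p \<inter> set q = {}" using t AB(2) by blast
    from decm_glue[OF p(1) q(1) this]
    have "decm ((rev p @ v # q) # ((v # p') # R) @ (v # q') # R') (mset_set E)" by (simp add: M)
    then have 1: "decm ((v # p') # (v # q') # (rev p @ v # q) # R @ R') (mset_set E)"
      by (auto simp: decm_def ac_simps)
    have d: "distinct (rev p' @ v # q')" using 1 t AB(2) by (auto simp: decm_def)
    have "mset (el (rev p' @ v # q')) = mset (el (v # p')) + mset (el (v # q'))"
      using el_append[of "rev p'" v q'] mset_el_rev[of "v # p'"] by simp
    then have "decm ((rev p' @ v # q') # (rev p @ v # q) # R @ R') (mset_set E)"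
      using 1 d by (simp add: decm_def add.assoc)
    moreover have "length ((rev p' @ v # q') # (rev p @ v # q) # R @ R') \<le> card V div 2"
      using p(2) q(2) True cV by (auto elim!: evenE)
    ultimately show False using pnleI finE ncx by blast
  qed
qed

text \<open>Otherwise the path \<open>x v y\<close> could be replaced by an edge: subdividing that edge again costs no path.\<close>

lemma suppress:
  assumes v: "nb E v = {x, y}" "v \<in> V" "x \<noteq> y"
    and T': "insert {x, y} {e\<in>E. v \<notin> e} \<subseteq> T'" "good (V - {v}) T'"
  shows "{x, y} \<in> E"
proof (rule ccontr)
  assume xy: "{x, y} \<notin> E"
  let ?E = "insert {x, y} {e\<in>E. v \<notin> e}"
  have vx: "{v, x} \<in> E" "{v, y} \<in> E" using v(1) by (auto simp: nb_def)
  have xyV: "x \<in> V - {v}" "y \<in> V - {v}" using vx edge by auto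
  have E2: "?E \<subseteq> all2 (V - {v})"
  proof -
    have "{e\<in>E. v \<notin> e} \<subseteq> all2 (V - {v})" using EV unfolding all2_def by blast
    moreover have "{x, y} \<in> all2 (V - {v})" using xyV v(3) by (simp add: all2_edge)
    ultimately show ?thesis by blast
  qed
  have EE: "E - ?E = {{v, x}, {v, y}}"
  proof
    show "E - ?E \<subseteq> {{v, x}, {v, y}}"
    proof
      fix e assume e: "e \<in> E - ?E"
      then have "e \<in> all2 V" using EV by blast
      then obtain a b where ab: "e = {a, b}" by (auto simp: all2_def card_2_iff)
      then have "a = v \<or> b = v" using e by auto
      then obtain u where u: "e = {v, u}" using ab by auto
      then have "u \<in> nb E v" using e by (simp add: nb_def)
      then show "e \<in> {{v, x}, {v, y}}" using u v(1) by auto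
    qed
    have "v \<noteq> x" "v \<noteq> y" using xyV by auto
    then have "{v, x} \<noteq> {x, y}" "{v, y} \<noteq> {x, y}" by (auto simp: doubleton_eq_iff)
    then show "{{v, x}, {v, y}} \<subseteq> E - ?E" using vx by simp
  qed
  have "conn (V - {v}) ?E"
  proof (rule conn_delete[OF conn, where K = "{x, y}"])
    show "e \<subseteq> V - {v}" if "e \<in> ?E" for e using that E2 by (auto simp: all2_def)
    show "e \<subseteq> {x, y} \<union> {v}" if "e \<in> E - ?E" for e using that unfolding EE by auto
    show "{x, y} \<subseteq> S \<or> {x, y} \<inter> S = {}" if "closed_in ?E S" for S
      using closed_inD[OF that, of x y] by auto
  qed (use v in auto)
  moreover have cV: "card (V - {v}) = card V - 1" "0 < card V"
    using v(2) finV by (auto simp: card_gt_0_iff)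
  ultimately have "pnle ?E (card (V - {v}) div 2) \<or> exc (V - {v}) ?E"
    using IH[OF _ _ E2 T'] finV by simp
  \<comment> \<open>On one vertex less, even an exceptional graph has a decomposition into
    \<open>card V div 2\<close> paths, so no exception arises here.\<close>
  then have bound: "pnle ?E (card V div 2)"
  proof
    assume "pnle ?E (card (V - {v}) div 2)"
    then show ?thesis by (rule pnle_mono) (use cV in simp)
  next
    assume "exc (V - {v}) ?E"
    from exc_pnle[OF this] show ?thesis using cV by simp
  qed
  obtain ps where ps: "length ps \<le> card V div 2" "decm ps (mset_set ?E)" "\<forall>p\<in>set ps. Suc 0 < length p"
    using pnle_long[OF bound] by blast
  let ?F = "{e\<in>E. v \<notin> e}"
  have ME: "mset_set ?E = mset_set ?F + {#{x, y}#}" using xy finE by simp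
  have nv: "v \<notin> \<Union> (set_mset (mset_set ?F + {#{x, y}#}))" using xyV finE by auto
  obtain qs where qs: "length qs = length ps" "decm qs (mset_set ?F + {#{x, v}, {v, y}#})"
    using decm_lift[OF ps(2)[unfolded ME] nv ps(3)] by blast
  have "E = insert {x, v} (insert {v, y} ?F)"
  proof -
    have "E = (E - ?E) \<union> ?F" using xy by blast
    also have "\<dots> = {{v, x}, {v, y}} \<union> ?F" unfolding EE ..
    also have "\<dots> = insert {x, v} (insert {v, y} ?F)"
      unfolding insert_commute[of x v] by simp
    finally show ?thesis .
  qed
  moreover have "mset_set (insert {x, v} (insert {v, y} ?F)) = mset_set ?F + {#{x, v}, {v, y}#}"
    using finE v(3) xyV by (simp add: doubleton_eq_iff add_mset_commute)
  ultimately have "decm qs (mset_set E)" using qs(2) by simp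
  then show False using pnleI[OF finE] qs(1) ps(1) ncx by metis
qed

end

section \<open>Even order\<close>

text \<open>The values of \<open>lab\<close> outside \<open>{0, 1, 2, 3, 5, 6}\<close> are irrelevant.\<close>

definition lab :: "'a \<Rightarrow> 'a \<Rightarrow> 'a \<Rightarrow> 'a \<Rightarrow> 'a \<Rightarrow> 'a \<Rightarrow> nat \<Rightarrow> 'a" where
  "lab x y z t v w i = (if i = 0 then x else if i = 1 then y else if i = 2 then z else if i = 3 then t
     else if i = 5 then v else w)"

lemma lab_simps [simp]:
  "lab x y z t v w 0 = x" "lab x y z t v w (Suc 0) = y" "lab x y z t v w 1 = y" "lab x y z t v w 2 = z"
  "lab x y z t v w 3 = t" "lab x y z t v w 5 = v" "lab x y z t v w 6 = w"
  by (simp_all add: lab_def)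

lemma lessThan_lits: "{..<1::nat} = {0}" "{..<2::nat} = {0, 1}" "{..<3::nat} = {0, 1, 2}"
    "{..<4::nat} = {0, 1, 2, 3}"
  by auto

lemma im_simps [simp]: "im f [] = {}" "im f ((i, j) # es) = insert {f i, f j} (im f es)"
  by (auto simp: im_def)

lemma lab_image: "q \<in> {1, 2, 3, 4} \<Longrightarrow> lab x y z t v w ` {..<q} = set (take q [x, y, z, t])"
  by (elim insertE emptyE; hypsubst) (simp_all add: lessThan_lits lessThan_Suc)

lemma lab_inj:
  assumes "q \<in> {1, 2, 3, 4}" "distinct (take q [x, y, z, t] @ [v, w])"
  shows "inj_on (lab x y z t v w) ({..<q} \<union> set [5, 6])"
  using assms
  by (elim insertE emptyE; hypsubst) (auto simp: lessThan_lits lessThan_Suc insert_Diff_if)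

lemma lab_inj1:
  assumes "q \<in> {1, 2, 3, 4}" "distinct (take q [x, y, z, t] @ [v])"
  shows "inj_on (lab x y z t v w) ({..<q} \<union> set [5])"
  using assms by (elim insertE emptyE; hypsubst) (auto simp: lessThan_lits lessThan_Suc insert_Diff_if)

context mincx
begin

lemma edgeE:
  assumes "e \<in> E"
  obtains a b where "e = {a, b}" "a \<noteq> b" "a \<in> V" "b \<in> V"
proof -
  have "e \<subseteq> V" "card e = 2" using assms EV unfolding all2_def by blast+
  then show ?thesis using that by (auto simp: card_2_iff)
qed

lemma nb_sym: "a \<in> nb E b \<longleftrightarrow> b \<in> nb E a"
  by (simp add: nb_def insert_commute)

text \<open>The form of \<open>reduce\<close> in which, for concrete labels, all side conditions
  except \<open>link\<close> are mostly a matter of evaluation.\<close>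

lemma reduce2:
  assumes red: "reducible [5, 6] J N q ks (lab x y z t v w)"
    and q: "q \<in> {1, 2, 3, 4}" and dist: "distinct (take q [x, y, z, t] @ [v, w])"
    and V: "set (take q [x, y, z, t]) \<subseteq> V" "v \<in> V" "w \<in> V"
    and N: "im (lab x y z t v w) N \<subseteq> E"
    and J: "im (lab x y z t v w) J \<inter> E = {}" "im (lab x y z t v w) J \<subseteq> T"
    and labs: "list_all (\<lambda>(i, j). i < q \<and> j < q) J"
      "list_all (\<lambda>(i, j). (i < q \<or> i = 5 \<or> i = 6) \<and> (j < q \<or> j = 5 \<or> j = 6)) N"
    and nbs: "\<forall>u\<in>nb E v. {v, u} \<in> im (lab x y z t v w) N" "\<forall>u\<in>nb E w. {w, u} \<in> im (lab x y z t v w) N"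
    and link: "\<And>S. closed_in ((E - im (lab x y z t v w) N) \<union> im (lab x y z t v w) J) S \<Longrightarrow>
      set (take q [x, y, z, t]) \<subseteq> S \<or> set (take q [x, y, z, t]) \<inter> S = {}"
    and size: "4 \<le> card V"
    and ks: "5 \<in> set ks" "card V = 5 \<Longrightarrow> 3 \<in> set ks \<or> J = [] \<and> \<not> all2 (V - {v, w}) \<subseteq> E"
  shows False
proof (rule reduce[OF red])
  show "inj_on (lab x y z t v w) ({..<q} \<union> set [5, 6])" by (rule lab_inj[OF q dist])
  show "lab x y z t v w ` {..<q} \<subseteq> V" using lab_image[OF q] V(1) by metis
  show "\<forall>(i, j)\<in>set N. i \<in> {..<q} \<union> set [5, 6] \<and> j \<in> {..<q} \<union> set [5, 6]"
    using labs(2) by (auto simp: list_all_iff)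
  show "\<forall>(i, j)\<in>set J. i < q \<and> j < q" using labs(1) by (auto simp: list_all_iff)
  show "{lab x y z t v w i, u} \<in> im (lab x y z t v w) N"
    if "i \<in> set [5, 6]" "{lab x y z t v w i, u} \<in> E" for i u
    using that nbs by (auto simp: in_nb)
  show "lab x y z t v w ` {..<q} \<subseteq> S \<or> lab x y z t v w ` {..<q} \<inter> S = {}"
    if "closed_in ((E - im (lab x y z t v w) N) \<union> im (lab x y z t v w) J) S" for S
    using link[OF that] lab_image[OF q, of x y z t v w] by simp
qed (use assms in auto)

lemma reduce1:
  assumes red: "reducible [5] J N q ks (lab x y z t v v)" and even: "even (card V)"
    and q: "q \<in> {1, 2, 3, 4}" and dist: "distinct (take q [x, y, z, t] @ [v])"
    and V: "set (take q [x, y, z, t]) \<subseteq> V" "v \<in> V"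
    and N: "im (lab x y z t v v) N \<subseteq> E"
    and J: "im (lab x y z t v v) J \<inter> E = {}" "im (lab x y z t v v) J \<subseteq> T"
    and labs: "list_all (\<lambda>(i, j). i < q \<and> j < q) J"
      "list_all (\<lambda>(i, j). (i < q \<or> i = 5) \<and> (j < q \<or> j = 5)) N"
    and nbs: "\<forall>u\<in>nb E v. {v, u} \<in> im (lab x y z t v v) N"
    and link: "\<And>S. closed_in ((E - im (lab x y z t v v) N) \<union> im (lab x y z t v v) J) S \<Longrightarrow>
      set (take q [x, y, z, t]) \<subseteq> S \<or> set (take q [x, y, z, t]) \<inter> S = {}"
    and size: "3 \<le> card V" and ks: "5 \<in> set ks" "3 \<in> set ks"
  shows False
proof (rule reduce[OF red])
  show "inj_on (lab x y z t v v) ({..<q} \<union> set [5])" by (rule lab_inj1[OF q dist])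
  show "lab x y z t v v ` {..<q} \<subseteq> V" using lab_image[OF q] V(1) by metis
  show "\<forall>(i, j)\<in>set N. i \<in> {..<q} \<union> set [5] \<and> j \<in> {..<q} \<union> set [5]"
    using labs(2) by (auto simp: list_all_iff)
  show "\<forall>(i, j)\<in>set J. i < q \<and> j < q" using labs(1) by (auto simp: list_all_iff)
  show "{lab x y z t v v i, u} \<in> im (lab x y z t v v) N"
    if "i \<in> set [5]" "{lab x y z t v v i, u} \<in> E" for i u
    using that nbs by (auto simp: in_nb)
  show "lab x y z t v v ` {..<q} \<subseteq> S \<or> lab x y z t v v ` {..<q} \<inter> S = {}"
    if "closed_in ((E - im (lab x y z t v v) N) \<union> im (lab x y z t v v) J) S" for S
    using link[OF that] lab_image[OF q, of x y z t v v] by simp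
qed (use assms in auto)

lemma card_ge_2: "2 \<le> card V"
proof (rule ccontr)
  assume "\<not> 2 \<le> card V"
  have "E = {}"
  proof (rule equals0I)
    fix e assume "e \<in> E"
    then have "e \<subseteq> V" "card e = 2" using EV unfolding all2_def by blast+
    then show False using card_mono[OF finV, of e] \<open>\<not> 2 \<le> card V\<close> by simp
  qed
  then have "pnle E 0" by (intro pnleI[of _ "[]"]) (auto simp: decm_def)
  then show False using ncx pnle_mono by blast
qed

lemma card_ge_3: "3 \<le> card V"
proof (rule ccontr)
  assume "\<not> 3 \<le> card V"
  then have "card V = 2" using card_ge_2 by simp
  then obtain a b where ab: "V = {a, b}" "a \<noteq> b" by (auto simp: card_2_iff)
  have "E \<subseteq> {{a, b}}"
  proof
    fix e assume "e \<in> E"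
    then obtain c d where "e = {c, d}" "c \<noteq> d" "c \<in> {a, b}" "d \<in> {a, b}" using edgeE ab(1) by metis
    then show "e \<in> {{a, b}}" by (auto simp: doubleton_eq_iff)
  qed
  then have "E = {{a, b}} \<or> E = {}" by blast
  then have "pnle E 1"
  proof
    assume "E = {{a, b}}"
    then show ?thesis using ab by (intro pnleI[of _ "[[a, b]]"]) (auto simp: decm_def)
  next
    assume "E = {}"
    then show ?thesis by (intro pnleI[of _ "[]"]) (auto simp: decm_def)
  qed
  then show False using ncx \<open>card V = 2\<close> by simp
qed

lemma nb_nonempty: "v \<in> V \<Longrightarrow> nb E v \<noteq> {}"
proof -
  assume v: "v \<in> V"
  then obtain e where e: "e \<in> E" "v \<in> e" using conn_nonisolated[OF conn card_ge_2 EV] by blast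
  then obtain a b where "e = {a, b}" using edgeE by metis
  then have "{v, a} \<in> E \<or> {v, b} \<in> E" using e by (auto simp: insert_commute)
  then show "nb E v \<noteq> {}" by (auto simp: nb_def)
qed

lemma finite_nb: "finite (nb E v)"
  using nbV finV finite_subset by (metis Diff_subset)

text \<open>By \<open>cut\<close>, a part \<open>A\<close> that only \<open>a\<close> connects to at
  least two other vertices has at most one vertex; that vertex is not isolated, so \<open>a\<close>
  is its only neighbour. Most arguments on connectedness below come down to this.\<close>

lemma side:
  assumes a: "a \<in> V" and A: "A \<subseteq> V - {a}" "2 \<le> card (V - {a} - A)"
    and no: "\<And>u w. u \<in> A \<Longrightarrow> {u, w} \<in> E \<Longrightarrow> w \<in> insert a A"
  shows "A = {} \<or> (\<exists>p. A = {p} \<and> nb E p = {a})"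
proof -
  have "\<not> 2 \<le> card A"
  proof
    assume "2 \<le> card A"
    moreover have "A \<union> (V - {a} - A) = V - {a}" using A(1) by auto
    ultimately show False using cut[OF a, of A "V - {a} - A"] A(2) no by blast
  qed
  moreover have fA: "finite A" using A(1) finV finite_subset by blast
  moreover have "card A = 0 \<longleftrightarrow> A = {}" using fA by simp
  ultimately consider "A = {}" | "card A = 1" by linarith
  then show ?thesis
  proof cases
    case 2
    then obtain p where p: "A = {p}" by (auto simp: card_1_singleton_iff)
    have "nb E p \<subseteq> {a}" using no[of p] p edge by (auto simp: nb_def)
    then have "nb E p = {a}" using nb_nonempty[of p] p A(1) by auto
    then show ?thesis using p by blast
  qed simp
qed

text \<open>If one part of the graph without \<open>v\<close> has two vertices, \<open>side\<close>
  makes the other a pendant vertex at \<open>v\<close>. If neither has, a part is a single vertex,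
  which can only be adjacent to \<open>v\<close>.\<close>

lemma conn_del:
  assumes v: "v \<in> V" and np: "\<And>p. nb E p \<noteq> {v}"
  shows "conn (V - {v}) {e\<in>E. v \<notin> e}"
  unfolding conn_def
proof (intro allI impI)
  fix S assume S: "closed_in {e\<in>E. v \<notin> e} S"
  let ?A = "(V - {v}) \<inter> S" and ?B = "V - {v} - S"
  have cl: "a \<in> S \<longleftrightarrow> b \<in> S" if "{a, b} \<in> E" "a \<noteq> v" "b \<noteq> v" for a b
    using closed_inD[OF S, of a b] that by simp
  show "V - {v} \<subseteq> S \<or> (V - {v}) \<inter> S = {}"
  proof (cases "2 \<le> card ?B")
    case True
    have "?A = {} \<or> (\<exists>p. ?A = {p} \<and> nb E p = {v})"
    proof (rule side[OF v])
      show "2 \<le> card (V - {v} - ?A)" using True by (simp add: Diff_Int_distrib Diff_Int)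
      show "w \<in> insert v ?A" if "u \<in> ?A" "{u, w} \<in> E" for u w
        using that cl[of u w] edge by auto
    qed auto
    then show ?thesis using np by blast
  next
    case False
    show ?thesis
    proof (cases "2 \<le> card ?A")
      case True
      have "?B = {} \<or> (\<exists>p. ?B = {p} \<and> nb E p = {v})"
      proof (rule side[OF v])
        have "V - {v} - ?B = ?A" by auto
        then show "2 \<le> card (V - {v} - ?B)" using True by simp
        show "w \<in> insert v ?B" if "u \<in> ?B" "{u, w} \<in> E" for u w
          using that cl[of u w] edge by auto
      qed auto
      then show ?thesis using np by blast
    next
      case B: False
      show ?thesis
      proof (rule ccontr)
        assume n: "\<not> ?thesis"
        then obtain a where a: "a \<in> ?A" by blast
        have "?A = {a}"
        proof -
          have "card ?A \<le> 1" using B by simp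
          then have "\<forall>x\<in>?A. \<forall>y\<in>?A. x = y" using finV card_le_Suc0_iff_eq[of ?A] by simp
          then show ?thesis using a by blast
        qed
        have "nb E a \<subseteq> {v}"
        proof
          fix u assume "u \<in> nb E a"
          then have u: "{a, u} \<in> E" by (simp add: in_nb)
          show "u \<in> {v}"
          proof (rule ccontr)
            assume "u \<notin> {v}"
            then have "u \<in> ?A" using cl[OF u] edge[OF u] a by simp
            then show False using \<open>?A = {a}\<close> edge[OF u] by simp
          qed
        qed
        then show False using nb_nonempty[of a] np[of a] a by auto
      qed
    qed
  qed
qed

lemma pendant_even:
  assumes "even (card V)" "nb E v = {x}"
  shows False
proof (rule reduce1[OF red_one1[of "lab x x x x v v"] assms(1)])
  have e: "{v, x} \<in> E" using assms(2) by (auto simp: nb_def)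
  show "distinct (take 1 [x, x, x, x] @ [v])" "set (take 1 [x, x, x, x]) \<subseteq> V" "v \<in> V"
    "im (lab x x x x v v) [(0, 5)] \<subseteq> E"
    using e edge[OF e] by (auto simp: insert_commute)
qed (use assms(2) card_ge_3 in \<open>auto simp: insert_commute\<close>)

text \<open>A simplicial vertex \<open>s\<close> of \<open>T\<close> has one, two or three
  neighbours in \<open>E\<close>. With two, \<open>suppress\<close> makes them adjacent, which keeps
  the graph connected. With three, a missing edge between them is added and then subdivided; if none
  is missing, one of the three edges is deleted along with \<open>s\<close>, and the third neighbour
  keeps its ends connected.\<close>

lemma even_False:
  assumes ev: "even (card V)"
  shows False
proof -
  have np: "nb E p \<noteq> {v}" for p v using pendant_even[OF ev] by blast
  have "V \<noteq> {}" using card_ge_2 by auto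
  then obtain s where s: "s \<in> V" "card (nb T s \<inter> V) \<le> 3" "clique T (nb T s \<inter> V)"
    using good unfolding good_def by blast
  have sub: "nb E s \<subseteq> nb T s \<inter> V" using ET nbV[of s] by (auto simp: nb_def)
  have fin: "finite (nb T s \<inter> V)" using finV by simp
  have c3: "card (nb E s) \<le> 3" using card_mono[OF fin sub] s(2) by simp
  have cl: "{a, b} \<in> T" if "a \<in> nb E s" "b \<in> nb E s" "a \<noteq> b" for a b
    using s(3) sub that unfolding clique_def by blast
  have sV: "s \<notin> nb E s" "nb E s \<subseteq> V" using nbV by auto
  have "card (nb E s) \<noteq> 0" using nb_nonempty[OF s(1)] finite_nb by simp
  moreover have "card (nb E s) \<noteq> 1" using np by (metis card_1_singletonE)
  ultimately consider "card (nb E s) = 2" | "card (nb E s) = 3" using c3 by linarith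
  then show False
  proof cases
    case 1
    then obtain x y where xy: "nb E s = {x, y}" "x \<noteq> y" by (auto simp: card_2_iff)
    have e: "{s, x} \<in> E" "{s, y} \<in> E" using xy by (auto simp: nb_def)
    have E: "{x, y} \<in> E"
    proof (rule suppress[OF xy(1) s(1) xy(2)])
      show "insert {x, y} {e \<in> E. s \<notin> e} \<subseteq> T" using ET cl xy by auto
      show "good (V - {s}) T" using good good_mono by blast
    qed
    show False
    proof (rule reduce1[OF red_one2[of "lab x y x x s s"] ev])
      show "set (take 2 [x, y, x, x]) \<subseteq> S \<or> set (take 2 [x, y, x, x]) \<inter> S = {}"
        if "closed_in ((E - im (lab x y x x s s) [(0, 5), (1, 5)]) \<union> im (lab x y x x s s) []) S" for S
      proof -
        have "{x, y} \<notin> im (lab x y x x s s) [(0, 5), (1, 5)]" using sV xy by (auto simp: doubleton_eq_iff)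
        then have "x \<in> S \<longleftrightarrow> y \<in> S" using closed_inD[OF that, of x y] E by simp
        then show ?thesis by auto
      qed
    qed (use xy sV s e card_ge_3 in \<open>auto simp: insert_commute\<close>)
  next
    case 2
    then obtain x y z where xyz: "nb E s = {x, y, z}" "distinct [x, y, z]" by (auto simp: card_3_iff)
    have c: "conn (V - {s}) {e\<in>E. s \<notin> e}" using conn_del[OF s(1)] np by blast
    have red: False if xyz: "nb E s = {x, y, z}" "distinct [x, y, z]" and yz: "{y, z} \<notin> E" for x y z
    proof (rule reduce1[OF red_one3_add[of "lab x y z x s s"] ev])
      have e: "{s, x} \<in> E" "{s, y} \<in> E" "{s, z} \<in> E" using xyz by (auto simp: nb_def)
      then show "im (lab x y z x s s) [(0, 5), (1, 5), (2, 5)] \<subseteq> E" by (simp add: insert_commute)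
      show "set (take 3 [x, y, z, x]) \<subseteq> S \<or> set (take 3 [x, y, z, x]) \<inter> S = {}"
        if S: "closed_in ((E - im (lab x y z x s s) [(0, 5), (1, 5), (2, 5)]) \<union> im (lab x y z x s s) [(1, 2)]) S" for S
      proof -
        have "closed_in {e\<in>E. s \<notin> e} S" using S unfolding closed_in_def by auto
        then have "V - {s} \<subseteq> S \<or> (V - {s}) \<inter> S = {}" using connD[OF c] by blast
        then show ?thesis using xyz sV by auto
      qed
    qed (use xyz sV s card_ge_3 yz cl in \<open>auto simp: insert_commute\<close>)
    show False
    proof (cases "{x, y} \<in> E \<and> {y, z} \<in> E \<and> {x, z} \<in> E")
      case False
      then show False
        using red[of x y z] red[of y x z] red[of z x y] xyz by (auto simp: insert_commute)
    next
      case True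
      show False
      proof (rule reduce1[OF red_one3[of "lab x y z x s s"] ev])
        have e: "{s, x} \<in> E" "{s, y} \<in> E" "{s, z} \<in> E" using xyz by (auto simp: nb_def)
        then show "im (lab x y z x s s) [(0, 5), (1, 5), (2, 5), (1, 2)] \<subseteq> E"
          using True by (simp add: insert_commute)
        show "set (take 3 [x, y, z, x]) \<subseteq> S \<or> set (take 3 [x, y, z, x]) \<inter> S = {}"
          if S: "closed_in ((E - im (lab x y z x s s) [(0, 5), (1, 5), (2, 5), (1, 2)]) \<union> im (lab x y z x s s) []) S" for S
        proof -
          have "{x, y} \<notin> im (lab x y z x s s) [(0, 5), (1, 5), (2, 5), (1, 2)]"
            "{x, z} \<notin> im (lab x y z x s s) [(0, 5), (1, 5), (2, 5), (1, 2)]"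
            using sV xyz by (auto simp: doubleton_eq_iff)
          then have "x \<in> S \<longleftrightarrow> y \<in> S" "x \<in> S \<longleftrightarrow> z \<in> S"
            using closed_inD[OF S, of x y] closed_inD[OF S, of x z] True by simp_all
          then show ?thesis by auto
        qed
      qed (use xyz sV s card_ge_3 in \<open>auto simp: insert_commute\<close>)
    qed
  qed
qed

end

section \<open>Odd order\<close>

locale mincx_odd = mincx +
  assumes od: "odd (card V)"
begin

lemma ge5: "5 \<le> card V"
proof (rule ccontr)
  assume "\<not> 5 \<le> card V"
  then have 3: "card V = 3" using card_ge_3 od by presburger
  then obtain a b c where abc: "V = {a, b, c}" "distinct [a, b, c]" by (auto simp: card_3_iff)
  have all: "all2 V \<subseteq> {{a, b}, {a, c}, {b, c}}"
  proof
    fix e assume "e \<in> all2 V"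
    then obtain x y where "e = {x, y}" "x \<noteq> y" "x \<in> V" "y \<in> V" by (auto simp: all2_def card_2_iff)
    then show "e \<in> {{a, b}, {a, c}, {b, c}}" using abc by auto
  qed
  have path: False if "E \<subseteq> {{x, y}, {y, z}}" "distinct [x, y, z]" for x y z
  proof -
    have "E = {{x, y}, {y, z}} \<or> E = {{x, y}} \<or> E = {{y, z}} \<or> E = {}" using that(1) by blast
    moreover have "pnle {{x, y}, {y, z}} 1"
      using that(2) by (intro pnleI[of _ "[[x, y, z]]"]) (auto simp: decm_def doubleton_eq_iff)
    moreover have "pnle {{x, y}} 1" using that(2) by (intro pnleI[of _ "[[x, y]]"]) (auto simp: decm_def)
    moreover have "pnle {{y, z}} 1" using that(2) by (intro pnleI[of _ "[[y, z]]"]) (auto simp: decm_def)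
    moreover have "pnle ({} :: 'a set set) 1" by (intro pnleI[of _ "[]"]) (auto simp: decm_def)
    ultimately show False using ncx 3 by (metis div_less_dividend One_nat_def numeral_3_eq_3 numeral_2_eq_2 Suc_1 div2_Suc_Suc div_less lessI zero_less_Suc)
  qed
  have "E \<noteq> all2 V" using nexc 3 by (auto simp: exc_def)
  then have "{a, b} \<notin> E \<or> {a, c} \<notin> E \<or> {b, c} \<notin> E" using EV all by blast
  then show False
  proof (elim disjE)
    assume "{a, b} \<notin> E"
    then show False using path[of a c b] EV all abc by (force simp: insert_commute)
  next
    assume "{a, c} \<notin> E"
    then show False using path[of a b c] EV all abc by (force simp: insert_commute)
  next
    assume "{b, c} \<notin> E"
    then show False using path[of b a c] EV all abc by (force simp: insert_commute)
  qed
qed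

section \<open>Pendant vertices at odd order\<close>

lemma nbD: "nb E v = X \<Longrightarrow> u \<in> X \<Longrightarrow> {v, u} \<in> E \<and> {u, v} \<in> E \<and> u \<in> V \<and> v \<in> V \<and> u \<noteq> v"
  using edge by (auto simp: nb_def insert_commute)

text \<open>The two pendant vertices would be a part of size two cut off by \<open>x\<close>, and at
  least two further vertices exist by \<open>ge5\<close>.\<close>

lemma no_double_pendant:
  assumes "nb E p = {x}" "nb E p' = {x}" "p \<noteq> p'"
  shows False
proof (rule cut)
  have e: "{p, x} \<in> E" "{p', x} \<in> E" using assms by (auto simp: nb_def)
  have in_V: "x \<in> V" "p \<in> V" "p' \<in> V" "p \<noteq> x" "p' \<noteq> x" using edge[OF e(1)] edge[OF e(2)] by auto
  show "x \<in> V" by fact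
  show "{p, p'} \<union> (V - {x, p, p'}) = V - {x}" using in_V by auto
  show "2 \<le> card {p, p'}" using assms(3) by simp
  have "card (V - {x, p, p'}) = card V - 3"
    using in_V assms(3) by (subst card_Diff_subset) (auto simp: card_insert_if)
  then show "2 \<le> card (V - {x, p, p'})" using ge5 by simp
  show "{a, b} \<notin> E" if "a \<in> {p, p'}" "b \<in> V - {x, p, p'}" for a b
    using that assms by (auto simp: nb_def)
qed auto

text \<open>A further part cut off by \<open>v\<close> would be a second pendant vertex at
  \<open>v\<close>; \<open>p\<close> itself counts among the vertices on the other side.\<close>

lemma conn_del2:
  assumes p: "nb E p = {v}"
  shows "conn (V - {v, p}) {e\<in>E. v \<notin> e \<and> p \<notin> e}"
  unfolding conn_def
proof (intro allI impI)
  fix S assume S: "closed_in {e\<in>E. v \<notin> e \<and> p \<notin> e} S"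
  have pv: "{p, v} \<in> E" using p by (auto simp: nb_def)
  let ?A = "(V - {v, p}) \<inter> S"
  show "V - {v, p} \<subseteq> S \<or> (V - {v, p}) \<inter> S = {}"
  proof (rule ccontr)
    assume n: "\<not> ?thesis"
    then obtain b where b: "b \<in> V - {v, p}" "b \<notin> S" by auto
    have "?A = {} \<or> (\<exists>p'. ?A = {p'} \<and> nb E p' = {v})"
    proof (rule side)
      show "v \<in> V" "?A \<subseteq> V - {v}" using edge[OF pv] by auto
      have "{b, p} \<subseteq> V - {v} - ?A" using b edge[OF pv] by auto
      moreover have "card {b, p} = 2" using b by auto
      ultimately show "2 \<le> card (V - {v} - ?A)" using finV by (metis card_mono finite_Diff)
      show "w \<in> insert v ?A" if u: "u \<in> ?A" "{u, w} \<in> E" for u w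
      proof -
        have "w \<noteq> p" using u p by (auto simp: nb_def insert_commute)
        then show ?thesis using closed_inD[OF S, of u w] u edge[OF u(2)] by auto
      qed
    qed
    then show False using n no_double_pendant[OF p] by blast
  qed
qed

text \<open>A missing edge \<open>x y\<close> is added. A present one is deleted, and this can
  disconnect the graph only if nothing but at most one pendant vertex hangs at \<open>x\<close> and
  at \<open>y\<close> each. Odd order then leaves exactly one of them, and the graph is decomposed
  directly.\<close>

lemma leafpend2:
  assumes v: "nb E v = {x, y, p}" and p: "nb E p = {v}" and d: "distinct [x, y, p]" and T: "{x, y} \<in> T"
  shows False
proof -
  have e: "{v, x} \<in> E" "{v, y} \<in> E" "{v, p} \<in> E" using v by (auto simp: nb_def)
  have V: "x \<in> V" "y \<in> V" "p \<in> V" "v \<in> V" "v \<noteq> x" "v \<noteq> y" "v \<noteq> p" using e edge by auto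
  show False
  proof (cases "{x, y} \<in> E")
    case False
    show False
    proof (rule reduce2[OF red_leafpend2_add[of "lab x y x x v p"]])
      show "set (take 2 [x, y, x, x]) \<subseteq> S \<or> set (take 2 [x, y, x, x]) \<inter> S = {}"
        if "closed_in ((E - im (lab x y x x v p) [(5, 6), (0, 5), (1, 5)]) \<union> im (lab x y x x v p) [(0, 1)]) S" for S
        using closed_inD[OF that, of x y] by simp
    qed (use v p d T V e False ge5 in \<open>auto simp: insert_commute\<close>)
  next
    case True
    show False
    proof (rule reduce2[OF red_leafpend2[of "lab x y x x v p"]])
      fix S assume "closed_in ((E - im (lab x y x x v p) [(5, 6), (0, 5), (1, 5), (0, 1)]) \<union> im (lab x y x x v p) []) S"
      then have S: "closed_in (E - {{v, p}, {v, x}, {v, y}, {x, y}}) S" by (simp add: insert_commute)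
      show "set (take 2 [x, y, x, x]) \<subseteq> S \<or> set (take 2 [x, y, x, x]) \<inter> S = {}"
      proof (rule ccontr)
        assume "\<not> ?thesis"
        then have xy: "x \<in> S \<longleftrightarrow> y \<notin> S" by auto
        have cl: "u \<in> S \<longleftrightarrow> w \<in> S" if "{u, w} \<in> E" "u \<notin> {v, p}" "w \<notin> {v, p}" "{u, w} \<noteq> {x, y}" for u w
        proof -
          have "u \<noteq> v" "w \<noteq> v" using that by auto
          then have "{u, w} \<notin> {{v, p}, {v, x}, {v, y}, {x, y}}"
            using that(4) by (simp add: doubleton_eq_iff)
          then have "{u, w} \<in> E - {{v, p}, {v, x}, {v, y}, {x, y}}" using that(1) by simp
          from closed_inD[OF S this] show ?thesis .
        qed
        have nvp: "w = x \<or> w = y \<or> u = p" if "{u, w} \<in> E" "u \<in> {v, p}" "w \<notin> {v, p}" for u w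
          using that v p by (auto simp: nb_def)
        have half: "A = {} \<or> (\<exists>q. A = {q} \<and> nb E q = {a})"
          if A: "A = {u \<in> V - {v, p, a}. u \<in> S \<longleftrightarrow> a \<in> S}" and ab: "{a, b} = {x, y}" for A a b
        proof (rule side)
          show "a \<in> V" using ab V by (auto simp: doubleton_eq_iff)
          show "A \<subseteq> V - {a}" using A by auto
          have "a \<notin> {v, p}" using ab V d by (auto simp: doubleton_eq_iff)
          then have "{v, p} \<subseteq> V - {a} - A" using A V by auto
          moreover have "card {v, p} = 2" using V by simp
          ultimately show "2 \<le> card (V - {a} - A)" using finV by (metis card_mono finite_Diff)
          fix u w assume u: "u \<in> A" "{u, w} \<in> E"
          have "u \<notin> {x, y}" using u(1) A ab xy by (auto simp: doubleton_eq_iff)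
          then have "w \<notin> {v, p}"
            using u A v p by (auto simp: nb_def insert_commute)
          moreover have "{u, w} \<noteq> {x, y}" using \<open>u \<notin> {x, y}\<close> by auto
          ultimately have "u \<in> S \<longleftrightarrow> w \<in> S" using cl[OF u(2)] u(1) A by auto
          then show "w \<in> insert a A" using u A edge[OF u(2)] \<open>w \<notin> {v, p}\<close> by auto
        qed
        define A where "A = {u \<in> V - {v, p, x}. u \<in> S \<longleftrightarrow> x \<in> S}"
        define B where "B = {u \<in> V - {v, p, y}. u \<in> S \<longleftrightarrow> y \<in> S}"
        have AB: "A = {} \<or> (\<exists>q. A = {q} \<and> nb E q = {x})" "B = {} \<or> (\<exists>q. B = {q} \<and> nb E q = {y})"
          using half[OF A_def, of y] half[OF B_def, of x] by (auto simp: insert_commute)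
        have VAB: "V = {v, p, x, y} \<union> A \<union> B" "A \<inter> {v, p, x, y} = {}" "B \<inter> {v, p, x, y} = {}" "A \<inter> B = {}"
          using V xy by (auto simp: A_def B_def)
        have c4: "card {v, p, x, y} = 4" using V d by (auto simp: card_insert_if)
        \<comment> \<open>The bull: a triangle \<open>a b v\<close> with the pendant edges
          \<open>q a\<close> and \<open>p v\<close>; two paths suffice.\<close>
        have bull: False if V5: "V = {v, p, a, b, q}" and q: "nb E q = {a}" and ab: "{a, b} = {x, y}" "q \<notin> {v, p, x, y}" for a b q
        proof -
          have abn: "a \<noteq> b" "a \<noteq> v" "b \<noteq> v" "a \<noteq> p" "b \<noteq> p" using ab V d by (auto simp: doubleton_eq_iff)
          have nv: "nb E v = {a, b, p}" using v ab by auto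
          have qn: "q \<noteq> v" "q \<noteq> p" "q \<noteq> a" "q \<noteq> b" using ab by auto
          have "E = {{q, a}, {a, b}, {b, v}, {v, p}, {v, a}}"
          proof
            show "{{q, a}, {a, b}, {b, v}, {v, p}, {v, a}} \<subseteq> E"
              using nbD[OF q, of a] nbD[OF nv, of a] nbD[OF nv, of b] e(3) True ab(1) by auto
            show "E \<subseteq> {{q, a}, {a, b}, {b, v}, {v, p}, {v, a}}"
            proof
              fix f assume f: "f \<in> E"
              then obtain s t where st: "f = {s, t}" "s \<noteq> t" "s \<in> V" "t \<in> V" using edgeE by metis
              have half: "{c, d} \<in> {{q, a}, {a, b}, {b, v}, {v, p}, {v, a}}"
                if c: "{c, d} \<in> E" "c \<in> {v, p, q}" for c d
              proof -
                have "d \<in> nb E c" using c by (simp add: nb_def)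
                then show ?thesis using c(2) q p nv by (elim insertE emptyE) (auto simp: insert_commute)
              qed
              show "f \<in> {{q, a}, {a, b}, {b, v}, {v, p}, {v, a}}"
              proof (cases "s \<in> {v, p, q} \<or> t \<in> {v, p, q}")
                case True
                then show ?thesis using half[of s t] half[of t s] f st(1) by (metis insert_commute)
              next
                case False
                then have "s \<in> {a, b}" "t \<in> {a, b}" using st(3,4) V5 by blast+
                then have "f = {a, b}" using st(1,2) by auto
                then show ?thesis by simp
              qed
            qed
          qed
          moreover have "decm [[q, a, b, v, p], [v, a]] (mset_set {{q, a}, {a, b}, {b, v}, {v, p}, {v, a}})"
            using abn qn V by (auto simp: decm_def doubleton_eq_iff)
          ultimately have "pnle E 2" using pnleI[OF finE, of "[[q, a, b, v, p], [v, a]]" 2] by simp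
          moreover have "card V = 5" using V5 abn qn V by (simp add: card_insert_if)
          ultimately show False using ncx by simp
        qed
        from AB show False
        proof (elim disjE exE conjE)
          assume "A = {}" "B = {}"
          then have "card V = 4" using VAB c4 by simp
          then show False using od by simp
        next
          fix q assume "A = {}" "B = {q}" "nb E q = {y}"
          then show False using bull[of y x q] VAB by auto
        next
          fix q assume "A = {q}" "nb E q = {x}" "B = {}"
          then show False using bull[of x y q] VAB by auto
        next
          fix q q' assume "A = {q}" "B = {q'}"
          then have q: "q \<notin> insert q' {v, p, x, y}" "q' \<notin> {v, p, x, y}"
            "V = insert q (insert q' {v, p, x, y})" using VAB by auto
          have "card V = Suc (card (insert q' {v, p, x, y}))"
            unfolding q(3) by (rule card_insert_disjoint) (use q(1) in auto)
          also have "card (insert q' {v, p, x, y}) = 5"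
            using card_insert_disjoint[OF _ q(2)] c4 by simp
          finally show False using od by simp
        qed
      qed
    qed (use v p d T V e True ge5 in \<open>auto simp: insert_commute\<close>)
  qed
qed

text \<open>Any missing edge among \<open>x\<close>, \<open>y\<close>, \<open>z\<close> is added; if
  all are present, \<open>y z\<close> is deleted and \<open>x\<close> still connects its
  ends.\<close>

lemma leafpend3:
  assumes v: "nb E v = {x, y, z, p}" and p: "nb E p = {v}" and d: "distinct [x, y, z, p]"
    and T: "clique T {x, y, z}"
  shows False
proof -
  have add: False if v: "nb E v = {x, y, z, p}" and d: "distinct [x, y, z, p]" and T: "{y, z} \<in> T"
    and n: "{y, z} \<notin> E" for x y z
  proof (rule reduce2[OF red_leafpend3_add[of "lab x y z x v p"]])
    have e: "{v, x} \<in> E" "{v, y} \<in> E" "{v, z} \<in> E" "{v, p} \<in> E" using v by (auto simp: nb_def)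
    then show "im (lab x y z x v p) [(5, 6), (0, 5), (1, 5), (2, 5)] \<subseteq> E"
      by (simp add: insert_commute)
    have V: "x \<in> V" "y \<in> V" "z \<in> V" "p \<in> V" "v \<in> V" "v \<notin> {x, y, z, p}" using e edge by auto
    then show "set (take 3 [x, y, z, x]) \<subseteq> V" "v \<in> V" "p \<in> V"
      "distinct (take 3 [x, y, z, x] @ [v, p])" using d by auto
    show "set (take 3 [x, y, z, x]) \<subseteq> S \<or> set (take 3 [x, y, z, x]) \<inter> S = {}"
      if S: "closed_in ((E - im (lab x y z x v p) [(5, 6), (0, 5), (1, 5), (2, 5)]) \<union> im (lab x y z x v p) [(1, 2)]) S" for S
    proof -
      have "closed_in {e\<in>E. v \<notin> e \<and> p \<notin> e} S" using S unfolding closed_in_def by auto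
      from connD[OF conn_del2[OF p] this] show ?thesis using V d by auto
    qed
  qed (use v p d T n ge5 in \<open>auto simp: insert_commute\<close>)
  have T': "{x, y} \<in> T" "{y, z} \<in> T" "{x, z} \<in> T" using T d by (auto simp: clique_def)
  show False
  proof (cases "{x, y} \<in> E \<and> {y, z} \<in> E \<and> {x, z} \<in> E")
    case False
    then show False
      using add[of x y z] add[of y x z] add[of z x y] v d T' by (auto simp: insert_commute)
  next
    case True
    have e: "{v, x} \<in> E" "{v, y} \<in> E" "{v, z} \<in> E" "{v, p} \<in> E" using v by (auto simp: nb_def)
    have V: "x \<in> V" "y \<in> V" "z \<in> V" "p \<in> V" "v \<in> V" "v \<notin> {x, y, z, p}" using e edge by auto
    show False
    proof (rule reduce2[OF red_leafpend3[of "lab x y z x v p"]])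
      show "set (take 3 [x, y, z, x]) \<subseteq> S \<or> set (take 3 [x, y, z, x]) \<inter> S = {}"
        if S: "closed_in ((E - im (lab x y z x v p) [(5, 6), (0, 5), (1, 5), (2, 5), (1, 2)]) \<union> im (lab x y z x v p) []) S" for S
      proof -
        have "{x, y} \<notin> im (lab x y z x v p) [(5, 6), (0, 5), (1, 5), (2, 5), (1, 2)]"
          "{x, z} \<notin> im (lab x y z x v p) [(5, 6), (0, 5), (1, 5), (2, 5), (1, 2)]"
          using V d by (auto simp: doubleton_eq_iff)
        then have "x \<in> S \<longleftrightarrow> y \<in> S" "x \<in> S \<longleftrightarrow> z \<in> S"
          using closed_inD[OF S, of x y] closed_inD[OF S, of x z] True by simp_all
        then show ?thesis by auto
      qed
    qed (use v p d V e True ge5 in \<open>auto simp: insert_commute\<close>)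
  qed
qed

lemma adj23:
  assumes q: "nb E q = {r, s}" and r: "nb E r = {q, s, b}" and d: "distinct [q, r, s, b]"
    and T: "{s, b} \<in> T"
  shows False
proof -
  have e: "{q, r} \<in> E" "{q, s} \<in> E" "{r, s} \<in> E" "{r, b} \<in> E" using q r by (auto simp: nb_def)
  have V: "q \<in> V" "r \<in> V" "s \<in> V" "b \<in> V" using e edge by auto
  show False
  proof (cases "{s, b} \<in> E")
    case True
    show False
    proof (rule reduce2[OF red_adj23[of "lab s b s s q r"]])
      show "set (take 2 [s, b, s, s]) \<subseteq> S \<or> set (take 2 [s, b, s, s]) \<inter> S = {}"
        if "closed_in ((E - im (lab s b s s q r) [(5, 6), (0, 5), (0, 6), (1, 6)]) \<union> im (lab s b s s q r) []) S" for S
        using closed_inD[OF that, of s b] True d by (auto simp: doubleton_eq_iff)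
    qed (use q r d V e T True ge5 in \<open>auto simp: insert_commute\<close>)
  next
    case False
    show False
    proof (rule reduce2[OF red_adj23_add[of "lab s b s s q r"]])
      show "set (take 2 [s, b, s, s]) \<subseteq> S \<or> set (take 2 [s, b, s, s]) \<inter> S = {}"
        if "closed_in ((E - im (lab s b s s q r) [(5, 6), (0, 5), (0, 6), (1, 6)]) \<union> im (lab s b s s q r) [(0, 1)]) S" for S
        using closed_inD[OF that, of s b] by simp
    qed (use q r d V e T False ge5 in \<open>auto simp: insert_commute\<close>)
  qed
qed

text \<open>That is, \<open>y z\<close> is no bridge after the removal of \<open>v\<close>. If it
  were, one end, say \<open>y\<close>, would be separated from \<open>x\<close> as well. By
  \<open>side\<close> at most a pendant vertex hangs at \<open>y\<close>, so \<open>y\<close> has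
  the neighbours \<open>v\<close>, \<open>z\<close> and possibly this one: \<open>adj23\<close> or
  \<open>leafpend2\<close> applies.\<close>

lemma bridge:
  assumes v: "nb E v = {x, y, z}" and d: "distinct [x, y, z]" and T: "clique T {x, y, z}"
    and S: "closed_in ({e\<in>E. v \<notin> e} - {{y, z}}) S" and yz: "{y, z} \<in> E"
  shows "y \<in> S \<longleftrightarrow> z \<in> S"
proof -
  have core: False if v: "nb E v = {x, y, z}" and d: "distinct [x, y, z]" and T: "{x, z} \<in> T"
    and S: "closed_in ({e\<in>E. v \<notin> e} - {{y, z}}) S" and yz: "{y, z} \<in> E" and s: "y \<in> S \<longleftrightarrow> z \<notin> S" "y \<in> S \<longleftrightarrow> x \<notin> S"
    for x y z
  proof -
    have e: "{v, x} \<in> E" "{v, y} \<in> E" "{v, z} \<in> E" using v by (auto simp: nb_def)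
    have V: "x \<in> V" "y \<in> V" "z \<in> V" "v \<in> V" "v \<notin> {x, y, z}" using e edge by auto
    define A where "A = {u \<in> V - {v, y}. u \<in> S \<longleftrightarrow> y \<in> S}"
    have nA: "v \<notin> A" "x \<notin> A" "z \<notin> A" "y \<notin> A" using s by (auto simp: A_def)
    have noA: "w \<in> insert y A" if u: "u \<in> A" "{u, w} \<in> E" for u w
    proof -
      have uu: "u \<noteq> v" "u \<noteq> x" "u \<noteq> y" "u \<noteq> z" using u nA by auto
      have "w \<noteq> v" using u uu v by (auto simp: nb_def insert_commute)
      then have "{u, w} \<in> {e\<in>E. v \<notin> e} - {{y, z}}" using u(2) uu by (auto simp: doubleton_eq_iff)
      then show ?thesis using closed_inD[OF S, of u w] u \<open>w \<noteq> v\<close> edge[OF u(2)] by (auto simp: A_def)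
    qed
    have "A = {} \<or> (\<exists>p. A = {p} \<and> nb E p = {y})"
    proof (rule side[OF V(2)])
      show "A \<subseteq> V - {y}" by (auto simp: A_def)
      have "{v, z} \<subseteq> V - {y} - A" using nA V d by auto
      moreover have "card {v, z} = 2" using V by auto
      ultimately show "2 \<le> card (V - {y} - A)" using finV by (metis card_mono finite_Diff)
    qed (rule noA)
    moreover have nby: "nb E y = {v, z} \<union> {a\<in>A. {y, a} \<in> E}"
    proof
      show "nb E y \<subseteq> {v, z} \<union> {a\<in>A. {y, a} \<in> E}"
      proof
        fix u assume "u \<in> nb E y"
        then have u: "{y, u} \<in> E" by (simp add: nb_def)
        show "u \<in> {v, z} \<union> {a\<in>A. {y, a} \<in> E}"
        proof (cases "u = v \<or> u = z")
          case False
          then have "{y, u} \<in> {e\<in>E. v \<notin> e} - {{y, z}}" using u V by (auto simp: doubleton_eq_iff)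
          then have "y \<in> S \<longleftrightarrow> u \<in> S" using closed_inD[OF S] by blast
          then show ?thesis using False u edge[OF u] by (auto simp: A_def)
        qed auto
      qed
      show "{v, z} \<union> {a\<in>A. {y, a} \<in> E} \<subseteq> nb E y" using e yz by (auto simp: nb_def insert_commute)
    qed
    ultimately show False
    proof (elim disjE exE conjE)
      assume "A = {}"
      then have "nb E y = {v, z}" using nby by simp
      moreover have "nb E v = {y, z, x}" using v by auto
      ultimately show False using adj23[of y v z x] V d T by (auto simp: insert_commute)
    next
      fix p assume p: "A = {p}" "nb E p = {y}"
      then have "{y, p} \<in> E" using nbD[OF p(2), of y] by simp
      then have "nb E y = {v, z, p}" using nby p by auto
      moreover have "{v, z} \<in> T" using e ET by auto
      ultimately show False using leafpend2[of y v z p] p nA V by auto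
    qed
  qed
  show ?thesis
  proof (rule ccontr)
    assume n: "\<not> ?thesis"
    have T': "{x, y} \<in> T" "{x, z} \<in> T" using T d by (auto simp: clique_def)
    show False
    proof (cases "y \<in> S \<longleftrightarrow> x \<in> S")
      case False
      then show False using core[of x y z] assms n T' by auto
    next
      case True
      then show False using core[of x z y] assms n T' by (auto simp: insert_commute)
    qed
  qed
qed


section \<open>Removing two nonadjacent vertices\<close>

lemma nonadjacent: "{v, w} \<notin> E \<Longrightarrow> v \<notin> nb E v \<and> w \<notin> nb E v \<and> v \<notin> nb E w \<and> w \<notin> nb E w"
  using edge[of v v] edge[of w w] by (auto simp: nb_def insert_commute)

text \<open>\<open>v\<close> alone is no cut vertex. Putting \<open>w\<close> on the common side of
  its neighbours \<open>x\<close> and \<open>y\<close> turns \<open>S\<close> into a set closed in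
  the graph without \<open>v\<close>.\<close>

lemma link2:
  assumes np: "\<And>p. nb E p \<noteq> {v}" and v: "v \<in> V" "v \<noteq> w"
    and S: "closed_in {e\<in>E. v \<notin> e \<and> w \<notin> e} S"
    and w: "nb E w \<subseteq> {v, x, y}" "w \<notin> {x, y}" "x \<in> S \<longleftrightarrow> y \<in> S"
  shows "V - {v, w} \<subseteq> S \<or> (V - {v, w}) \<inter> S = {}"
proof -
  define S' where "S' = (if x \<in> S then insert w S else S - {w})"
  have same: "a \<in> S' \<longleftrightarrow> a \<in> S" if "a \<noteq> w" for a using that by (simp add: S'_def)
  have "closed_in {e\<in>E. v \<notin> e} S'"
    unfolding closed_in_def
  proof (intro allI impI)
    fix a b assume ab: "{a, b} \<in> {e\<in>E. v \<notin> e}"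
    have *: "d \<in> S' \<longleftrightarrow> w \<in> S'" if "{w, d} \<in> E" "d \<noteq> v" for d
    proof -
      have "d \<in> {x, y}" using that w(1) by (auto simp: nb_def)
      then have "d \<noteq> w" "d \<in> S \<longleftrightarrow> x \<in> S" using w(2,3) by auto
      then show ?thesis by (simp add: S'_def)
    qed
    show "a \<in> S' \<longleftrightarrow> b \<in> S'"
    proof (cases "a = w \<or> b = w")
      case True
      then show ?thesis using *[of a] *[of b] ab by (auto simp: insert_commute)
    next
      case False
      then have "{a, b} \<in> {e\<in>E. v \<notin> e \<and> w \<notin> e}" using ab by auto
      then show ?thesis using closed_inD[OF S] same False by blast
    qed
  qed
  from connD[OF conn_del[OF v(1) np] this] show ?thesis using same by blast
qed

text \<open>As in \<open>link2\<close>, with the edge \<open>y z\<close> deleted in addition. After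
  \<open>w\<close> is put back, \<open>bridge\<close> brings \<open>y\<close> and \<open>z\<close>
  to the same side, and \<open>link2\<close> applies.\<close>

lemma link2_bridge:
  assumes np: "\<And>p. nb E p \<noteq> {v}" and v: "nb E v = {x, y, z}" "v \<noteq> w"
    and d: "distinct [x, y, z]" and T: "clique T {x, y, z}" and yz: "{y, z} \<in> E"
    and S: "closed_in ({e\<in>E. v \<notin> e \<and> w \<notin> e} - {{y, z}}) S"
    and w: "nb E w \<subseteq> {v, x, t}" "w \<notin> {x, t, y, z}" "x \<in> S \<longleftrightarrow> t \<in> S"
  shows "V - {v, w} \<subseteq> S \<or> (V - {v, w}) \<inter> S = {}"
proof -
  have vV: "v \<in> V" using nbD[OF v(1), of x] by simp
  define S' where "S' = (if x \<in> S then insert w S else S - {w})"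
  have same: "a \<in> S' \<longleftrightarrow> a \<in> S" if "a \<noteq> w" for a using that by (simp add: S'_def)
  have "closed_in ({e\<in>E. v \<notin> e} - {{y, z}}) S'"
    unfolding closed_in_def
  proof (intro allI impI)
    fix a b assume ab: "{a, b} \<in> {e\<in>E. v \<notin> e} - {{y, z}}"
    have *: "d \<in> S' \<longleftrightarrow> w \<in> S'" if "{w, d} \<in> E" "d \<noteq> v" for d
    proof -
      have "d \<in> {x, t}" using that w(1) by (auto simp: nb_def)
      then have "d \<noteq> w" "d \<in> S \<longleftrightarrow> x \<in> S" using w(2,3) by auto
      then show ?thesis by (simp add: S'_def)
    qed
    show "a \<in> S' \<longleftrightarrow> b \<in> S'"
    proof (cases "a = w \<or> b = w")
      case True
      then show ?thesis using *[of a] *[of b] ab by (auto simp: insert_commute)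
    next
      case False
      then have "{a, b} \<in> {e\<in>E. v \<notin> e \<and> w \<notin> e} - {{y, z}}" using ab by auto
      then show ?thesis using closed_inD[OF S] same False by blast
    qed
  qed
  from bridge[OF v(1) d T this yz] have "y \<in> S \<longleftrightarrow> z \<in> S" using same w(2) by auto
  then have "closed_in {e\<in>E. v \<notin> e \<and> w \<notin> e} S"
    using S unfolding closed_in_def by (metis (no_types, lifting) DiffI doubleton_eq_iff singletonD)
  from link2[OF np vV v(2) this w(1) _ w(3)] show ?thesis using w(2) by auto
qed

lemma pend_deg2:
  assumes v: "nb E v = {x, y}" and p: "nb E p = {x}" and d: "x \<noteq> y" "p \<noteq> y" and e: "{x, y} \<in> E"
  shows False
proof -
  have pv: "p \<noteq> v" using v p d by auto
  show False
  proof (rule reduce2[OF red_pend_deg2[of "lab x y x x v p"]])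
    show "set (take 2 [x, y, x, x]) \<subseteq> S \<or> set (take 2 [x, y, x, x]) \<inter> S = {}"
      if S: "closed_in ((E - im (lab x y x x v p) [(0, 6), (0, 5), (1, 5)]) \<union> im (lab x y x x v p) []) S" for S
    proof -
      have "{x, y} \<notin> im (lab x y x x v p) [(0, 6), (0, 5), (1, 5)]"
        using nbD[OF v, of x] nbD[OF v, of y] d by (auto simp: doubleton_eq_iff)
      then show ?thesis using closed_inD[OF S, of x y] e by simp
    qed
  qed (use v p d pv ge5 nbD[OF v, of x] nbD[OF v, of y] nbD[OF p, of x] in \<open>auto simp: insert_commute\<close>)
qed

lemma twin2:
  assumes v: "nb E v = {x, y}" and w: "nb E w = {x, y}" and d: "x \<noteq> y" "v \<noteq> w" and e: "{x, y} \<in> E"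
  shows False
proof (rule reduce2[OF red_twin2[of "lab x y x x v w"]])
  have n: "v \<noteq> x" "v \<noteq> y" "w \<noteq> x" "w \<noteq> y" using nbD[OF v] nbD[OF w] by auto
  show "set (take 2 [x, y, x, x]) \<subseteq> S \<or> set (take 2 [x, y, x, x]) \<inter> S = {}"
    if S: "closed_in ((E - im (lab x y x x v w) [(0, 5), (1, 5), (0, 6), (1, 6)]) \<union> im (lab x y x x v w) []) S" for S
  proof -
    have "{x, y} \<notin> im (lab x y x x v w) [(0, 5), (1, 5), (0, 6), (1, 6)]"
      using n by (auto simp: doubleton_eq_iff)
    then show ?thesis using closed_inD[OF S, of x y] e by simp
  qed
qed (use v w d ge5 nbD[OF v, of x] nbD[OF v, of y] nbD[OF w, of x] nbD[OF w, of y] in \<open>auto simp: insert_commute\<close>)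

lemma share2:
  assumes v: "nb E v = {x, y}" and w: "nb E w = {y, z}" and d: "distinct [x, y, z]" "v \<noteq> w"
    and nvw: "{v, w} \<notin> E" and e: "{x, y} \<in> E" "{y, z} \<in> E"
  shows False
proof (rule reduce2[OF red_share2[of "lab x y z x v w"]])
  have n: "v \<notin> {x, y, z}" "w \<notin> {x, y, z}"
    using nonadjacent[OF nvw] unfolding v w by auto
  then show "distinct (take 3 [x, y, z, x] @ [v, w])" using d by auto
  show "set (take 3 [x, y, z, x]) \<subseteq> S \<or> set (take 3 [x, y, z, x]) \<inter> S = {}"
    if S: "closed_in ((E - im (lab x y z x v w) [(0, 5), (1, 5), (1, 6), (2, 6)]) \<union> im (lab x y z x v w) []) S" for S
  proof -
    have "{x, y} \<notin> im (lab x y z x v w) [(0, 5), (1, 5), (1, 6), (2, 6)]"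
      "{y, z} \<notin> im (lab x y z x v w) [(0, 5), (1, 5), (1, 6), (2, 6)]"
      using n by (auto simp: doubleton_eq_iff)
    then show ?thesis using closed_inD[OF S, of x y] closed_inD[OF S, of y z] e by auto
  qed
qed (use v w ge5 nbD[OF v, of x] nbD[OF v, of y] nbD[OF w, of y] nbD[OF w, of z] in \<open>auto simp: insert_commute\<close>)

text \<open>The reduction deletes \<open>y z\<close>. If this separated \<open>y\<close> from
  \<open>z\<close>, then \<open>y\<close> would cut off a part containing both \<open>v\<close> and
  \<open>x\<close>, too large for \<open>side\<close>.\<close>

lemma disj2:
  assumes v: "nb E v = {x, y}" and w: "nb E w = {z, t}" and d: "distinct [x, y, z, t]" "v \<noteq> w"
    and nvw: "{v, w} \<notin> E" and e: "{x, y} \<in> E" "{z, t} \<in> E" "{y, z} \<in> E"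
  shows False
proof (rule reduce2[OF red_disj2[of "lab x y z t v w"]])
  have n: "v \<notin> {x, y, z, t}" "w \<notin> {x, y, z, t}"
    using nonadjacent[OF nvw] unfolding v w by auto
  have VV: "x \<in> V" "y \<in> V" "z \<in> V" "t \<in> V" "v \<in> V" "w \<in> V"
    using nbD[OF v, of x] nbD[OF v, of y] nbD[OF w, of z] nbD[OF w, of t] by auto
  show "distinct (take 4 [x, y, z, t] @ [v, w])" using d n by auto
  fix S assume "closed_in ((E - im (lab x y z t v w) [(0, 5), (1, 5), (2, 6), (3, 6), (1, 2)]) \<union> im (lab x y z t v w) []) S"
  then have S: "closed_in (E - {{x, v}, {y, v}, {z, w}, {t, w}, {y, z}}) S" by simp
  have nN: "{a, b} \<notin> {{x, v}, {y, v}, {z, w}, {t, w}, {y, z}}"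
    if "a \<notin> {v, w}" "b \<notin> {v, w}" "{a, b} \<noteq> {y, z}" for a b
  proof -
    have "{a, b} \<inter> {v, w} = {}" using that by auto
    then show ?thesis using that(3) by blast
  qed
  have xy: "x \<in> S \<longleftrightarrow> y \<in> S"
    using closed_inD[OF S, of x y] nN[of x y] e n d by (auto simp: doubleton_eq_iff)
  have zt: "z \<in> S \<longleftrightarrow> t \<in> S"
    using closed_inD[OF S, of z t] nN[of z t] e n d by (auto simp: doubleton_eq_iff)
  have "y \<in> S \<longleftrightarrow> z \<in> S"
  proof (rule ccontr)
    assume yz: "\<not> ?thesis"
    define A where "A = insert v {u \<in> V - {v, w, y}. u \<in> S \<longleftrightarrow> y \<in> S}"
    have fin: "finite A" using finV by (simp add: A_def)
    have "A = {} \<or> (\<exists>p. A = {p} \<and> nb E p = {y})"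
    proof (rule side[OF VV(2)])
      show "A \<subseteq> V - {y}" using VV n by (auto simp: A_def)
      have "{w, z} \<subseteq> V - {y} - A" using VV n d yz by (auto simp: A_def)
      moreover have "card {w, z} = 2" using n by auto
      ultimately show "2 \<le> card (V - {y} - A)" using finV by (metis card_mono finite_Diff)
      show "b \<in> insert y A" if a: "a \<in> A" "{a, b} \<in> E" for a b
      proof (cases "a = v \<or> b = v")
        case True
        then show ?thesis
        proof
          assume "a = v"
          then have "b \<in> {x, y}" using a(2) v by (auto simp: nb_def)
          then show ?thesis using xy VV n d by (auto simp: A_def)
        qed (simp add: A_def)
      next
        case False
        then have a': "a \<in> V - {v, w, y}" "a \<in> S \<longleftrightarrow> y \<in> S" using a(1) by (auto simp: A_def)
        have "b \<noteq> w"
        proof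
          assume "b = w"
          then have "a \<in> {z, t}" using a(2) w by (auto simp: nb_def insert_commute)
          then show False using a' yz zt by auto
        qed
        moreover have "{a, b} \<noteq> {y, z}" using a' yz by (auto simp: doubleton_eq_iff)
        ultimately have "a \<in> S \<longleftrightarrow> b \<in> S" using closed_inD[OF S, of a b] nN[of a b] a' False a(2) by blast
        then show ?thesis using a' \<open>b \<noteq> w\<close> False edge[OF a(2)] by (auto simp: A_def)
      qed
    qed
    moreover have "x \<in> A" "v \<in> A" "x \<noteq> v" using xy VV n d by (auto simp: A_def)
    ultimately show False by auto
  qed
  then show "set (take 4 [x, y, z, t]) \<subseteq> S \<or> set (take 4 [x, y, z, t]) \<inter> S = {}"
    using xy zt by auto
qed (use v w e ge5 nbD[OF v, of x] nbD[OF v, of y] nbD[OF w, of z] nbD[OF w, of t] in \<open>auto simp: insert_commute\<close>)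

lemma sub32:
  assumes v: "nb E v = {x, y, z}" and w: "nb E w = {x, y}" and d: "distinct [x, y, z]" "v \<noteq> w"
    and nvw: "{v, w} \<notin> E" and e: "{x, y} \<in> E" and np: "\<And>p. nb E p \<noteq> {v}"
  shows False
proof (rule reduce2[OF red_sub32[of "lab x y z x v w"]])
  have n: "v \<notin> {x, y, z}" "w \<notin> {x, y, z}"
    using nonadjacent[OF nvw] unfolding v w by auto
  then show "distinct (take 3 [x, y, z, x] @ [v, w])" using d by auto
  fix S assume S: "closed_in ((E - im (lab x y z x v w) [(0, 5), (1, 5), (2, 5), (0, 6), (1, 6)]) \<union> im (lab x y z x v w) []) S"
  have "{x, y} \<notin> im (lab x y z x v w) [(0, 5), (1, 5), (2, 5), (0, 6), (1, 6)]"
    using n by (auto simp: doubleton_eq_iff)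
  then have xy: "x \<in> S \<longleftrightarrow> y \<in> S" using closed_inD[OF S, of x y] e by simp
  have "closed_in {e\<in>E. v \<notin> e \<and> w \<notin> e} S" using S unfolding closed_in_def by auto
  from link2[OF np _ d(2) this _ _ xy]
  show "set (take 3 [x, y, z, x]) \<subseteq> S \<or> set (take 3 [x, y, z, x]) \<inter> S = {}"
    using w n nbD[OF v, of x] nbD[OF v, of y] nbD[OF v, of z] by auto
qed (use v w ge5 nbD[OF v, of x] nbD[OF v, of y] nbD[OF v, of z] nbD[OF w, of x] nbD[OF w, of y] in \<open>auto simp: insert_commute\<close>)

text \<open>A missing edge \<open>y z\<close> is added, a present one deleted; in the second case
  \<open>bridge\<close> saves connectedness.\<close>

lemma cross32:
  assumes v: "nb E v = {x, y, z}" and w: "nb E w = {x, t}" and d: "distinct [x, y, z, t]" "v \<noteq> w"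
    and nvw: "{v, w} \<notin> E" and e: "{x, t} \<in> E" and np: "\<And>p. nb E p \<noteq> {v}" and T: "clique T {x, y, z}"
  shows False
proof -
  have n: "v \<notin> {x, y, z, t}" "w \<notin> {x, y, z, t}"
    using nonadjacent[OF nvw] unfolding v w by auto
  have VV: "x \<in> V" "y \<in> V" "z \<in> V" "t \<in> V" "v \<in> V" "w \<in> V"
    using nbD[OF v, of x] nbD[OF v, of y] nbD[OF v, of z] nbD[OF w, of t] nbD[OF w, of x] by auto
  have T': "{y, z} \<in> T" using T d by (auto simp: clique_def)
  show False
  proof (cases "{y, z} \<in> E")
    case False
    show False
    proof (rule reduce2[OF red_cross32_add[of "lab x y z t v w"]])
      fix S assume S: "closed_in ((E - im (lab x y z t v w) [(0, 5), (1, 5), (2, 5), (0, 6), (3, 6)]) \<union> im (lab x y z t v w) [(1, 2)]) S"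
      have "{x, t} \<notin> im (lab x y z t v w) [(0, 5), (1, 5), (2, 5), (0, 6), (3, 6)]"
        using n by (auto simp: doubleton_eq_iff)
      then have xt: "x \<in> S \<longleftrightarrow> t \<in> S" using closed_inD[OF S, of x t] e by simp
      have "closed_in {e\<in>E. v \<notin> e \<and> w \<notin> e} S" using S unfolding closed_in_def by auto
      from link2[OF np VV(5) d(2) this _ _ xt]
      show "set (take 4 [x, y, z, t]) \<subseteq> S \<or> set (take 4 [x, y, z, t]) \<inter> S = {}"
        using w n VV by auto
    qed (use v w d n VV ge5 T' False nbD[OF v, of x] nbD[OF v, of y] nbD[OF v, of z] nbD[OF w, of x] nbD[OF w, of t]
        in \<open>auto simp: insert_commute\<close>)
  next
    case True
    show False
    proof (rule reduce2[OF red_cross32[of "lab x y z t v w"]])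
      fix S assume S: "closed_in ((E - im (lab x y z t v w) [(0, 5), (1, 5), (2, 5), (0, 6), (3, 6), (1, 2)]) \<union> im (lab x y z t v w) []) S"
      have "{x, t} \<notin> im (lab x y z t v w) [(0, 5), (1, 5), (2, 5), (0, 6), (3, 6), (1, 2)]"
        using n d by (auto simp: doubleton_eq_iff)
      then have xt: "x \<in> S \<longleftrightarrow> t \<in> S" using closed_inD[OF S, of x t] e by simp
      have "closed_in ({e\<in>E. v \<notin> e \<and> w \<notin> e} - {{y, z}}) S" using S unfolding closed_in_def by auto
      from link2_bridge[OF np v d(2) _ T True this _ _ xt]
      show "set (take 4 [x, y, z, t]) \<subseteq> S \<or> set (take 4 [x, y, z, t]) \<inter> S = {}"
        using w n VV d by auto
    qed (use v w d n VV ge5 True nbD[OF v, of x] nbD[OF v, of y] nbD[OF v, of z] nbD[OF w, of x] nbD[OF w, of t]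
        in \<open>auto simp: insert_commute\<close>)
  qed
qed

lemma tail3:
  assumes v: "nb E v = {x, y, z}" and p: "nb E p = {x}" and d: "distinct [x, y, z]" "v \<noteq> p"
    and np: "\<And>p. nb E p \<noteq> {v}" and T: "clique T {x, y, z}"
  shows False
proof -
  have n: "v \<notin> {x, y, z}" "p \<notin> {x, y, z}"
  proof -
    have vx: "v \<noteq> x" using nbD[OF v, of x] by auto
    have "{v, p} \<notin> E"
    proof
      assume "{v, p} \<in> E"
      then have "v \<in> nb E p" by (simp add: nb_def insert_commute)
      then show False using p vx by simp
    qed
    from nonadjacent[OF this] show "v \<notin> {x, y, z}" "p \<notin> {x, y, z}" unfolding v p by auto
  qed
  have VV: "x \<in> V" "y \<in> V" "z \<in> V" "v \<in> V" "p \<in> V"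
    using nbD[OF v, of x] nbD[OF v, of y] nbD[OF v, of z] nbD[OF p, of x] by auto
  have T': "{y, z} \<in> T" using T d by (auto simp: clique_def)
  show False
  proof (cases "{y, z} \<in> E")
    case False
    show False
    proof (rule reduce2[OF red_tail_add[of "lab x y z x v p"]])
      fix S assume S: "closed_in ((E - im (lab x y z x v p) [(0, 5), (1, 5), (2, 5), (0, 6)]) \<union> im (lab x y z x v p) [(1, 2)]) S"
      have "closed_in {e\<in>E. v \<notin> e \<and> p \<notin> e} S" using S unfolding closed_in_def by auto
      from link2[OF np VV(4) d(2) this, of x x]
      show "set (take 3 [x, y, z, x]) \<subseteq> S \<or> set (take 3 [x, y, z, x]) \<inter> S = {}"
        using p n VV by auto
    qed (use v p d n VV ge5 T' False nbD[OF v, of x] nbD[OF v, of y] nbD[OF v, of z] nbD[OF p, of x]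
        in \<open>auto simp: insert_commute\<close>)
  next
    case True
    show False
    proof (rule reduce2[OF red_tail[of "lab x y z x v p"]])
      fix S assume S: "closed_in ((E - im (lab x y z x v p) [(0, 5), (1, 5), (2, 5), (0, 6), (1, 2)]) \<union> im (lab x y z x v p) []) S"
      have "closed_in ({e\<in>E. v \<notin> e \<and> p \<notin> e} - {{y, z}}) S" using S unfolding closed_in_def by auto
      from link2_bridge[OF np v d(2) d(1) T True this, of x]
      show "set (take 3 [x, y, z, x]) \<subseteq> S \<or> set (take 3 [x, y, z, x]) \<inter> S = {}"
        using p n VV d by auto
    qed (use v p d n VV ge5 True nbD[OF v, of x] nbD[OF v, of y] nbD[OF v, of z] nbD[OF p, of x]
        in \<open>auto simp: insert_commute\<close>)
  qed
qed


lemma member_swap: "e \<notin> A \<Longrightarrow> e \<in> (E - B) \<union> C \<Longrightarrow> e \<in> (E - (A \<union> B)) \<union> C"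
  by blast

text \<open>Closes the gap of \<open>same3\<close> and \<open>adj34\<close>, whose reductions do not
  cover the triangle: if the three other vertices formed one, \<open>E\<close> would itself be
  exceptional.\<close>

lemma exc_two:
  assumes "card V = 5" and in_E: "all2 (V - {v, w}) \<subseteq> E" and "v \<in> V" "a \<in> V" "v \<noteq> a" "{v, a} \<notin> E"
    and v: "\<And>r. r \<in> V \<Longrightarrow> r \<noteq> v \<Longrightarrow> r \<noteq> a \<Longrightarrow> {v, r} \<in> E"
    and w: "\<And>r. r \<in> V \<Longrightarrow> r \<noteq> w \<Longrightarrow> r \<noteq> v \<Longrightarrow> {w, r} \<in> E"
  shows False
proof -
  have "all2 V - {{v, a}} \<subseteq> E"
  proof
    fix e assume "e \<in> all2 V - {{v, a}}"
    then obtain s t where e: "e = {s, t}" "s \<noteq> t" "s \<in> V" "t \<in> V" "{s, t} \<noteq> {v, a}"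
      by (auto simp: all2_def card_2_iff)
    consider "s = v" | "t = v" | "s = w" "t \<noteq> v" | "t = w" "s \<noteq> v" | "s \<notin> {v, w}" "t \<notin> {v, w}" by blast
    then show "e \<in> E"
    proof cases
      case 1 then show ?thesis using v[of t] e by auto
    next
      case 2 then show ?thesis using v[of s] e by (auto simp: insert_commute)
    next
      case 3 then show ?thesis using w[of t] e by auto
    next
      case 4 then show ?thesis using w[of s] e by (auto simp: insert_commute)
    next
      case 5
      then have "{s, t} \<in> all2 (V - {v, w})" using e by (simp add: all2_edge)
      then show ?thesis using in_E e by blast
    qed
  qed
  then have "E = all2 V - {{v, a}}" using EV assms(6) by blast
  moreover have "{v, a} \<in> all2 V" using assms by (simp add: all2_edge)
  ultimately show False using nexc assms(1) by (auto simp: exc_def)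
qed

text \<open>By the number of edges among \<open>x\<close>, \<open>y\<close>, \<open>z\<close>: two
  or more keep these connected; a single edge is replaced by the two missing ones; if there is none,
  the whole triangle is added.\<close>

lemma same3:
  assumes v: "nb E v = {x, y, z}" and w: "nb E w = {x, y, z}" and d: "distinct [x, y, z]" "v \<noteq> w"
    and T: "clique T {x, y, z}"
  shows False
proof -
  have nvw: "{v, w} \<notin> E" using w nbD[OF w] v by (auto simp: nb_def)
  have n: "v \<notin> {x, y, z}" "w \<notin> {x, y, z}" using nonadjacent[OF nvw] unfolding v w by auto
  have VV: "x \<in> V" "y \<in> V" "z \<in> V" "v \<in> V" "w \<in> V"
    using nbD[OF v, of x] nbD[OF v, of y] nbD[OF v, of z] nbD[OF w, of x] by auto
  have T': "{x, y} \<in> T" "{y, z} \<in> T" "{x, z} \<in> T" using T d by (auto simp: clique_def)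
  note adj = nbD[OF v, of x] nbD[OF v, of y] nbD[OF v, of z] nbD[OF w, of x] nbD[OF w, of y] nbD[OF w, of z]
  have two: False if v: "nb E v = {x, y, z}" and w: "nb E w = {x, y, z}" and d: "distinct [x, y, z]"
    and e: "{x, y} \<in> E" "{x, z} \<in> E" for x y z
  proof (rule reduce2[OF red_same3[of "lab x y z x v w"]])
    note adj = nbD[OF v, of x] nbD[OF v, of y] nbD[OF v, of z] nbD[OF w, of x] nbD[OF w, of y] nbD[OF w, of z]
    have n: "v \<notin> {x, y, z}" "w \<notin> {x, y, z}" using nonadjacent[OF nvw] unfolding v w by auto
    have VV: "x \<in> V" "y \<in> V" "z \<in> V" "v \<in> V" "w \<in> V" using adj by auto
    show "distinct (take 3 [x, y, z, x] @ [v, w])" using d n assms(4) by auto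
    show "set (take 3 [x, y, z, x]) \<subseteq> V" "v \<in> V" "w \<in> V" using VV by auto
    show "im (lab x y z x v w) [(0, 5), (1, 5), (2, 5), (0, 6), (1, 6), (2, 6)] \<subseteq> E"
      using adj by auto
    show "set (take 3 [x, y, z, x]) \<subseteq> S \<or> set (take 3 [x, y, z, x]) \<inter> S = {}"
      if S: "closed_in ((E - im (lab x y z x v w) [(0, 5), (1, 5), (2, 5), (0, 6), (1, 6), (2, 6)]) \<union> im (lab x y z x v w) []) S" for S
    proof -
      have "{x, y} \<notin> im (lab x y z x v w) [(0, 5), (1, 5), (2, 5), (0, 6), (1, 6), (2, 6)]"
        "{x, z} \<notin> im (lab x y z x v w) [(0, 5), (1, 5), (2, 5), (0, 6), (1, 6), (2, 6)]"
        using n by (auto simp: doubleton_eq_iff)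
      then show ?thesis using closed_inD[OF S, of x y] closed_inD[OF S, of x z] e by auto
    qed
    show "3 \<in> set [5] \<or> [] = [] \<and> \<not> all2 (V - {v, w}) \<subseteq> E" if c: "card V = 5"
    proof -
      have "{v, w, x, y, z} \<subseteq> V" "card {v, w, x, y, z} = 5"
        using VV n d assms(4) by (auto simp: card_insert_if)
      then have V5: "V = {v, w, x, y, z}" using c finV by (metis card_subset_eq)
      have "\<not> all2 (V - {v, w}) \<subseteq> E"
      proof
        assume "all2 (V - {v, w}) \<subseteq> E"
        then show False
        proof (rule exc_two[OF c _ VV(4,5) assms(4) nvw])
          have in_xyz: "r \<in> {x, y, z}" if "r \<in> V" "r \<noteq> v" "r \<noteq> w" for r using that unfolding V5 by simp
          show "{v, r} \<in> E" if "r \<in> V" "r \<noteq> v" "r \<noteq> w" for r using nbD[OF v in_xyz[OF that]] by simp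
          show "{w, r} \<in> E" if "r \<in> V" "r \<noteq> w" "r \<noteq> v" for r using nbD[OF w in_xyz] that by simp
        qed
      qed
      then show ?thesis by simp
    qed
  qed (use v w ge5 VV in \<open>auto simp: insert_commute\<close>)
  have one: False if v: "nb E v = {x, y, z}" and w: "nb E w = {x, y, z}" and d: "distinct [x, y, z]"
    and e: "{x, y} \<in> E" "{x, z} \<notin> E" "{y, z} \<notin> E" and T': "{x, z} \<in> T" "{y, z} \<in> T" for x y z
  proof (rule reduce2[OF red_same3_path[of "lab x y z x v w"]])
    note adj = nbD[OF v, of x] nbD[OF v, of y] nbD[OF v, of z] nbD[OF w, of x] nbD[OF w, of y] nbD[OF w, of z]
    have n: "v \<notin> {x, y, z}" "w \<notin> {x, y, z}" using nonadjacent[OF nvw] unfolding v w by auto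
    show "distinct (take 3 [x, y, z, x] @ [v, w])" using d n assms(4) by auto
    show "im (lab x y z x v w) [(0, 5), (1, 5), (2, 5), (0, 6), (1, 6), (2, 6), (0, 1)] \<subseteq> E"
      using adj e by auto
    show "set (take 3 [x, y, z, x]) \<subseteq> V" "v \<in> V" "w \<in> V" using adj by auto
    show "set (take 3 [x, y, z, x]) \<subseteq> S \<or> set (take 3 [x, y, z, x]) \<inter> S = {}"
      if S: "closed_in ((E - im (lab x y z x v w) [(0, 5), (1, 5), (2, 5), (0, 6), (1, 6), (2, 6), (0, 1)]) \<union> im (lab x y z x v w) [(0, 2), (1, 2)]) S" for S
      using closed_inD[OF S, of x z] closed_inD[OF S, of y z] by auto
  qed (use v w ge5 e T' in \<open>auto simp: insert_commute\<close>)
  have none: False if e: "{x, y} \<notin> E" "{x, z} \<notin> E" "{y, z} \<notin> E"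
  proof (rule reduce2[OF red_same3_tri[of "lab x y z x v w"]])
    show "distinct (take 3 [x, y, z, x] @ [v, w])" using d n by auto
    show "im (lab x y z x v w) [(0, 5), (1, 5), (2, 5), (0, 6), (1, 6), (2, 6)] \<subseteq> E" using adj by auto
    show "set (take 3 [x, y, z, x]) \<subseteq> S \<or> set (take 3 [x, y, z, x]) \<inter> S = {}"
      if S: "closed_in ((E - im (lab x y z x v w) [(0, 5), (1, 5), (2, 5), (0, 6), (1, 6), (2, 6)]) \<union> im (lab x y z x v w) [(0, 2), (1, 2), (0, 1)]) S" for S
      using closed_inD[OF S, of x z] closed_inD[OF S, of y z] by auto
  qed (use v w ge5 e T' VV in \<open>auto simp: insert_commute\<close>)
  have perm: "{x, y, z} = {y, x, z}" "{x, y, z} = {z, x, y}" "{x, y, z} = {y, z, x}" "{x, y, z} = {x, z, y}" by auto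
  have sym: "{y, x} = {x, y}" "{z, x} = {x, z}" "{z, y} = {y, z}" by auto
  consider "{x, y} \<in> E" "{x, z} \<in> E" | "{x, y} \<in> E" "{y, z} \<in> E" | "{x, z} \<in> E" "{y, z} \<in> E"
    | "{x, y} \<in> E" "{x, z} \<notin> E" "{y, z} \<notin> E" | "{x, z} \<in> E" "{x, y} \<notin> E" "{y, z} \<notin> E"
    | "{y, z} \<in> E" "{x, y} \<notin> E" "{x, z} \<notin> E" | "{x, y} \<notin> E" "{x, z} \<notin> E" "{y, z} \<notin> E" by blast
  then show False
  proof cases
    case 1 then show False using two[OF v w d(1)] by blast
  next
    case 2 then show False using two[OF v[unfolded perm(1)] w[unfolded perm(1)]] d by (auto simp: sym)
  next
    case 3 then show False using two[OF v[unfolded perm(2)] w[unfolded perm(2)]] d by (auto simp: sym)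
  next
    case 4 then show False using one[OF v w d(1)] T' by blast
  next
    case 5 then show False using one[OF v[unfolded perm(4)] w[unfolded perm(4)]] d T' by (auto simp: sym)
  next
    case 6 then show False using one[OF v[unfolded perm(3)] w[unfolded perm(3)]] d T' by (auto simp: sym)
  next
    case 7 then show False using none by blast
  qed
qed

text \<open>The reductions that add edges force more and more edges: \<open>x\<close>, then
  \<open>y\<close>, has a neighbour among \<open>z\<close>, \<open>t\<close>, and finally
  \<open>z t\<close> is present. Now \<open>z t\<close> can be deleted if \<open>x\<close> is
  adjacent to both \<open>z\<close> and \<open>t\<close>; otherwise the one edge from
  \<open>x\<close> to them is moved to the other.\<close>

lemma cross33:
  assumes v: "nb E v = {x, y, z}" and w: "nb E w = {x, y, t}" and d: "distinct [x, y, z, t]" "v \<noteq> w"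
    and nvw: "{v, w} \<notin> E" and T: "clique T {x, y, z, t}"
  shows False
proof -
  have T': "{a, b} \<in> T" if "a \<in> {x, y, z, t}" "b \<in> {x, y, z, t}" "a \<noteq> b" for a b
    using T that by (auto simp: clique_def)
  \<comment> \<open>The common frame: \<open>R\<close> holds the deleted edges among the four old
    vertices, and it suffices to see that the edges left among these connect them.\<close>
  have go: False
    if red: "reducible [5, 6] J N 4 [3, 5] (lab x y z t v w)"
      and v: "nb E v = {x, y, z}" and w: "nb E w = {x, y, t}" and d: "distinct [x, y, z, t]" "v \<noteq> w" and nvw: "{v, w} \<notin> E"
      and N: "set N = {(0, 5), (1, 5), (2, 5), (0, 6), (1, 6), (3, 6)} \<union> R"
      and R: "R \<subseteq> {0, 1, 2, 3} \<times> {0, 1, 2, 3}" "set J \<subseteq> {0, 1, 2, 3} \<times> {0, 1, 2, 3}"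
      and RE: "(\<lambda>(i, j). {lab x y z t v w i, lab x y z t v w j}) ` R \<subseteq> E"
      and J: "im (lab x y z t v w) J \<inter> E = {}" "im (lab x y z t v w) J \<subseteq> T"
      and link: "\<And>S. (\<And>a b. a \<in> {x, y, z, t} \<Longrightarrow> b \<in> {x, y, z, t} \<Longrightarrow>
          {a, b} \<in> (E - (\<lambda>(i, j). {lab x y z t v w i, lab x y z t v w j}) ` R) \<union> im (lab x y z t v w) J \<Longrightarrow>
          a \<in> S \<longleftrightarrow> b \<in> S) \<Longrightarrow> {x, y, z, t} \<subseteq> S \<or> {x, y, z, t} \<inter> S = {}"
    for J N R x y z t v w
  proof (rule reduce2[OF red])
    note adj = nbD[OF v, of x] nbD[OF v, of y] nbD[OF v, of z] nbD[OF w, of x] nbD[OF w, of y] nbD[OF w, of t]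
    have n: "v \<notin> {x, y, z, t}" "w \<notin> {x, y, z, t}" using nonadjacent[OF nvw] unfolding v w by auto
    show "distinct (take 4 [x, y, z, t] @ [v, w])" using d n by auto
    have imN: "im (lab x y z t v w) N = {{x, v}, {y, v}, {z, v}, {x, w}, {y, w}, {t, w}} \<union>
        (\<lambda>(i, j). {lab x y z t v w i, lab x y z t v w j}) ` R"
      by (simp add: im_def N image_Un)
    show "im (lab x y z t v w) N \<subseteq> E" unfolding imN using adj RE by auto
    show "set (take 4 [x, y, z, t]) \<subseteq> V" "v \<in> V" "w \<in> V" using adj by auto
    show "\<forall>u\<in>nb E v. {v, u} \<in> im (lab x y z t v w) N" "\<forall>u\<in>nb E w. {w, u} \<in> im (lab x y z t v w) N"
      unfolding imN v w by (auto simp: insert_commute)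
    show "list_all (\<lambda>(i, j). i < 4 \<and> j < 4) J" using R(2) by (force simp: list_all_iff)
    show "list_all (\<lambda>(i, j). (i < 4 \<or> i = 5 \<or> i = 6) \<and> (j < 4 \<or> j = 5 \<or> j = 6)) N"
      using R(1) by (force simp: list_all_iff N)
    show "set (take 4 [x, y, z, t]) \<subseteq> S \<or> set (take 4 [x, y, z, t]) \<inter> S = {}"
      if S: "closed_in ((E - im (lab x y z t v w) N) \<union> im (lab x y z t v w) J) S" for S
    proof -
      have "{x, y, z, t} \<subseteq> S \<or> {x, y, z, t} \<inter> S = {}"
      proof (rule link)
        fix a b assume ab: "a \<in> {x, y, z, t}" "b \<in> {x, y, z, t}"
          "{a, b} \<in> (E - (\<lambda>(i, j). {lab x y z t v w i, lab x y z t v w j}) ` R) \<union> im (lab x y z t v w) J"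
        have "a \<notin> {v, w}" "b \<notin> {v, w}" using ab n by auto
        then have "{a, b} \<notin> {{x, v}, {y, v}, {z, v}, {x, w}, {y, w}, {t, w}}"
          by (auto simp: doubleton_eq_iff)
        from closed_inD[OF S[unfolded imN] member_swap[OF this ab(3)]]
        show "a \<in> S \<longleftrightarrow> b \<in> S" .
      qed
      then show ?thesis by simp
    qed
  qed (use J ge5 in auto)
  have add2: False if v: "nb E v = {x, y, z}" and w: "nb E w = {x, y, t}" and d: "distinct [x, y, z, t]"
    and n: "{z, x} \<notin> E" "{x, t} \<notin> E" and TT: "{z, x} \<in> T" "{x, t} \<in> T"
    and e: "{x, y} \<in> E \<or> {z, y} \<in> E \<or> {t, y} \<in> E" for x y z t
  proof (rule go[OF red_type_I_add2 v w d assms(4) nvw, where R = "{}"])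
    fix S assume S: "\<And>a b. a \<in> {x, y, z, t} \<Longrightarrow> b \<in> {x, y, z, t} \<Longrightarrow>
        {a, b} \<in> E - (\<lambda>(i, j). {lab x y z t v w i, lab x y z t v w j}) ` {} \<union> im (lab x y z t v w) [(0, 2), (0, 3)] \<Longrightarrow>
        a \<in> S \<longleftrightarrow> b \<in> S"
    have "x \<in> S \<longleftrightarrow> z \<in> S" "x \<in> S \<longleftrightarrow> t \<in> S" using S[of x z] S[of x t] by auto
    moreover have "(x \<in> S \<longleftrightarrow> y \<in> S) \<or> (z \<in> S \<longleftrightarrow> y \<in> S) \<or> (t \<in> S \<longleftrightarrow> y \<in> S)"
      using S[of x y] S[of z y] S[of t y] e by auto
    ultimately show "{x, y, z, t} \<subseteq> S \<or> {x, y, z, t} \<inter> S = {}" by auto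
  qed (use n TT in \<open>auto simp: insert_commute\<close>)
  have move: False if v: "nb E v = {x, y, z}" and w: "nb E w = {x, y, t}" and d: "distinct [x, y, z, t]" "v \<noteq> w" and nvw: "{v, w} \<notin> E"
    and e: "{x, z} \<in> E" "{x, t} \<notin> E" "{z, t} \<in> E" "{y, z} \<in> E \<or> {y, t} \<in> E" and TT: "{x, t} \<in> T" for x y z t v w
  proof (rule go[OF red_type_I_move v w d nvw, where R = "{(0, 2)}"])
    fix S assume S: "\<And>a b. a \<in> {x, y, z, t} \<Longrightarrow> b \<in> {x, y, z, t} \<Longrightarrow>
        {a, b} \<in> E - (\<lambda>(i, j). {lab x y z t v w i, lab x y z t v w j}) ` {(0, 2)} \<union> im (lab x y z t v w) [(0, 3)] \<Longrightarrow>
        a \<in> S \<longleftrightarrow> b \<in> S"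
    have "z \<in> S \<longleftrightarrow> t \<in> S" "x \<in> S \<longleftrightarrow> t \<in> S"
      using S[of z t] S[of x t] e d by (auto simp: doubleton_eq_iff)
    moreover have "(y \<in> S \<longleftrightarrow> z \<in> S) \<or> (y \<in> S \<longleftrightarrow> t \<in> S)"
      using S[of y z] S[of y t] e d by (auto simp: doubleton_eq_iff)
    ultimately show "{x, y, z, t} \<subseteq> S \<or> {x, y, z, t} \<inter> S = {}" by auto
  qed (use e TT in \<open>auto simp: insert_commute\<close>)
  have perm: "nb E v = {y, x, z}" "nb E w = {y, x, t}" using v w by auto
  have sym: "{x, z} = {z, x}" "{x, t} = {t, x}" "{y, z} = {z, y}" "{y, t} = {t, y}" by auto
  have 1: "{z, x} \<in> E \<or> {t, x} \<in> E"
  proof (rule ccontr)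
    assume "\<not> ?thesis"
    then have 1: "{z, x} \<notin> E" "{x, t} \<notin> E" by (simp_all add: sym)
    then have n: "{x, y} \<notin> E" "{z, y} \<notin> E" "{t, y} \<notin> E" using add2[OF v w d(1)] T' d(1) by auto
    show False
    proof (rule go[OF red_type_I_add3 v w d nvw, where R = "{}"])
      fix S assume S: "\<And>a b. a \<in> {x, y, z, t} \<Longrightarrow> b \<in> {x, y, z, t} \<Longrightarrow>
          {a, b} \<in> E - (\<lambda>(i, j). {lab x y z t v w i, lab x y z t v w j}) ` {} \<union> im (lab x y z t v w) [(0, 2), (0, 1), (1, 3)] \<Longrightarrow>
          a \<in> S \<longleftrightarrow> b \<in> S"
      show "{x, y, z, t} \<subseteq> S \<or> {x, y, z, t} \<inter> S = {}"
        using S[of x z] S[of x y] S[of y t] by auto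
    qed (use 1 n T' d in \<open>auto simp: insert_commute\<close>)
  qed
  have 2: "{z, y} \<in> E \<or> {t, y} \<in> E"
  proof (rule ccontr)
    assume "\<not> ?thesis"
    then have 2: "{z, y} \<notin> E" "{y, t} \<notin> E" by (simp_all add: sym)
    moreover have "{z, y} \<in> T" "{y, t} \<in> T" "distinct [y, x, z, t]" using T' d(1) by auto
    ultimately show False using add2[OF perm _ 2] 1 by blast
  qed
  have e: "{z, t} \<in> E"
  proof (rule ccontr)
    assume n: "{z, t} \<notin> E"
    show False
    proof (rule go[OF red_type_I_add v w d nvw, where R = "{}"])
      fix S assume S: "\<And>a b. a \<in> {x, y, z, t} \<Longrightarrow> b \<in> {x, y, z, t} \<Longrightarrow>
          {a, b} \<in> E - (\<lambda>(i, j). {lab x y z t v w i, lab x y z t v w j}) ` {} \<union> im (lab x y z t v w) [(2, 3)] \<Longrightarrow>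
          a \<in> S \<longleftrightarrow> b \<in> S"
      have "z \<in> S \<longleftrightarrow> t \<in> S" using S[of z t] by auto
      moreover have "(z \<in> S \<longleftrightarrow> x \<in> S) \<or> (t \<in> S \<longleftrightarrow> x \<in> S)" "(z \<in> S \<longleftrightarrow> y \<in> S) \<or> (t \<in> S \<longleftrightarrow> y \<in> S)"
        using S[of z x] S[of t x] S[of z y] S[of t y] 1 2 by auto
      ultimately show "{x, y, z, t} \<subseteq> S \<or> {x, y, z, t} \<inter> S = {}" by auto
    qed (use n T' d in \<open>auto simp: insert_commute\<close>)
  qed
  have y: "{y, z} \<in> E \<or> {y, t} \<in> E" using 2 by (simp add: sym)
  show False
  proof (cases "{x, z} \<in> E \<and> {x, t} \<in> E")
    case True
    show False
    proof (rule go[OF red_type_I v w d nvw, where R = "{(2, 3)}"])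
      fix S assume S: "\<And>a b. a \<in> {x, y, z, t} \<Longrightarrow> b \<in> {x, y, z, t} \<Longrightarrow>
          {a, b} \<in> E - (\<lambda>(i, j). {lab x y z t v w i, lab x y z t v w j}) ` {(2, 3)} \<union> im (lab x y z t v w) [] \<Longrightarrow>
          a \<in> S \<longleftrightarrow> b \<in> S"
      have "x \<in> S \<longleftrightarrow> z \<in> S" "x \<in> S \<longleftrightarrow> t \<in> S"
        using S[of x z] S[of x t] True d by (auto simp: doubleton_eq_iff)
      moreover have "(y \<in> S \<longleftrightarrow> z \<in> S) \<or> (y \<in> S \<longleftrightarrow> t \<in> S)"
        using S[of y z] S[of y t] y d by (auto simp: doubleton_eq_iff)
      ultimately show "{x, y, z, t} \<subseteq> S \<or> {x, y, z, t} \<inter> S = {}" by auto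
    qed (use e T' d in \<open>auto simp: insert_commute\<close>)
  next
    case False
    then consider "{x, z} \<in> E" "{x, t} \<notin> E" | "{x, z} \<notin> E" "{x, t} \<in> E" using 1 by (auto simp: sym)
    then show False
    proof cases
      case 1
      then show False using move[OF v w d nvw _ _ e y] T' d by auto
    next
      case 2
      have "distinct [x, y, t, z]" "{w, v} \<notin> E" "w \<noteq> v" "{t, z} \<in> E" "{y, t} \<in> E \<or> {y, z} \<in> E" "{x, z} \<in> T"
        using d nvw e y T' by (auto simp: insert_commute)
      then show False using move[OF w v] 2 by blast
    qed
  qed
qed


section \<open>Removing two adjacent vertices\<close>

text \<open>The component of \<open>a\<close> after removing \<open>u\<close> and \<open>v\<close>
  contains no other neighbour of these, so \<open>a\<close> cuts off the rest of it. By
  \<open>side\<close> that rest is at most one pendant vertex, and \<open>leafpend2\<close> excludes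
  it.\<close>

lemma twocut:
  assumes uv: "{u, v} \<in> E" and a: "{a, u} \<in> E" "{a, v} \<in> E"
    and S: "closed_in {e\<in>E. u \<notin> e \<and> v \<notin> e} S"
    and other: "\<And>q. q \<in> nb E u \<union> nb E v \<Longrightarrow> q \<notin> {u, v, a} \<Longrightarrow> q \<in> S \<longleftrightarrow> a \<notin> S"
  shows "nb E a = {u, v}"
proof -
  have V: "u \<in> V" "v \<in> V" "a \<in> V" "u \<noteq> v" "a \<noteq> u" "a \<noteq> v"
    using edge[OF uv] edge[OF a(1)] edge[OF a(2)] by auto
  define A where "A = {q \<in> V - {u, v, a}. q \<in> S \<longleftrightarrow> a \<in> S}"
  have cl: "p \<in> S \<longleftrightarrow> q \<in> S" if "{p, q} \<in> E" "p \<notin> {u, v}" "q \<notin> {u, v}" for p q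
    using closed_inD[OF S, of p q] that by auto
  have "A = {} \<or> (\<exists>p. A = {p} \<and> nb E p = {a})"
  proof (rule side[OF V(3)])
    show "A \<subseteq> V - {a}" by (auto simp: A_def)
    have "{u, v} \<subseteq> V - {a} - A" using V by (auto simp: A_def)
    moreover have "card {u, v} = 2" using V by simp
    ultimately show "2 \<le> card (V - {a} - A)" using finV by (metis card_mono finite_Diff)
    show "q \<in> insert a A" if p: "p \<in> A" "{p, q} \<in> E" for p q
    proof -
      have pp: "p \<notin> {u, v, a}" "p \<in> S \<longleftrightarrow> a \<in> S" using p(1) by (auto simp: A_def)
      have "q \<notin> {u, v}"
      proof
        assume "q \<in> {u, v}"
        then have "p \<in> nb E u \<union> nb E v" using p(2) by (auto simp: nb_def insert_commute)
        then show False using other[of p] pp by blast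
      qed
      then show ?thesis using cl[OF p(2)] pp edge[OF p(2)] by (auto simp: A_def)
    qed
  qed
  moreover have sub: "nb E a \<subseteq> {u, v} \<union> A"
  proof
    fix q assume "q \<in> nb E a"
    then have q: "{a, q} \<in> E" by (simp add: nb_def)
    then show "q \<in> {u, v} \<union> A" using cl[OF q] V edge[OF q] by (auto simp: A_def)
  qed
  moreover have sup: "{u, v} \<subseteq> nb E a" using a by (auto simp: nb_def)
  ultimately show ?thesis
  proof (elim disjE exE conjE)
    fix p assume p: "A = {p}" "nb E p = {a}"
    have "p \<in> nb E a" using nbD[OF p(2), of a] by (simp add: nb_def)
    then have "nb E a = {u, v, p}" using sub sup p(1) by auto
    moreover have "distinct [u, v, p]" using V p(1) by (auto simp: A_def)
    ultimately show ?thesis using leafpend2[of a u v p] p(2) uv ET by auto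
  qed auto
qed

lemma adj33_ab:
  assumes v: "nb E v = {u, a, b}" and u: "nb E u = {v, a, b}" and d: "distinct [u, v, a, b]"
  shows False
proof -
  note adj = nbD[OF v, of u] nbD[OF v, of a] nbD[OF v, of b] nbD[OF u, of a] nbD[OF u, of b] nbD[OF u, of v]
  show False
  proof (rule reduce2[OF red_adj33_ab[of "lab a b a a u v"]])
    fix S assume S: "closed_in ((E - im (lab a b a a u v) [(5, 6), (0, 5), (1, 5), (0, 6), (1, 6)]) \<union> im (lab a b a a u v) []) S"
    have cl: "closed_in {e\<in>E. u \<notin> e \<and> v \<notin> e} S" using S unfolding closed_in_def by auto
    have "a \<in> S \<longleftrightarrow> b \<in> S"
    proof (rule ccontr)
      assume n: "\<not> ?thesis"
      have "nb E a = {u, v}"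
        by (rule twocut[OF _ _ _ cl]) (use adj u v n in auto)
      then show False using adj23[of a u v b] u d adj ET by (auto simp: insert_commute)
    qed
    then show "set (take 2 [a, b, a, a]) \<subseteq> S \<or> set (take 2 [a, b, a, a]) \<inter> S = {}" by auto
    next show "im (lab a b a a u v) [(5, 6), (0, 5), (1, 5), (0, 6), (1, 6)] \<subseteq> E" using adj by auto
    show "set (take 2 [a, b, a, a]) \<subseteq> V" "u \<in> V" "v \<in> V" using adj by auto
  qed (use v u d ge5 in \<open>auto simp: insert_commute\<close>)
qed

lemma adj24:
  assumes v: "nb E v = {u, a}" and u: "nb E u = {v, a, b, c}" and d: "distinct [u, v, a, b, c]"
    and np: "\<And>p. nb E p \<noteq> {u}"
  shows False
proof -
  note adj = nbD[OF v, of u] nbD[OF v, of a] nbD[OF u, of a] nbD[OF u, of b] nbD[OF u, of v] nbD[OF u, of c]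
  show False
  proof (rule reduce2[OF red_adj24[of "lab a b c a u v"]])
    fix S assume S: "closed_in ((E - im (lab a b c a u v) [(5, 6), (0, 5), (1, 5), (2, 5), (0, 6)]) \<union> im (lab a b c a u v) []) S"
    have cl: "closed_in {e\<in>E. u \<notin> e \<and> v \<notin> e} S" using S unfolding closed_in_def by auto
    have "V - {u, v} \<subseteq> S \<or> (V - {u, v}) \<inter> S = {}"
      by (rule link2[OF np _ _ cl, where x = a and y = a]) (use adj v d in auto)
    moreover have "{a, b, c} \<subseteq> V - {u, v}"
      using nbD[OF u, of a] nbD[OF u, of b] nbD[OF u, of c] d by auto
    ultimately have "{a, b, c} \<subseteq> S \<or> {a, b, c} \<inter> S = {}" by blast
    then show "set (take 3 [a, b, c, a]) \<subseteq> S \<or> set (take 3 [a, b, c, a]) \<inter> S = {}" by auto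
    next show "im (lab a b c a u v) [(5, 6), (0, 5), (1, 5), (2, 5), (0, 6)] \<subseteq> E" using adj by auto
    show "set (take 3 [a, b, c, a]) \<subseteq> V" "u \<in> V" "v \<in> V" using adj by auto
  qed (use v u d ge5 in \<open>auto simp: insert_commute\<close>)
qed

text \<open>Were \<open>a\<close> and \<open>b\<close> on different sides, one of them would be
  alone on its side among \<open>a\<close>, \<open>b\<close>, \<open>c\<close>. By
  \<open>twocut\<close> it would have degree two, which \<open>adj23\<close> forbids.\<close>

lemma adj34:
  assumes v: "nb E v = {u, a, b}" and u: "nb E u = {v, a, b, c}" and d: "distinct [u, v, a, b, c]"
    and np: "\<And>p. nb E p \<noteq> {u}"
  shows False
proof -
  note adj = nbD[OF v, of u] nbD[OF v, of a] nbD[OF v, of b] nbD[OF u, of a] nbD[OF u, of b] nbD[OF u, of v] nbD[OF u, of c]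
  show False
  proof (rule reduce2[OF red_adj34[of "lab a b c a u v"]])
    fix S assume S: "closed_in ((E - im (lab a b c a u v) [(5, 6), (0, 5), (1, 5), (2, 5), (0, 6), (1, 6)]) \<union> im (lab a b c a u v) []) S"
    have cl: "closed_in {e\<in>E. u \<notin> e \<and> v \<notin> e} S" using S unfolding closed_in_def by auto
    have ab: "a \<in> S \<longleftrightarrow> b \<in> S"
    proof (rule ccontr)
      assume n: "\<not> ?thesis"
      show False
      proof (cases "c \<in> S \<longleftrightarrow> a \<in> S")
        case False
        have "nb E a = {v, u}"
          by (rule twocut[OF _ _ _ cl, THEN trans]) (use adj u v n False in auto)
        moreover have "nb E v = {a, u, b}" "{u, b} \<in> T" "distinct [a, v, u, b]" using v d adj ET by auto
        ultimately show False using adj23[of a v u b] by blast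
      next
        case True
        have "nb E b = {v, u}"
          by (rule twocut[OF _ _ _ cl, THEN trans]) (use adj u v n True in auto)
        moreover have "nb E v = {b, u, a}" "{u, a} \<in> T" "distinct [b, v, u, a]" using v d adj ET by auto
        ultimately show False using adj23[of b v u a] by blast
      qed
    qed
    have "V - {u, v} \<subseteq> S \<or> (V - {u, v}) \<inter> S = {}"
      by (rule link2[OF np _ _ cl, where x = a and y = b]) (use adj v d ab in auto)
    moreover have "{a, b, c} \<subseteq> V - {u, v}"
      using nbD[OF u, of a] nbD[OF u, of b] nbD[OF u, of c] d by auto
    ultimately have "{a, b, c} \<subseteq> S \<or> {a, b, c} \<inter> S = {}" by blast
    then show "set (take 3 [a, b, c, a]) \<subseteq> S \<or> set (take 3 [a, b, c, a]) \<inter> S = {}" by auto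
    next show "im (lab a b c a u v) [(5, 6), (0, 5), (1, 5), (2, 5), (0, 6), (1, 6)] \<subseteq> E" using adj by auto
    show "set (take 3 [a, b, c, a]) \<subseteq> V" "u \<in> V" "v \<in> V" using adj by auto
    show "3 \<in> set [5] \<or> [] = [] \<and> \<not> all2 (V - {u, v}) \<subseteq> E" if c5: "card V = 5"
    proof -
      have "{u, v, a, b, c} \<subseteq> V" "card {u, v, a, b, c} = 5"
        using adj d by (auto simp: card_insert_if)
      then have V5: "V = {u, v, a, b, c}" using c5 finV by (metis card_subset_eq)
      have vc: "{v, c} \<notin> E" using v d by (auto simp: nb_def)
      have "\<not> all2 (V - {u, v}) \<subseteq> E"
      proof
        assume in_E: "all2 (V - {u, v}) \<subseteq> E"
        show False
        proof (rule exc_two[OF c5, of v u c])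
          show "all2 (V - {v, u}) \<subseteq> E" using in_E by (simp add: insert_commute)
          show "{v, r} \<in> E" if r: "r \<in> V" "r \<noteq> v" "r \<noteq> c" for r
          proof -
            have "r \<in> {u, a, b}" using r unfolding V5 by simp
            from nbD[OF v this] show ?thesis by simp
          qed
          show "{u, r} \<in> E" if r: "r \<in> V" "r \<noteq> u" "r \<noteq> v" for r
          proof -
            have "r \<in> {v, a, b, c}" using r unfolding V5 by simp
            from nbD[OF u this] show ?thesis by simp
          qed
        qed (use adj d vc in auto)
      qed
      then show ?thesis by simp
    qed
  qed (use v u d ge5 in \<open>auto simp: insert_commute\<close>)
qed

text \<open>Edges are added, moved or deleted among \<open>a\<close>, \<open>b\<close>,
  \<open>c\<close> so that what remains still connects these three.\<close>

lemma adj33_ac: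
  assumes v: "nb E v = {u, a, b}" and u: "nb E u = {v, a, c}" and d: "distinct [u, v, a, b, c]"
    and T: "clique T {a, b, c}"
  shows False
proof -
  have T': "{a, b} \<in> T" "{a, c} \<in> T" "{b, c} \<in> T" using T d by (auto simp: clique_def)
  note adj = nbD[OF v, of u] nbD[OF v, of a] nbD[OF v, of b] nbD[OF u, of a] nbD[OF u, of c] nbD[OF u, of v]
  have VV: "set (take 3 [a, b, c, a]) \<subseteq> V" "u \<in> V" "v \<in> V" using adj by auto
  have base: "im (lab a b c a u v) [(5, 6), (0, 5), (2, 5), (0, 6), (1, 6)] \<subseteq> E" using adj by auto
  have move: False if v: "nb E v = {u, a, b}" and u: "nb E u = {v, a, c}" and d: "distinct [u, v, a, b, c]"
    and e: "{a, b} \<in> E" "{a, c} \<notin> E" "{b, c} \<in> E" and TT: "{a, c} \<in> T" for u v b c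
  proof (rule reduce2[OF red_adj33_ac_move[of "lab a b c a u v"]])
    note adj = nbD[OF v, of u] nbD[OF v, of a] nbD[OF v, of b] nbD[OF u, of a] nbD[OF u, of c] nbD[OF u, of v]
    show "set (take 3 [a, b, c, a]) \<subseteq> V" "u \<in> V" "v \<in> V" using adj by auto
    show "im (lab a b c a u v) [(5, 6), (0, 5), (2, 5), (0, 6), (1, 6), (0, 1)] \<subseteq> E" using adj e by auto
    fix S assume S: "closed_in ((E - im (lab a b c a u v) [(5, 6), (0, 5), (2, 5), (0, 6), (1, 6), (0, 1)]) \<union> im (lab a b c a u v) [(0, 2)]) S"
    have "{b, c} \<notin> im (lab a b c a u v) [(5, 6), (0, 5), (2, 5), (0, 6), (1, 6), (0, 1)]"
      using d by (auto simp: doubleton_eq_iff)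
    then show "set (take 3 [a, b, c, a]) \<subseteq> S \<or> set (take 3 [a, b, c, a]) \<inter> S = {}"
      using closed_inD[OF S, of b c] closed_inD[OF S, of a c] e by auto
  qed (use v u d e TT ge5 in \<open>auto simp: insert_commute\<close>)
  consider (1) "{a, b} \<notin> E" "{a, c} \<notin> E" | (2) "{b, c} \<notin> E" "{a, b} \<in> E \<or> {a, c} \<in> E"
    | (3) "{b, c} \<in> E" "{a, b} \<in> E" "{a, c} \<notin> E" | (4) "{b, c} \<in> E" "{a, b} \<notin> E" "{a, c} \<in> E"
    | (5) "{b, c} \<in> E" "{a, b} \<in> E" "{a, c} \<in> E" by blast
  then show False
  proof cases
    case 1
    show False
    proof (rule reduce2[OF red_adj33_ac_add2[of "lab a b c a u v"]])
      fix S assume S: "closed_in ((E - im (lab a b c a u v) [(5, 6), (0, 5), (2, 5), (0, 6), (1, 6)]) \<union> im (lab a b c a u v) [(0, 1), (0, 2)]) S"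
      show "set (take 3 [a, b, c, a]) \<subseteq> S \<or> set (take 3 [a, b, c, a]) \<inter> S = {}"
        using closed_inD[OF S, of a b] closed_inD[OF S, of a c] by auto
    qed (use v u d 1 T' VV base ge5 in \<open>auto simp: insert_commute\<close>)
  next
    case 2
    show False
    proof (rule reduce2[OF red_adj33_ac_add[of "lab a b c a u v"]])
      fix S assume S: "closed_in ((E - im (lab a b c a u v) [(5, 6), (0, 5), (2, 5), (0, 6), (1, 6)]) \<union> im (lab a b c a u v) [(1, 2)]) S"
      have "{a, b} \<notin> im (lab a b c a u v) [(5, 6), (0, 5), (2, 5), (0, 6), (1, 6)]"
        "{a, c} \<notin> im (lab a b c a u v) [(5, 6), (0, 5), (2, 5), (0, 6), (1, 6)]"
        using d by (auto simp: doubleton_eq_iff)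
      then show "set (take 3 [a, b, c, a]) \<subseteq> S \<or> set (take 3 [a, b, c, a]) \<inter> S = {}"
      proof -
        assume n: "{a, b} \<notin> im (lab a b c a u v) [(5, 6), (0, 5), (2, 5), (0, 6), (1, 6)]"
          "{a, c} \<notin> im (lab a b c a u v) [(5, 6), (0, 5), (2, 5), (0, 6), (1, 6)]"
        have bc: "b \<in> S \<longleftrightarrow> c \<in> S" using closed_inD[OF S, of b c] by simp
        from 2(2) show ?thesis
        proof
          assume "{a, b} \<in> E"
          then have "a \<in> S \<longleftrightarrow> b \<in> S" using closed_inD[OF S, of a b] n(1) by blast
          then show ?thesis using bc by auto
        next
          assume "{a, c} \<in> E"
          then have "a \<in> S \<longleftrightarrow> c \<in> S" using closed_inD[OF S, of a c] n(2) by blast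
          then show ?thesis using bc by auto
        qed
      qed
    qed (use v u d 2 T' VV base ge5 in \<open>auto simp: insert_commute\<close>)
  next
    case 3
    then show False using move[OF v u d] T' by blast
  next
    case 4
    have "distinct [v, u, a, c, b]" "{c, b} \<in> E" using d 4 by (auto simp: insert_commute)
    then show False using move[OF u v] 4 T' by blast
  next
    case 5
    show False
    proof (rule reduce2[OF red_adj33_ac[of "lab a b c a u v"]])
      show "im (lab a b c a u v) [(5, 6), (0, 5), (2, 5), (0, 6), (1, 6), (1, 2)] \<subseteq> E" using base 5 by auto
      fix S assume S: "closed_in ((E - im (lab a b c a u v) [(5, 6), (0, 5), (2, 5), (0, 6), (1, 6), (1, 2)]) \<union> im (lab a b c a u v) []) S"
      have "{a, b} \<notin> im (lab a b c a u v) [(5, 6), (0, 5), (2, 5), (0, 6), (1, 6), (1, 2)]"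
        "{a, c} \<notin> im (lab a b c a u v) [(5, 6), (0, 5), (2, 5), (0, 6), (1, 6), (1, 2)]"
        using d by (auto simp: doubleton_eq_iff)
      then show "set (take 3 [a, b, c, a]) \<subseteq> S \<or> set (take 3 [a, b, c, a]) \<inter> S = {}"
        using closed_inD[OF S, of a b] closed_inD[OF S, of a c] 5 by auto
    qed (use v u d VV ge5 in \<open>auto simp: insert_commute\<close>)
  qed
qed

text \<open>With the clique \<open>K\<close> as its only neighbours, \<open>v\<close> is simplicial
  in every set that contains it; sets without \<open>v\<close> are not affected. This provides the
  changed \<open>T\<close> for one application of \<open>suppress\<close>.\<close>

lemma good_reattach:
  assumes g: "good X T" and K: "K \<subseteq> X" "v \<notin> K" "finite K" "card K \<le> 3" "clique T K"
  shows "good X ({e\<in>T. v \<notin> e} \<union> (\<lambda>k. {v, k}) ` K)"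
proof -
  let ?T = "{e\<in>T. v \<notin> e} \<union> (\<lambda>k. {v, k}) ` K"
  have nbv: "nb ?T v = K" using K(2) by (auto simp: nb_def doubleton_eq_iff)
  have old: "{a, b} \<in> ?T \<longleftrightarrow> {a, b} \<in> T" if "a \<noteq> v" "b \<noteq> v" for a b
    using that by (auto simp: doubleton_eq_iff)
  show ?thesis
    unfolding good_def
  proof (intro conjI allI impI ballI)
    fix e assume "e \<in> ?T"
    then show "card e = 2" using g K(2) by (auto simp: good_def card_insert_if)
  next
    fix S assume S: "S \<subseteq> X" "S \<noteq> {}"
    show "\<exists>s\<in>S. card (nb ?T s \<inter> S) \<le> 3 \<and> clique ?T (nb ?T s \<inter> S)"
    proof (cases "v \<in> S")
      case True
      have "card (K \<inter> S) \<le> 3" using K by (meson card_mono inf_le1 le_trans)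
      moreover have "clique ?T (K \<inter> S)"
        unfolding clique_def
      proof (intro ballI impI)
        fix a b assume "a \<in> K \<inter> S" "b \<in> K \<inter> S" "a \<noteq> b"
        then show "{a, b} \<in> ?T" using K(2,5) old[of a b] unfolding clique_def by blast
      qed
      ultimately show ?thesis by (intro bexI[OF _ True]) (simp add: nbv)
    next
      case False
      obtain s where s: "s \<in> S" "card (nb T s \<inter> S) \<le> 3" "clique T (nb T s \<inter> S)"
        using g S unfolding good_def by blast
      have n1: "nb ?T s \<inter> S = nb T s \<inter> S"
      proof (intro set_eqI)
        fix r
        have "s \<noteq> v" using False s(1) by blast
        then show "r \<in> nb ?T s \<inter> S \<longleftrightarrow> r \<in> nb T s \<inter> S"
          using False old[of s r] unfolding nb_def by blast
      qed
      have c1: "clique ?T (nb T s \<inter> S)"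
        unfolding clique_def
      proof (intro ballI impI)
        fix a b assume ab: "a \<in> nb T s \<inter> S" "b \<in> nb T s \<inter> S" "a \<noteq> b"
        then have "a \<noteq> v" "b \<noteq> v" using False by auto
        then show "{a, b} \<in> ?T" using ab s(3) old[of a b] unfolding clique_def by blast
      qed
      show ?thesis
      proof (rule bexI[OF _ s(1)], rule conjI)
        show "card (nb ?T s \<inter> S) \<le> 3" unfolding n1 by (rule s(2))
        show "clique ?T (nb ?T s \<inter> S)" unfolding n1 by (rule c1)
      qed
    qed
  qed
qed

section \<open>The graph without its pendant vertices\<close>

definition core :: "'a set" where
  "core = {v \<in> V. \<nexists>x. nb E v = {x}}"

text \<open>A neighbour outside \<open>core\<close> is pendant at \<open>h\<close>, and there is at
  most one. If \<open>h\<close> had a single further neighbour \<open>y\<close>, then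
  \<open>y\<close> would cut off \<open>h\<close> together with its pendant vertex, against
  \<open>side\<close>.\<close>

lemma core_nb:
  assumes h: "h \<in> core"
  shows "(nb E h \<subseteq> core \<and> (\<forall>p. nb E p \<noteq> {h}) \<or>
      (\<exists>p. nb E p = {h} \<and> nb E h = insert p (nb E h \<inter> core) \<and> p \<notin> core)) \<and> 2 \<le> card (nb E h \<inter> core)"
proof -
  have hV: "h \<in> V" and hc: "\<And>x. nb E h \<noteq> {x}" using h by (auto simp: core_def)
  have pend: "nb E q = {h}" if q: "q \<in> nb E h" "q \<notin> core" for q
  proof -
    have "q \<in> V" using q(1) nbV by blast
    then obtain x where "nb E q = {x}" using q(2) unfolding core_def by blast
    moreover have "h \<in> nb E q" using q(1) nb_sym by metis
    ultimately show ?thesis by simp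
  qed
  have c0: "card (nb E h) \<noteq> 0" using nb_nonempty[OF hV] finite_nb by simp
  have "card (nb E h) \<noteq> 1" using hc by (metis card_1_singletonE)
  then have c2: "2 \<le> card (nb E h)" using c0 by linarith
  show ?thesis
  proof (cases "nb E h \<subseteq> core")
    case True
    have "\<forall>p. nb E p \<noteq> {h}"
    proof (intro allI notI)
      fix p assume p: "nb E p = {h}"
      then have "p \<in> nb E h" using nb_sym[of p h] by simp
      then show False using True p by (auto simp: core_def)
    qed
    moreover have "nb E h \<inter> core = nb E h" using True by blast
    ultimately show ?thesis using True c2 by simp
  next
    case False
    then obtain p where p: "p \<in> nb E h" "p \<notin> core" by blast
    have php: "nb E p = {h}" using pend[OF p] .
    have eq: "nb E h = insert p (nb E h \<inter> core)"
      using p pend no_double_pendant[OF php] by blast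
    have "2 \<le> card (nb E h \<inter> core)"
    proof (rule ccontr)
      assume n: "\<not> ?thesis"
      have "card (nb E h) = Suc (card (nb E h \<inter> core))"
        using finite_nb p by (subst eq) (simp add: card_insert_if)
      then have "card (nb E h \<inter> core) = 1" using c2 n by simp
      then obtain y where y: "nb E h \<inter> core = {y}" by (auto simp: card_1_singleton_iff)
      then have hy: "nb E h = {p, y}" using eq by simp
      have V: "y \<in> V" "p \<in> V" "h \<noteq> p" "h \<noteq> y" using nbD[OF hy, of y] nbD[OF hy, of p] by auto
      have py: "p \<noteq> y" using p y by auto
      have "{h, p} = {} \<or> (\<exists>q. {h, p} = {q} \<and> nb E q = {y})"
      proof (rule side[OF V(1)])
        show "{h, p} \<subseteq> V - {y}" using V hV py by auto
        have "card (V - {y} - {h, p}) = card V - 3"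
          using V hV py finV by (subst Diff_insert2[symmetric], subst card_Diff_subset) (auto simp: card_insert_if)
        then show "2 \<le> card (V - {y} - {h, p})" using ge5 by simp
        show "w \<in> insert y {h, p}" if "u \<in> {h, p}" "{u, w} \<in> E" for u w
          using that hy php by (auto simp: nb_def)
      qed
      then show False using V by auto
    qed
    then show ?thesis using eq php p(2) by blast
  qed
qed

lemma core_nonempty: "\<exists>h. h \<in> core"
proof -
  obtain v where v: "v \<in> V" using ge5 by fastforce
  show ?thesis
  proof (cases "v \<in> core")
    case False
    then obtain x where x: "nb E v = {x}" using v by (auto simp: core_def)
    have "x \<in> core"
    proof (rule ccontr)
      assume "x \<notin> core"
      then obtain y where "nb E x = {y}" using nbD[OF x, of x] by (auto simp: core_def)
      moreover have "v \<in> nb E x" using nbD[OF x, of x] by (simp add: nb_def)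
      ultimately have xv: "nb E x = {v}" by simp
      have "closed_in E {v, x}"
        unfolding closed_in_def using x xv by (auto simp: nb_def insert_commute)
      then have "V \<subseteq> {v, x}" using connD[OF conn] v by blast
      then have "card V \<le> card {v, x}" by (simp add: card_mono)
      also have "\<dots> \<le> 2" by (simp add: card_insert_if)
      finally show False using ge5 by simp
    qed
    then show ?thesis by blast
  qed blast
qed

lemma local_structure:
  obtains u R W where "u \<in> core" "R \<subseteq> core" "u \<notin> R" "card R \<le> 3" "clique T (insert u R)"
    "W \<subseteq> core" "W \<noteq> {}" "W \<inter> insert u R = {}" "\<And>a b. a \<in> W \<Longrightarrow> b \<in> W \<Longrightarrow> {a, b} \<notin> E"
    "nb E u \<inter> core \<subseteq> R \<union> W"
    "\<And>v. v \<in> W \<Longrightarrow> nb E v \<inter> core \<subseteq> insert u R"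
    "\<And>v. v \<in> W \<Longrightarrow> card (nb E v \<inter> core) \<le> 3"
    "\<And>v. v \<in> W \<Longrightarrow> card (nb E v \<inter> core) = 3 \<Longrightarrow> u \<in> nb E v"
    "\<And>v. v \<in> W \<Longrightarrow> clique T (nb E v \<inter> core)"
proof -
  have fC: "finite core" "core \<subseteq> V" using finV by (auto simp: core_def)
  define simpl where "simpl = (\<lambda>s. card (nb T s \<inter> core) \<le> 3 \<and> clique T (nb T s \<inter> core))"
  \<comment> \<open>Independence is taken in \<open>T\<close>, not only in \<open>E\<close>, so that
    the neighbours in \<open>T\<close> of a vertex of \<open>L\<close> avoid
    \<open>L\<close>.\<close>
  define F where "F = {L. L \<subseteq> {s\<in>core. simpl s} \<and> (\<forall>a\<in>L. \<forall>b\<in>L. {a, b} \<notin> T)}"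
  have "F \<subseteq> Pow core" by (auto simp: F_def)
  then have "finite F" using fC(1) by (simp add: finite_subset)
  moreover have "F \<noteq> {}" by (auto simp: F_def)
  ultimately obtain L where L: "L \<in> F" "\<And>L'. L' \<in> F \<Longrightarrow> L \<subseteq> L' \<Longrightarrow> L = L'"
    using finite_has_maximal[of F] by blast
  have Lc: "L \<subseteq> core" "\<And>s. s \<in> L \<Longrightarrow> simpl s" and Li: "\<And>a b. a \<in> L \<Longrightarrow> b \<in> L \<Longrightarrow> {a, b} \<notin> T"
    using L(1) by (auto simp: F_def)
  have "core - L \<noteq> {}"
  proof
    assume "core - L = {}"
    obtain h where h: "h \<in> core" using core_nonempty by blast
    then have "nb E h \<inter> core \<noteq> {}" using core_nb[OF h] by auto
    then obtain k where k: "k \<in> core" "{h, k} \<in> E" by (auto simp: nb_def)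
    then show False using Li[of h k] h ET \<open>core - L = {}\<close> by blast
  qed
  moreover have "core - L \<subseteq> V" using fC by blast
  ultimately obtain u where u: "u \<in> core - L" "card (nb T u \<inter> (core - L)) \<le> 3" "clique T (nb T u \<inter> (core - L))"
    using good unfolding good_def by blast
  define R where "R = nb T u \<inter> (core - L)"
  define W where "W = {v\<in>L. {u, v} \<in> T}"
  have uu: "{u} \<notin> T" using T2[of "{u}"] by auto
  have uR: "u \<notin> R" using uu by (auto simp: R_def nb_def)
  \<comment> \<open>Otherwise \<open>u\<close> would be simplicial in \<open>core\<close> and not
    adjacent to \<open>L\<close>, so \<open>L\<close> could be enlarged.\<close>
  have "W \<noteq> {}"
  proof
    assume "W = {}"
    then have "nb T u \<inter> core = R" by (auto simp: W_def R_def nb_def)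
    then have "simpl u" using u by (simp add: simpl_def R_def)
    moreover have "{u, v} \<notin> T" "{v, u} \<notin> T" if "v \<in> L" for v
      using \<open>W = {}\<close> that by (auto simp: W_def insert_commute)
    ultimately have "insert u L \<in> F" using u(1) Lc Li uu by (auto simp: F_def)
    then show False using L(2)[of "insert u L"] u(1) by blast
  qed
  have cl: "clique T (insert u R)"
    unfolding clique_def
  proof (intro ballI impI)
    fix a b assume ab: "a \<in> insert u R" "b \<in> insert u R" "a \<noteq> b"
    have R: "{u, c} \<in> T" "{c, u} \<in> T" if "c \<in> R" for c
      using that by (auto simp: R_def nb_def insert_commute)
    show "{a, b} \<in> T"
    proof (cases "a = u \<or> b = u")
      case True
      then show ?thesis using R ab by blast
    next
      case False
      then show ?thesis using ab u(3) unfolding R_def[symmetric] clique_def by blast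
    qed
  qed
  \<comment> \<open>\<open>v\<close> is simplicial and adjacent to \<open>u\<close> in
    \<open>T\<close>, so its other neighbours are adjacent to \<open>u\<close>; being adjacent to a
    vertex of \<open>L\<close>, they are not in \<open>L\<close>.\<close>
  have K: "nb T v \<inter> core \<subseteq> insert u R" if v: "v \<in> W" for v
  proof
    fix b assume b: "b \<in> nb T v \<inter> core"
    have bL: "b \<notin> L" using Li[of v b] v b by (auto simp: W_def nb_def)
    have c: "clique T (nb T v \<inter> core)" using Lc(2)[of v] v unfolding W_def simpl_def by blast
    have uc: "u \<in> nb T v \<inter> core" using v u(1) by (auto simp: W_def nb_def insert_commute)
    have "{u, b} \<in> T" if "u \<noteq> b"
      by (rule c[unfolded clique_def, rule_format, OF uc b that])
    then show "b \<in> insert u R" using b bL by (auto simp: R_def nb_def)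
  qed
  have ET': "nb E v \<subseteq> nb T v" for v using ET by (auto simp: nb_def)
  show thesis
  proof (rule that[of u R W])
    show "nb E u \<inter> core \<subseteq> R \<union> W"
      using ET'[of u] by (auto simp: R_def W_def nb_def)
    show "W \<inter> insert u R = {}" using u(1) by (auto simp: W_def R_def)
    show "{a, b} \<notin> E" if "a \<in> W" "b \<in> W" for a b using that Li ET by (auto simp: W_def)
    fix v assume v: "v \<in> W"
    have c3: "card (nb T v \<inter> core) \<le> 3" "clique T (nb T v \<inter> core)"
      using Lc(2) v by (auto simp: W_def simpl_def)
    have sub: "nb E v \<inter> core \<subseteq> nb T v \<inter> core" using ET' by blast
    have fin: "finite (nb T v \<inter> core)" using fC by simp
    show "nb E v \<inter> core \<subseteq> insert u R" using K[OF v] sub by blast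
    show "card (nb E v \<inter> core) \<le> 3" using card_mono[OF fin sub] c3 by simp
    show "clique T (nb E v \<inter> core)" using c3(2) sub unfolding clique_def by blast
    \<comment> \<open>Three neighbours in \<open>E\<close> exhaust those in \<open>T\<close>, of
      which \<open>u\<close> is one.\<close>
    assume "card (nb E v \<inter> core) = 3"
    then have "nb E v \<inter> core = nb T v \<inter> core"
      using card_subset_eq[OF fin sub] card_mono[OF fin sub] c3(1) by simp
    moreover have "u \<in> nb T v \<inter> core" using v u(1) by (auto simp: W_def nb_def insert_commute)
    ultimately show "u \<in> nb E v" by blast
  qed (use u Lc uR cl \<open>W \<noteq> {}\<close> in \<open>auto simp: R_def W_def\<close>)
qed

end

lemma card_2E: "card X = 2 \<Longrightarrow> s \<in> X \<Longrightarrow> \<exists>t. X = {s, t} \<and> s \<noteq> t"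
  by (auto simp: card_2_iff)

lemma card_3E1: "card X = 3 \<Longrightarrow> s \<in> X \<Longrightarrow> \<exists>y z. X = {s, y, z} \<and> distinct [s, y, z]"
  unfolding card_3_iff by auto

lemma card_3E2: "card X = 3 \<Longrightarrow> s \<in> X \<Longrightarrow> t \<in> X \<Longrightarrow> s \<noteq> t \<Longrightarrow> \<exists>z. X = {s, t, z} \<and> distinct [s, t, z]"
  unfolding card_3_iff by auto

lemma clique_mono: "clique T K \<Longrightarrow> L \<subseteq> K \<Longrightarrow> clique T L"
  unfolding clique_def by blast

section \<open>The contradiction for odd order\<close>

context mincx_odd
begin

text \<open>What is left for a vertex with a small clique around it once pendant neighbours and
  suppressible vertices are excluded. \<open>nb E h \<in> E\<close> says of a vertex of degree two
  that its neighbours are adjacent.\<close>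

definition low :: "'a \<Rightarrow> bool" where
  "low h \<longleftrightarrow> (\<forall>p. nb E p \<noteq> {h}) \<and> nb E h \<subseteq> core \<and>
     (card (nb E h) = 3 \<or> card (nb E h) = 2 \<and> nb E h \<in> E)"

text \<open>A pendant neighbour is excluded by \<open>leafpend2\<close> and
  \<open>leafpend3\<close>; for degree two, \<open>suppress\<close> makes the neighbours
  adjacent.\<close>

lemma low_core:
  assumes h: "h \<in> core" and cl: "clique T (nb E h \<inter> core)" and c3: "card (nb E h \<inter> core) \<le> 3"
  shows "low h"
proof -
  let ?X = "nb E h \<inter> core"
  have c: "card ?X = 2 \<or> card ?X = 3" using core_nb[OF h] c3 by linarith
  have np: "nb E h \<subseteq> core \<and> (\<forall>p. nb E p \<noteq> {h})"
  proof (rule ccontr)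
    assume "\<not> ?thesis"
    then obtain p where p: "nb E p = {h}" "nb E h = insert p ?X" "p \<notin> core" using core_nb[OF h] by blast
    from c show False
    proof
      assume "card ?X = 2"
      then obtain x y where X: "?X = {x, y}" "x \<noteq> y" by (auto simp: card_2_iff)
      then have "nb E h = {x, y, p}" using p(2) by auto
      moreover have "x \<in> core" "y \<in> core" using X by blast+
      moreover have "{x, y} \<in> T" using cl X unfolding clique_def by simp
      ultimately show False using leafpend2[of h x y p] p X(2) by auto
    next
      assume "card ?X = 3"
      then obtain x y z where X: "?X = {x, y, z}" "distinct [x, y, z]" by (auto simp: card_3_iff)
      then have "nb E h = {x, y, z, p}" using p(2) by auto
      moreover have "x \<in> core" "y \<in> core" "z \<in> core" using X by blast+
      ultimately show False using leafpend3[of h x y z p] p X cl by auto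
    qed
  qed
  then have X: "?X = nb E h" by blast
  have "nb E h \<in> E" if c2: "card (nb E h) = 2"
  proof -
    obtain x y where xy: "nb E h = {x, y}" "x \<noteq> y" using c2 by (auto simp: card_2_iff)
    have "{x, y} \<in> E"
    proof (rule suppress[OF xy(1) _ xy(2)])
      show "h \<in> V" using h by (simp add: core_def)
      have "{x, y} \<in> T" using cl xy X unfolding clique_def by simp
      then show "insert {x, y} {e \<in> E. h \<notin> e} \<subseteq> T" using ET by blast
      show "good (V - {h}) T" using good good_mono by blast
    qed
    then show ?thesis using xy by simp
  qed
  then show ?thesis using np c X unfolding low_def by auto
qed

text \<open>A clique of at most four vertices has no room for disjoint neighbourhoods of sizes three
  and two. If one contains the other, \<open>sub32\<close> applies, and otherwise
  \<open>cross32\<close>.\<close>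

lemma pair32:
  assumes v: "low v" "card (nb E v) = 3" and w: "low w" "card (nb E w) = 2"
    and vw: "v \<noteq> w" "{v, w} \<notin> E"
    and Q: "nb E v \<subseteq> Q" "nb E w \<subseteq> Q" "clique T Q" "card Q \<le> 4" "finite Q"
  shows False
proof -
  have np: "nb E p \<noteq> {v}" for p using v(1) by (simp add: low_def)
  have eE: "nb E w \<in> E" using w by (auto simp: low_def)
  obtain s t where st: "nb E w = {s, t}" "s \<noteq> t" using w(2) by (auto simp: card_2_iff)
  have one: False if s: "s \<in> nb E v" and st: "nb E w = {s, t}" "s \<noteq> t" for s t
  proof (cases "t \<in> nb E v")
    case True
    then obtain z where z: "nb E v = {s, t, z}" "distinct [s, t, z]" using card_3E2[OF v(2) s True st(2)] by blast
    show False using sub32[OF z(1) st(1) z(2) vw] eE st np by auto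
  next
    case False
    obtain y z where yz: "nb E v = {s, y, z}" "distinct [s, y, z]" using card_3E1[OF v(2) s] by blast
    have "distinct [s, y, z, t]" using yz False by auto
    moreover have "clique T {s, y, z}" using clique_mono[OF Q(3) Q(1)] yz by simp
    ultimately show False using cross32[OF yz(1) st(1) _ vw] eE st np by auto
  qed
  show False
  proof (cases "nb E v \<inter> nb E w = {}")
    case True
    then have "card (nb E v \<union> nb E w) = 5" using v(2) w(2) finite_nb by (simp add: card_Un_disjoint)
    moreover have "card (nb E v \<union> nb E w) \<le> card Q" using Q by (intro card_mono) auto
    ultimately show False using Q(4) by simp
  next
    case False
    then have "s \<in> nb E v \<or> t \<in> nb E v" using st by auto
    moreover have "nb E w = {t, s}" using st by auto
    ultimately show False using one[of s t] one[of t s] st by auto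
  qed
qed

text \<open>All other positions of two neighbourhoods in a clique of four are reducible. Two
  disjoint pairs remain, because \<open>disj2\<close> needs an edge of \<open>E\<close> between
  them, while the clique is one of \<open>T\<close> only.\<close>

lemma pair:
  assumes v: "low v" and w: "low w" and vw: "v \<noteq> w" "{v, w} \<notin> E"
    and Q: "nb E v \<subseteq> Q" "nb E w \<subseteq> Q" "clique T Q" "card Q \<le> 4" "finite Q"
  shows "card (nb E v) = 2 \<and> card (nb E w) = 2 \<and> nb E v \<inter> nb E w = {}"
proof -
  have wv: "w \<noteq> v" "{w, v} \<notin> E" using vw by (auto simp: insert_commute)
  have n33: False if c3: "card (nb E v) = 3" "card (nb E w) = 3"
  proof -
    have "card (nb E v \<union> nb E w) \<le> 4" using Q card_mono[of Q "nb E v \<union> nb E w"] by auto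
    then have "2 \<le> card (nb E v \<inter> nb E w)"
      using card_Un_Int[OF finite_nb finite_nb, of v w] c3 by linarith
    then obtain D where "D \<subseteq> nb E v \<inter> nb E w" "card D = 2" by (meson obtain_subset_with_card_n)
    then obtain x y where xy: "x \<in> nb E v" "x \<in> nb E w" "y \<in> nb E v" "y \<in> nb E w" "x \<noteq> y"
      by (auto simp: card_2_iff)
    obtain z where z: "nb E v = {x, y, z}" "distinct [x, y, z]" using card_3E2[OF c3(1) xy(1,3,5)] by blast
    obtain t where t: "nb E w = {x, y, t}" "distinct [x, y, t]" using card_3E2[OF c3(2) xy(2,4,5)] by blast
    show False
    proof (cases "z = t")
      case True
      then show False using same3[OF z(1) _ z(2) vw(1)] t(1) clique_mono[OF Q(3) Q(1)] z(1) by simp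
    next
      case False
      have "clique T {x, y, z, t}" by (rule clique_mono[OF Q(3)]) (use Q z t in auto)
      moreover have "distinct [x, y, z, t]" using z t False by auto
      ultimately show False using cross33[OF z(1) t(1) _ vw] by blast
    qed
  qed
  have c: "card (nb E v) = 2" "card (nb E w) = 2"
    using n33 pair32[OF v _ w _ vw Q] pair32[OF w _ v _ wv Q(2,1,3-5)] v w by (auto simp: low_def)
  have e: "nb E v \<in> E" "nb E w \<in> E" using c v w by (auto simp: low_def)
  have "nb E v \<inter> nb E w = {}"
  proof (rule ccontr)
    assume "\<not> ?thesis"
    then obtain y where y: "y \<in> nb E v" "y \<in> nb E w" by blast
    obtain x where x: "nb E v = {y, x}" "y \<noteq> x" using card_2E[OF c(1) y(1)] by blast
    obtain z where z: "nb E w = {y, z}" "y \<noteq> z" using card_2E[OF c(2) y(2)] by blast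
    show False
    proof (cases "x = z")
      case True
      then show False using twin2[OF x(1) _ x(2) vw(1)] z e x by simp
    next
      case False
      have "nb E v = {x, y}" "{x, y} \<in> E" "{y, z} \<in> E" "distinct [x, y, z]" using x z e False by (auto simp: insert_commute)
      then show False using share2[OF _ z(1) _ vw] by blast
    qed
  qed
  then show ?thesis using c by simp
qed

text \<open>A pendant vertex at \<open>u\<close> is excluded by \<open>pend_deg2\<close> and
  \<open>tail3\<close>. The remaining cases are governed by the degree of \<open>v\<close> and by
  the set \<open>S\<close> of the other neighbours of \<open>u\<close>, both within the clique
  formed by \<open>u\<close> and \<open>R\<close>.\<close>

lemma adjacent_leaf:
  assumes v: "low v" and u: "u \<in> core" "u \<in> nb E v" "v \<in> core"
    and nbs: "nb E v \<subseteq> insert u R" "nb E u \<inter> core \<subseteq> insert v R"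
    and R: "card R \<le> 3" "finite R" "clique T (insert u R)" "u \<notin> R" "v \<notin> insert u R" "R \<subseteq> core"
  shows False
proof -
  have vu: "{v, u} \<in> E" "{u, v} \<in> E" "u \<noteq> v" using u(2) edge by (auto simp: nb_def insert_commute)
  have TR: "{a, b} \<in> T" if "a \<in> insert u R" "b \<in> insert u R" "a \<noteq> b" for a b
    using R(3) that by (auto simp: clique_def)
  have npv: "nb E p \<noteq> {v}" for p using v by (simp add: low_def)
  have v_cases: "(\<exists>a. nb E v = {u, a} \<and> u \<noteq> a \<and> {u, a} \<in> E) \<or> (\<exists>a b. nb E v = {u, a, b} \<and> distinct [u, a, b])"
  proof (cases "card (nb E v) = 3")
    case True
    then show ?thesis using card_3E1[OF True u(2)] by blast
  next
    case False
    then have c2: "card (nb E v) = 2" "nb E v \<in> E" using v by (auto simp: low_def)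
    then show ?thesis using card_2E[OF c2(1) u(2)] by fastforce
  qed
  have inR: "a \<in> R" if "a \<in> nb E v" "a \<noteq> u" for a using that nbs(1) by auto
  have npu: "nb E u \<subseteq> core \<and> (\<forall>p. nb E p \<noteq> {u})"
  proof (rule ccontr)
    assume "\<not> ?thesis"
    then obtain p where p: "nb E p = {u}" "p \<notin> core" using core_nb[OF u(1)] by blast
    from v_cases show False
    proof (elim disjE exE conjE)
      fix a assume a: "nb E v = {u, a}" "u \<noteq> a" "{u, a} \<in> E"
      have "p \<noteq> a" using inR[of a] a R(6) p(2) by auto
      then show False using pend_deg2[OF a(1) p(1)] a by blast
    next
      fix a b assume a: "nb E v = {u, a, b}" "distinct [u, a, b]"
      have "v \<noteq> p" using u(3) p(2) by blast
      moreover have "clique T {u, a, b}" using clique_mono[OF R(3) nbs(1)] a by simp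
      ultimately show False using tail3[OF a(1) p(1) a(2)] npv by blast
    qed
  qed
  have npu': "nb E p \<noteq> {u}" for p using npu by blast
  define S where "S = nb E u - {v}"
  have S: "S \<subseteq> R" "nb E u = insert v S" "v \<notin> S" using npu nbs(2) vu by (auto simp: S_def nb_def)
  have fS: "finite S" using S(1) R(2) finite_subset by blast
  have "2 \<le> card (nb E u)" using core_nb[OF u(1)] npu by (metis Int_absorb2)
  then have "1 \<le> card S" using S fS by simp
  moreover have "card S \<le> 3" using card_mono[OF R(2) S(1)] R(1) by simp
  ultimately have cS: "card S = 1 \<or> card S = 2 \<or> card S = 3" by linarith
  have nS: "u \<notin> S" "v \<notin> R" "u \<notin> R" using S(1) R by auto
  from v_cases show False
  proof (elim disjE exE conjE)
    fix a assume a: "nb E v = {u, a}" "u \<noteq> a" "{u, a} \<in> E"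
    have aS: "a \<in> S" "a \<in> R" using a inR[of a] nbD[OF a(1), of a] by (auto simp: S_def nb_def)
    have va: "v \<noteq> a" using nbD[OF a(1), of a] by auto
    from cS show False
    proof (elim disjE)
      assume "card S = 1"
      then have "S = {a}" using aS by (auto simp: card_1_singleton_iff)
      then have nu: "nb E u = {v, a}" using S by simp
      have V: "a \<in> V" "u \<in> V" "v \<in> V" using nbD[OF nu, of a] nbD[OF nu, of v] by auto
      \<comment> \<open>Here \<open>a\<close> would cut off the part \<open>{u, v}\<close>, too
        large for \<open>side\<close>.\<close>
      have "{u, v} = {} \<or> (\<exists>p. {u, v} = {p} \<and> nb E p = {a})"
      proof (rule side[OF V(1)])
        show "{u, v} \<subseteq> V - {a}" using V a va by auto
        have "card (V - {a} - {u, v}) = card V - 3"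
          using V a va vu finV by (subst Diff_insert2[symmetric], subst card_Diff_subset) (auto simp: card_insert_if)
        then show "2 \<le> card (V - {a} - {u, v})" using ge5 by simp
        show "w \<in> insert a {u, v}" if "q \<in> {u, v}" "{q, w} \<in> E" for q w
          using that a(1) nu by (auto simp: nb_def)
      qed
      then show False using vu by auto
    next
      assume "card S = 2"
      then obtain b where b: "S = {a, b}" "a \<noteq> b" using card_2E aS by metis
      have "nb E u = {v, a, b}" "distinct [v, u, a, b]" "{a, b} \<in> T"
        using b S nS vu va a TR[of a b] by auto
      then show False using adj23[OF a(1)] by blast
    next
      assume "card S = 3"
      then obtain b c where b: "S = {a, b, c}" "distinct [a, b, c]" using card_3E1 aS by metis
      have "nb E u = {v, a, b, c}" "distinct [u, v, a, b, c]" using b S nS vu by auto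
      then show False using adj24[OF a(1)] npu' by blast
    qed
  next
    fix a b assume a: "nb E v = {u, a, b}" "distinct [u, a, b]"
    have abR: "a \<in> R" "b \<in> R" using a inR[of a] inR[of b] by auto
    have vab: "v \<noteq> a" "v \<noteq> b" using abR nS by auto
    have a': "nb E v = {u, b, a}" using a(1) by auto
    have cl: "clique T {a, b, c}" if "c \<in> R" for c using clique_mono[OF R(3), of "{a, b, c}"] abR that by auto
    from cS show False
    proof (elim disjE)
      assume "card S = 1"
      then obtain c where c: "S = {c}" by (auto simp: card_1_singleton_iff)
      have nu: "nb E u = {v, c}" using S c by simp
      have cR: "c \<in> R" using S c by simp
      consider "c = a" | "c = b" | "c \<notin> {a, b}" by blast
      then show False
      proof cases
        case 1
        have "nb E v = {u, a, b}" "distinct [u, v, a, b]" using a vu vab by auto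
        then show False using adj23[of u v a b] nu 1 TR[of a b] abR by auto
      next
        case 2
        have "nb E v = {u, b, a}" "distinct [u, v, b, a]" using a vu vab by auto
        then show False using adj23[of u v b a] nu 2 TR[of b a] abR by auto
      next
        case 3
        have V: "u \<in> V" "c \<in> V" "a \<in> V" "b \<in> V" "c \<noteq> u"
          using nbD[OF nu, of c] nbD[OF a(1), of a] nbD[OF a(1), of b] by auto
        \<comment> \<open>The edge \<open>v c\<close> demanded by \<open>suppress\<close> need not
          lie in \<open>T\<close>. Without \<open>u\<close>, the neighbours of \<open>v\<close> in
          \<open>E\<close> are \<open>a\<close> and \<open>b\<close>, and \<open>a\<close>,
          \<open>b\<close>, \<open>c\<close> form a clique, so \<open>v\<close> can be attached to
          it afresh.\<close>
        let ?T = "{e\<in>T. v \<notin> e} \<union> (\<lambda>k. {v, k}) ` {a, b, c}"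
        have "{v, c} \<in> E"
        proof (rule suppress[OF nu V(1)])
          show "v \<noteq> c" using cR nS by auto
          show "insert {v, c} {e \<in> E. u \<notin> e} \<subseteq> ?T"
          proof
            fix e assume e: "e \<in> insert {v, c} {e \<in> E. u \<notin> e}"
            show "e \<in> ?T"
            proof (cases "e \<in> E \<and> u \<notin> e \<and> v \<in> e")
              case True
              then obtain s t where "e = {s, t}" using edgeE by metis
              then obtain q where q: "e = {v, q}" using True by auto
              then have "q \<in> nb E v" using True by (simp add: nb_def)
              then show ?thesis using a(1) True q by auto
            next
              case False
              then show ?thesis using e ET by auto
            qed
          qed
          show "good (V - {u}) ?T"
          proof (rule good_reattach)
            show "good (V - {u}) T" using good good_mono by blast
            show "{a, b, c} \<subseteq> V - {u}" using V a(2) by auto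
            show "v \<notin> {a, b, c}" using vab cR nS by auto
            show "card {a, b, c} \<le> 3" by (simp add: card_insert_if)
            show "clique T {a, b, c}" by (rule cl[OF cR])
          qed simp
        qed
        then have "c \<in> nb E v" by (simp add: nb_def)
        then show False using a(1) 3 V(5) by auto
      qed
    next
      assume c2: "card S = 2"
      show False
      proof (cases "a \<in> S")
        case True
        obtain c where c: "S = {a, c}" "a \<noteq> c" using card_2E[OF c2 True] by blast
        have nu: "nb E u = {v, a, c}" using S c by simp
        have cR: "c \<in> R" using S c by simp
        show False
        proof (cases "c = b")
          case True
          then show False using adj33_ab[OF a(1)] nu vu vab a by auto
        next
          case False
          have "distinct [u, v, a, b, c]" using a False c vu vab cR nS by auto
          then show False using adj33_ac[OF a(1) nu] cl[OF cR] by blast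
        qed
      next
        case False
        have bS: "b \<in> S"
        proof (rule ccontr)
          assume "b \<notin> S"
          then have "card ({a, b} \<union> S) = 4" using False c2 a(2) fS by (simp add: card_insert_if)
          moreover have "card ({a, b} \<union> S) \<le> card R" using abR S R(2) by (intro card_mono) auto
          ultimately show False using R(1) by simp
        qed
        obtain c where c: "S = {b, c}" "b \<noteq> c" using card_2E[OF c2 bS] by blast
        have nu: "nb E u = {v, b, c}" using S c by simp
        have cR: "c \<in> R" using S c by simp
        have "distinct [u, v, b, a, c]" using a False c vu vab cR nS by auto
        moreover have "clique T {b, a, c}" using cl[OF cR] by (simp add: insert_commute)
        ultimately show False using adj33_ac[OF a' nu] by blast
      qed
    next
      assume c3: "card S = 3"
      then have "S = R" using card_subset_eq[OF R(2) S(1)] card_mono[OF R(2) S(1)] R(1) by simp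
      then obtain c where c: "S = {a, b, c}" "distinct [a, b, c]" using card_3E2[OF c3, of a b] abR a(2) by auto
      have "nb E u = {v, a, b, c}" "distinct [u, v, a, b, c]" using c S nS vu a vab by auto
      then show False using adj34[OF a(1)] npu' by blast
    qed
  qed
qed

lemma odd_False: False
proof -
  obtain u R W where u: "u \<in> core" and R: "R \<subseteq> core" "u \<notin> R" "card R \<le> 3" "clique T (insert u R)"
    and W: "W \<subseteq> core" "W \<noteq> {}" "W \<inter> insert u R = {}" "\<And>a b. a \<in> W \<Longrightarrow> b \<in> W \<Longrightarrow> {a, b} \<notin> E"
    and nu: "nb E u \<inter> core \<subseteq> R \<union> W"
    and nW: "\<And>v. v \<in> W \<Longrightarrow> nb E v \<inter> core \<subseteq> insert u R" "\<And>v. v \<in> W \<Longrightarrow> card (nb E v \<inter> core) \<le> 3"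
      "\<And>v. v \<in> W \<Longrightarrow> card (nb E v \<inter> core) = 3 \<Longrightarrow> u \<in> nb E v" "\<And>v. v \<in> W \<Longrightarrow> clique T (nb E v \<inter> core)"
    using local_structure by blast
  have fin: "finite R" "finite (insert u R)"
    using R(1) finV finite_subset[of R V] by (auto simp: core_def)
  have c4: "card (insert u R) \<le> 4" using R(3) fin by (simp add: card_insert_if)
  have lowW: "low v" "nb E v \<subseteq> insert u R" if "v \<in> W" for v
  proof -
    show "low v" using low_core nW that W(1) by blast
    then show "nb E v \<subseteq> insert u R" using nW(1)[OF that] by (auto simp: low_def)
  qed
  have pairW: "card (nb E v) = 2 \<and> card (nb E w) = 2 \<and> nb E v \<inter> nb E w = {}"
    if "v \<in> W" "w \<in> W" "v \<noteq> w" for v w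
    by (rule pair[where Q = "insert u R"]) (use that lowW W(4) R(4) c4 fin in auto)
  show False
  proof (cases "\<exists>v\<in>W. \<exists>w\<in>W. v \<noteq> w")
    case True
    then obtain v' w' where vw': "v' \<in> W" "w' \<in> W" "v' \<noteq> w'" by blast
    \<comment> \<open>Two disjoint pairs fill the clique of at most four vertices, so one of them
      contains \<open>u\<close>.\<close>
    have Q: "nb E v \<union> nb E w = insert u R" if vw: "v \<in> W" "w \<in> W" "v \<noteq> w" for v w
    proof (rule card_subset_eq[OF fin(2)])
      show "nb E v \<union> nb E w \<subseteq> insert u R" using lowW vw by blast
      then have "card (nb E v \<union> nb E w) \<le> card (insert u R)" using fin(2) by (rule card_mono[rotated])
      moreover have "card (nb E v \<union> nb E w) = 4"
        using pairW[OF vw] finite_nb by (simp add: card_Un_disjoint)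
      ultimately show "card (nb E v \<union> nb E w) = card (insert u R)" using c4 by simp
    qed
    have "\<exists>v w. v \<in> W \<and> w \<in> W \<and> v \<noteq> w \<and> u \<in> nb E v"
      using Q[OF vw'] vw' by blast
    then obtain v w where vw: "v \<in> W" "w \<in> W" "v \<noteq> w" "u \<in> nb E v" by blast
    have c: "card (nb E v) = 2" "card (nb E w) = 2" "nb E v \<inter> nb E w = {}" using pairW[OF vw(1-3)] by auto
    obtain y where y: "nb E v = {u, y}" "u \<noteq> y" using card_2E[OF c(1) vw(4)] by blast
    obtain z t where zt: "nb E w = {z, t}" "z \<noteq> t" using c(2) by (auto simp: card_2_iff)
    have d: "distinct [u, y, z, t]" using c(3) y zt by auto
    have Qe: "insert u R = {u, y, z, t}" using Q[OF vw(1-3)] y zt by auto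
    have e: "{u, y} \<in> E" "{z, t} \<in> E" using lowW[OF vw(1)] lowW[OF vw(2)] c y zt by (auto simp: low_def)
    have nvw: "{v, w} \<notin> E" using W(4) vw by blast
    have y': "nb E v = {y, u}" and zt': "nb E w = {t, z}" using y zt by auto
    have "{u, z} \<notin> E"
      using disj2[OF y' zt(1) _ vw(3) nvw] d e by (auto simp: insert_commute)
    moreover have "{u, t} \<notin> E"
      using disj2[OF y' zt' _ vw(3) nvw] d e by (auto simp: insert_commute)
    \<comment> \<open>\<open>disj2\<close> forbids edges of \<open>E\<close> from \<open>u\<close>
      to the other pair, and \<open>u\<close> belongs to the neighbourhood of one vertex of
      \<open>W\<close> only.\<close>
    ultimately have uR: "nb E u \<inter> core \<subseteq> {y, v}"
    proof -
      assume no: "{u, z} \<notin> E" "{u, t} \<notin> E"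
      show ?thesis
      proof
        fix q assume q: "q \<in> nb E u \<inter> core"
        show "q \<in> {y, v}"
        proof (cases "q \<in> W")
          case True
          have "q = v"
          proof (rule ccontr)
            assume "q \<noteq> v"
            then have "nb E v \<inter> nb E q = {}" using pairW[OF vw(1) True] by blast
            moreover have "u \<in> nb E q" using q nb_sym by blast
            ultimately show False using vw(4) by blast
          qed
          then show ?thesis by simp
        next
          case False
          then have "q \<in> insert u R" using q nu by blast
          moreover have "q \<noteq> u" using q nbV[of u] by blast
          ultimately show ?thesis using q no unfolding Qe by (auto simp: nb_def)
        qed
      qed
    qed
    have npu: "nb E q = {u}" if q: "q \<in> nb E u" "q \<notin> core" for q
    proof -
      have "\<not> nb E u \<subseteq> core" using q by auto
      then obtain p where p: "nb E p = {u}" "nb E u = insert p (nb E u \<inter> core)"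
        using core_nb[OF u] by auto
      have "q \<in> insert p (nb E u \<inter> core)" using q(1) p(2) by simp
      then have "q = p" using q(2) by simp
      then show ?thesis using p(1) by simp
    qed
    \<comment> \<open>The part cut off by \<open>y\<close>: \<open>u\<close>, \<open>v\<close> and
      possibly a pendant vertex at \<open>u\<close>. It has at least two vertices, against
      \<open>side\<close>.\<close>
    define A where "A = insert u (insert v (nb E u - {y}))"
    have V: "y \<in> V" "u \<in> V" "v \<in> V" "w \<in> V" "z \<in> V" "v \<noteq> u" "v \<noteq> y"
      using nbD[OF y(1), of y] nbD[OF y(1), of u] nbD[OF zt(1), of z] by auto
    have notin: "w \<noteq> u" "w \<noteq> y" "w \<noteq> z" "v \<noteq> z" "w \<notin> nb E u" "z \<notin> nb E u"
    proof -
      have "w \<notin> insert u R" "v \<notin> insert u R" using W(3) vw by blast+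
      then show "w \<noteq> u" "w \<noteq> y" "w \<noteq> z" "v \<noteq> z" unfolding Qe by auto
      then show "w \<notin> nb E u" using uR W(1) vw by blast
      have "z \<in> core" using Qe R(1) d by auto
      then show "z \<notin> nb E u" using uR d \<open>v \<noteq> z\<close> by auto
    qed
    have "A = {} \<or> (\<exists>p. A = {p} \<and> nb E p = {y})"
    proof (rule side[OF V(1)])
      show "A \<subseteq> V - {y}" using V y(2) nbV[of u] by (auto simp: A_def)
      have "{w, z} \<subseteq> V - {y} - A" using V notin vw(3) d by (auto simp: A_def)
      moreover have "card {w, z} = 2" using notin by simp
      ultimately show "2 \<le> card (V - {y} - A)" using finV by (metis card_mono finite_Diff)
      show "b \<in> insert y A" if a: "a \<in> A" "{a, b} \<in> E" for a b
      proof -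
        consider "a = u" | "a = v" | "a \<in> nb E u" "a \<notin> core"
          using a(1) uR by (auto simp: A_def)
        then show ?thesis
        proof cases
          case 1 then show ?thesis using a(2) by (auto simp: A_def nb_def)
        next
          case 2
          then have "b \<in> {u, y}" using a(2) y(1) by (auto simp: nb_def)
          then show ?thesis by (auto simp: A_def)
        next
          case 3
          then have "b \<in> nb E a" "nb E a = {u}" using a(2) npu by (auto simp: nb_def)
          then show ?thesis by (simp add: A_def)
        qed
      qed
    qed
    moreover have "u \<in> A" "v \<in> A" by (auto simp: A_def)
    ultimately show False using V(6) by auto
  next
    case False
    then obtain v where v: "W = {v}" using W(2) by blast
    have low: "low v" "nb E v \<subseteq> insert u R" using lowW v by auto
    have vc: "v \<in> core" "v \<notin> insert u R" using W(1,3) v by auto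
    show False
    proof (cases "u \<in> nb E v")
      case True
      show False
        by (rule adjacent_leaf[OF low(1) u True vc(1) low(2) _ R(3) fin(1) R(4,2) vc(2) R(1)]) (use nu v in auto)
    next
      case False
      \<comment> \<open>Now \<open>u\<close> and \<open>v\<close> are nonadjacent with both
        neighbourhoods inside \<open>R\<close>, where the two disjoint pairs left by
        \<open>pair\<close> do not fit.\<close>
      then have nv: "nb E v \<subseteq> R" using low(2) by blast
      have vnu: "v \<notin> nb E u" using False nb_sym by metis
      have uR: "nb E u \<inter> core \<subseteq> R" using nu v vnu by blast
      have clR: "clique T R" using clique_mono[OF R(4)] by blast
      have lu: "low u"
        by (rule low_core[OF u clique_mono[OF clR uR]]) (use card_mono[OF fin(1) uR] R(3) in simp)
      have nu': "nb E u \<subseteq> R" using lu uR by (auto simp: low_def)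
      have vu: "v \<noteq> u" "{v, u} \<notin> E" using vc False by (auto simp: nb_def)
      have "card R \<le> 4" using R(3) by simp
      from pair[OF low(1) lu vu nv nu' clR this fin(1)]
      have "card (nb E v \<union> nb E u) = 4" using finite_nb by (simp add: card_Un_disjoint)
      moreover have "card (nb E v \<union> nb E u) \<le> card R" using nv nu' fin(1) by (intro card_mono) auto
      ultimately show False using R(3) by simp
    qed
  qed
qed

end

theorem pnle_or_exc:
  fixes V :: "'a set"
  assumes "finite V" "E \<subseteq> all2 V" "E \<subseteq> T" "good V T" "conn V E"
  shows "pnle E (card V div 2) \<or> exc V E"
  using assms
proof (induction "card V" arbitrary: V E T rule: less_induct)
  case less
  show ?case
  proof (rule ccontr)
    assume n: "\<not> ?thesis"
    have m: "mincx V E T"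
    proof (unfold_locales)
      fix V' :: "'a set" and E' T' assume "card V' < card V" "finite V'" "E' \<subseteq> all2 V'" "E' \<subseteq> T'" "good V' T'" "conn V' E'"
      then show "pnle E' (card V' div 2) \<or> exc V' E'" using less.hyps by blast
    qed (use less.prems n in auto)
    show False
    proof (cases "even (card V)")
      case True
      then show False using mincx.even_False[OF m] by blast
    next
      case False
      then have "mincx_odd V E T" using m by (simp add: mincx_odd_def mincx_odd_axioms_def)
      then show False by (rule mincx_odd.odd_False)
    qed
  qed
qed

section \<open>Transfer to graphs\<close>

lemma set_el_nth: "set (el xs) = {{xs ! i, xs ! Suc i} | i. Suc i < length xs}"
proof (induction xs rule: el.induct)
  case (1 x y r)
  have "{{(x # y # r) ! i, (x # y # r) ! Suc i} | i. Suc i < length (x # y # r)} =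
      insert {x, y} {{(y # r) ! i, (y # r) ! Suc i} | i. Suc i < length (y # r)}"
    (is "?L = insert _ ?R")
  proof (intro equalityI subsetI)
    fix e assume "e \<in> ?L"
    then obtain i where "e = {(x # y # r) ! i, (x # y # r) ! Suc i}" "Suc i < length (x # y # r)" by blast
    then show "e \<in> insert {x, y} ?R" by (cases i) auto
  next
    fix e assume "e \<in> insert {x, y} ?R"
    then consider "e = {x, y}" | i where "e = {(y # r) ! i, (y # r) ! Suc i}" "Suc i < length (y # r)" by blast
    then show "e \<in> ?L"
    proof cases
      case 1 then show ?thesis by (intro CollectI exI[of _ 0]) simp
    next
      case (2 i) then show ?thesis by (intro CollectI exI[of _ "Suc i"]) simp
    qed
  qed
  with 1 show ?case by simp
qed auto

text \<open>A list of paths becomes a set of graphs. Each edge has multiplicity one, so different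
  paths of the list share no edge; passing to the set can only lower the number.\<close>

lemma pn_le:
  fixes G :: "'a ugraph"
  assumes G: "uedges G \<subseteq> all2 (uverts G)" "finite (uverts G)" and p: "pnle (uedges G) m"
  shows "pn G \<le> m"
proof -
  obtain ps where ps: "length ps \<le> m" "finite (uedges G)" "decm ps (mset_set (uedges G))"
    "\<forall>p\<in>set ps. Suc 0 < length p" using pnle_long[OF p] by blast
  have M: "(\<Sum>p\<leftarrow>ps. mset (el p)) = mset_set (uedges G)" and d: "\<forall>p\<in>set ps. distinct p"
    using ps(3) by (auto simp: decm_def)
  have cnt: "(\<Sum>p\<leftarrow>ps. count (mset (el p)) e) \<le> 1" for e
  proof -
    have "count (\<Sum>p\<leftarrow>qs. mset (el p)) e = (\<Sum>p\<leftarrow>qs. count (mset (el p)) e)" for qs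
      by (induction qs) auto
    from this[of ps] have "(\<Sum>p\<leftarrow>ps. count (mset (el p)) e) = count (mset_set (uedges G)) e"
      unfolding M by (rule sym)
    also have "\<dots> \<le> 1" by (cases "e \<in> uedges G") (simp_all add: ps(2))
    finally show ?thesis .
  qed
  define gr where "gr = (\<lambda>p::'a list. UGraph (set p) (set (el p)))"
  have U: "(\<Union>p\<in>set ps. set (el p)) = uedges G"
  proof -
    have "set_mset (\<Sum>p\<leftarrow>ps. mset (el p)) = (\<Union>p\<in>set ps. set (el p))" by (induction ps) auto
    then show ?thesis unfolding M using ps(2) by simp
  qed
  have disj: "set (el p) \<inter> set (el q) = {}" if pq: "p \<in> set ps" "q \<in> set ps" "p \<noteq> q" for p q
  proof (rule equals0I)
    fix e assume e: "e \<in> set (el p) \<inter> set (el q)"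
    have "count (mset (el p)) e + count (mset (el q)) e \<le> (\<Sum>p\<leftarrow>ps. count (mset (el p)) e)"
      using pq
    proof (induction ps)
      case (Cons r rs)
      have mem: "count (mset (el p)) e \<le> (\<Sum>p\<leftarrow>rs. count (mset (el p)) e)" if "p \<in> set rs" for p
        using that member_le_sum_list[of "count (mset (el p)) e" "map (\<lambda>p. count (mset (el p)) e) rs"] by simp
      show ?case using Cons mem[of p] mem[of q] by auto
    qed simp
    moreover have "1 \<le> count (mset (el p)) e" "1 \<le> count (mset (el q)) e"
      using e by (auto simp: Suc_le_eq count_list_0_iff)
    ultimately show False using cnt[of e] by linarith
  qed
  have "path_decomposition G (gr ` set ps)"
    unfolding path_decomposition_def
  proof (intro conjI ballI)
    fix P assume "P \<in> gr ` set ps"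
    then obtain p where p: "p \<in> set ps" "P = gr p" by blast
    then show "is_path P"
      unfolding is_path_def using d ps(4)
      by (intro exI[of _ p]) (auto simp: gr_def set_el_nth)
    have E: "set (el p) \<subseteq> uedges G" using U p by blast
    have "set p = \<Union> (set (el p))" using Union_el ps(4) p by metis
    then have V: "set p \<subseteq> uverts G" using E G(1) by (auto simp: all2_def)
    show "subgraph P G"
      unfolding subgraph_def simple_graph_def
      using E V G el_subset[of _ p] by (auto simp: p gr_def all2_def)
  next
    show "pairwise (\<lambda>P Q. disjnt (uedges P) (uedges Q)) (gr ` set ps)"
      unfolding pairwise_def disjnt_def using disj by (auto simp: gr_def)
    show "(\<Union>P\<in>gr ` set ps. uedges P) = uedges G" using U by (simp add: gr_def)
  qed simp
  then have "pn G \<le> card (gr ` set ps)" unfolding pn_def by (intro Least_le) blast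
  also have "\<dots> \<le> length ps" by (meson card_image_le card_length finite_set le_trans)
  finally show ?thesis using ps(1) by simp
qed

lemma el_map: "el (map g p) = map ((`) g) (el p)"
  by (induction p rule: el.induct) auto

lemma pnle_image:
  assumes E: "E \<subseteq> all2 V" and g: "inj_on g V" and p: "pnle E m"
  shows "pnle ((`) g ` E) m"
proof -
  obtain ps where ps: "length ps \<le> m" "finite E" "decm ps (mset_set E)"
    "\<forall>p\<in>set ps. Suc 0 < length p" using pnle_long[OF p] by blast
  have M: "(\<Sum>p\<leftarrow>ps. mset (el p)) = mset_set E" and d: "\<forall>p\<in>set ps. distinct p"
    using ps(3) by (auto simp: decm_def)
  have sub: "set p \<subseteq> V" if "p \<in> set ps" for p
  proof -
    have "set_mset (\<Sum>p\<leftarrow>ps. mset (el p)) = (\<Union>p\<in>set ps. set (el p))" by (induction ps) auto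
    then have "set (el p) \<subseteq> E" using that ps(2) unfolding M by auto
    moreover have "set p = \<Union> (set (el p))" using Union_el ps(4) that by metis
    ultimately show ?thesis using E by (auto simp: all2_def)
  qed
  have "E \<subseteq> Pow V" using E by (auto simp: all2_def)
  then have "inj_on ((`) g) E" using inj_on_image_Pow[OF g] inj_on_subset by blast
  then have "mset_set ((`) g ` E) = image_mset ((`) g) (\<Sum>p\<leftarrow>ps. mset (el p))"
    unfolding M by (simp add: image_mset_mset_set)
  also have "\<dots> = (\<Sum>p\<leftarrow>map (map g) ps. mset (el p))"
    by (induction ps) (auto simp: el_map)
  finally have "decm (map (map g) ps) (mset_set ((`) g ` E))"
    using d sub g by (auto simp: decm_def distinct_map intro: inj_on_subset)
  then show ?thesis using ps by (intro pnleI[of _ "map (map g) ps"]) auto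
qed

lemma simple_all2: "simple_graph G \<longleftrightarrow> finite (uverts G) \<and> uedges G \<subseteq> all2 (uverts G)"
  by (auto simp: simple_graph_def all2_def)

lemma iso_complete:
  assumes "graph_iso G (complete_graph k)" "uedges G \<subseteq> all2 (uverts G)"
  shows "card (uverts G) = k \<and> clique (uedges G) (uverts G)"
proof -
  obtain f where f: "bij_betw f (uverts G) {..<k}"
    and E: "{{i, j} | i j. i < k \<and> j < k \<and> i \<noteq> j} = (`) f ` uedges G"
    using assms(1) by (auto simp: graph_iso_def complete_graph_def)
  have inj: "inj_on f (uverts G)" using f by (simp add: bij_betw_def)
  have "clique (uedges G) (uverts G)"
    unfolding clique_def
  proof (intro ballI impI)
    fix a b assume ab: "a \<in> uverts G" "b \<in> uverts G" "a \<noteq> b"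
    have "f a < k" "f b < k" "f a \<noteq> f b"
      using f ab inj_onD[OF inj] by (auto simp: bij_betw_def)
    then have "{f a, f b} \<in> (`) f ` uedges G" unfolding E[symmetric] by blast
    then obtain e where e: "e \<in> uedges G" "{f a, f b} = f ` e" by blast
    have "e \<subseteq> uverts G" using e(1) assms(2) by (auto simp: all2_def)
    moreover have "f ` e = f ` {a, b}" using e(2) by simp
    ultimately have "e = {a, b}" using inj_on_image_eq_iff[OF inj, of e "{a, b}"] ab by simp
    then show "{a, b} \<in> uedges G" using e(1) by simp
  qed
  moreover have "card (uverts G) = k" using bij_betw_same_card[OF f] by simp
  ultimately show ?thesis by simp
qed

text \<open>The vertex added last is simplicial in every set containing it, and any other set lies
  in the smaller 3-tree.\<close>

lemma k_tree_good: "k_tree 3 G \<Longrightarrow> good (uverts G) (uedges G)"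
proof (induction rule: k_tree.induct)
  case (complete G)
  have E: "uedges G \<subseteq> all2 (uverts G)" and fin: "finite (uverts G)" using complete(2) by (simp_all add: simple_all2)
  have K: "card (uverts G) = 3" "clique (uedges G) (uverts G)" using iso_complete[OF complete(3) E] by auto
  show ?case
    unfolding good_def
  proof (intro conjI ballI allI impI)
    show "card e = 2" if "e \<in> uedges G" for e using that E by (auto simp: all2_def)
    fix S assume S: "S \<subseteq> uverts G" "S \<noteq> {}"
    then obtain s where s: "s \<in> S" by blast
    have "card (nb (uedges G) s \<inter> S) \<le> card (uverts G)" using S fin by (intro card_mono) auto
    moreover have "clique (uedges G) (nb (uedges G) s \<inter> S)" using K(2) S unfolding clique_def by blast
    ultimately show "\<exists>s\<in>S. card (nb (uedges G) s \<inter> S) \<le> 3 \<and> clique (uedges G) (nb (uedges G) s \<inter> S)"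
      using s K(1) by auto
  qed
next
  case (extend G v)
  have E: "uedges G \<subseteq> all2 (uverts G)" and fin: "finite (uverts G)" using extend(1) by (simp_all add: simple_all2)
  let ?I = "induced_subgraph G (neighborhood G v)"
  have NV: "neighborhood G v \<subseteq> uverts G" by (auto simp: neighborhood_def)
  have "uedges ?I \<subseteq> all2 (uverts ?I)" using E by (auto simp: induced_subgraph_def all2_def)
  from iso_complete[OF extend(3) this] have K: "card (neighborhood G v) = 3" "clique (uedges G) (neighborhood G v)"
    using NV by (auto simp: induced_subgraph_def clique_def Int_absorb1)
  have nbv: "nb (uedges G) v = neighborhood G v"
  proof -
    have "{v, u} \<in> uedges G \<Longrightarrow> u \<in> uverts G \<and> u \<noteq> v" for u
      using subsetD[OF E, of "{v, u}"] by (auto simp: all2_edge)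
    then show ?thesis by (auto simp: nb_def neighborhood_def insert_commute)
  qed
  show ?case
    unfolding good_def
  proof (intro conjI ballI allI impI)
    show "card e = 2" if "e \<in> uedges G" for e using that E by (auto simp: all2_def)
    fix S assume S: "S \<subseteq> uverts G" "S \<noteq> {}"
    show "\<exists>s\<in>S. card (nb (uedges G) s \<inter> S) \<le> 3 \<and> clique (uedges G) (nb (uedges G) s \<inter> S)"
    proof (cases "v \<in> S")
      case True
      have "card (nb (uedges G) v \<inter> S) \<le> 3"
        using K(1) card_mono[of "neighborhood G v" "nb (uedges G) v \<inter> S"] nbv NV fin finite_subset by auto
      moreover have "clique (uedges G) (nb (uedges G) v \<inter> S)" using K(2) nbv unfolding clique_def by blast
      ultimately show ?thesis using True by blast
    next
      case False
      let ?D = "delete_vertex G v"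
      have "S \<subseteq> uverts ?D" using S False by (auto simp: delete_vertex_def induced_subgraph_def)
      then obtain s where s: "s \<in> S" "card (nb (uedges ?D) s \<inter> S) \<le> 3" "clique (uedges ?D) (nb (uedges ?D) s \<inter> S)"
        using extend.IH S(2) unfolding good_def by blast
      have eq: "nb (uedges ?D) s \<inter> S = nb (uedges G) s \<inter> S"
        using s(1) S False by (auto simp: nb_def delete_vertex_def induced_subgraph_def)
      have "uedges ?D \<subseteq> uedges G" by (auto simp: delete_vertex_def induced_subgraph_def)
      then have "clique (uedges G) (nb (uedges G) s \<inter> S)" using s(3) unfolding eq clique_def by blast
      then show ?thesis using s(1,2) unfolding eq by blast
    qed
  qed
qed

lemma conn_image:
  assumes "connected_graph G" "bij_betw f (uverts G) V" "E = (`) f ` uedges G"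
  shows "conn V E"
  unfolding conn_def
proof (intro allI impI)
  fix S assume S: "closed_in E S"
  have step: "f x \<in> S \<longleftrightarrow> f y \<in> S" if "(\<lambda>x y. {x, y} \<in> uedges G)\<^sup>*\<^sup>* x y" for x y
    using that
  proof induction
    case (step y z)
    then have "f ` {y, z} \<in> E" unfolding assms(3) by blast
    then have "{f y, f z} \<in> E" by simp
    then show ?case using closed_inD[OF S] step by blast
  qed simp
  have V: "V = f ` uverts G" using assms(2) by (simp add: bij_betw_def)
  show "V \<subseteq> S \<or> V \<inter> S = {}"
    using assms(1) step unfolding V connected_graph_def by blast
qed

lemma image_all2:
  assumes "bij_betw f V W"
  shows "(`) f ` all2 V = all2 W"
proof (intro equalityI subsetI)
  have inj: "inj_on f V" and W: "W = f ` V" using assms by (auto simp: bij_betw_def)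
  fix e assume "e \<in> (`) f ` all2 V"
  then obtain a b where "e = {f a, f b}" "a \<noteq> b" "a \<in> V" "b \<in> V" by (auto simp: all2_def card_2_iff)
  then show "e \<in> all2 W" using inj W by (auto simp: all2_edge dest: inj_onD)
next
  have W: "W = f ` V" using assms by (auto simp: bij_betw_def)
  fix e assume "e \<in> all2 W"
  then obtain c d where "e = {c, d}" "c \<noteq> d" "c \<in> W" "d \<in> W" by (auto simp: all2_def card_2_iff)
  then obtain a b where ab: "e = f ` {a, b}" "a \<in> V" "b \<in> V" "a \<noteq> b" unfolding W by auto
  then have "{a, b} \<in> all2 V" by (simp add: all2_edge)
  then show "e \<in> (`) f ` all2 V" using ab(1) by blast
qed

lemma complete_all2: "complete_graph k = UGraph {..<k} (all2 {..<k})"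
proof -
  have "{{i, j} | i j. i < k \<and> j < k \<and> i \<noteq> j} = all2 {..<k}"
  proof (intro equalityI subsetI)
    fix e assume "e \<in> all2 {..<k}"
    then obtain i j where "e = {i, j}" "i \<noteq> j" "i \<in> {..<k}" "j \<in> {..<k}" by (auto simp: all2_def card_2_iff)
    then show "e \<in> {{i, j} | i j. i < k \<and> j < k \<and> i \<noteq> j}" by blast
  qed (auto simp: all2_edge)
  then show ?thesis by (simp add: complete_graph_def)
qed

lemma exc_iso:
  assumes "exc V E"
  shows "graph_iso (UGraph V E) (complete_graph 3) \<or> graph_iso (UGraph V E) K5_minus"
proof -
  have fin: "finite V" using assms by (auto simp: exc_def intro: card_ge_0_finite)
  from assms consider "card V = 3" "E = all2 V" | e where "card V = 5" "e \<in> all2 V" "E = all2 V - {e}"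
    unfolding exc_def by blast
  then show ?thesis
  proof cases
    case 1
    obtain f where f: "bij_betw f V {..<3::nat}"
      using finite_same_card_bij[OF fin, of "{..<3::nat}"] 1(1) by auto
    then have "graph_iso (UGraph V E) (complete_graph 3)"
      unfolding graph_iso_def complete_all2 using image_all2[OF f] 1(2) by auto
    then show ?thesis by blast
  next
    case 2
    then obtain a b where ab: "e = {a, b}" "a \<noteq> b" "a \<in> V" "b \<in> V" by (auto simp: all2_def card_2_iff)
    have "card (V - {a, b}) = card {2..<5::nat}" using 2(1) ab by (subst card_Diff_subset) auto
    then obtain h where h: "bij_betw h (V - {a, b}) {2..<5::nat}"
      using finite_same_card_bij[of "V - {a, b}"] fin by blast
    \<comment> \<open>The ends of the missing edge go to 0 and 1, the ends of the edge that
      \<open>K5_minus\<close> lacks.\<close>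
    define f where "f = (\<lambda>x. if x = a then 0 else if x = b then 1 else h x)"
    have "bij_betw f ({a, b} \<union> (V - {a, b})) ({0, 1} \<union> {2..<5})"
    proof (rule bij_betw_combine)
      show "bij_betw f {a, b} {0, 1}" using ab by (auto simp: f_def bij_betw_def)
      show "bij_betw f (V - {a, b}) {2..<5}"
        using h by (rule bij_betw_cong[THEN iffD1, rotated]) (auto simp: f_def)
    qed auto
    moreover have "{a, b} \<union> (V - {a, b}) = V" "{0, 1} \<union> {2..<5} = {..<5::nat}" using ab by auto
    ultimately have f: "bij_betw f V {..<5}" by simp
    have "f ` e = {0, 1}" using ab by (auto simp: f_def)
    moreover have "(`) f ` (all2 V - {e}) = (`) f ` all2 V - {f ` e}"
    proof -
      have "all2 V \<subseteq> Pow V" by (auto simp: all2_def)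
      then have "inj_on ((`) f) (all2 V)"
        using f inj_on_image_Pow[of f V] inj_on_subset unfolding bij_betw_def by blast
      then show ?thesis using 2(2) by (simp add: inj_on_image_set_diff[of _ "all2 V"])
    qed
    ultimately have "(`) f ` E = all2 {..<5} - {{0, 1}}" using image_all2[OF f] 2(3) by simp
    then have "graph_iso (UGraph V E) K5_minus"
      unfolding graph_iso_def K5_minus_def complete_all2 using f by (intro exI[of _ f]) simp
    then show ?thesis by blast
  qed
qed

lemma graph_iso_trans:
  assumes "graph_iso G H" "graph_iso H K"
  shows "graph_iso G K"
proof -
  obtain f where f: "bij_betw f (uverts G) (uverts H)" "uedges H = (`) f ` uedges G"
    using assms(1) unfolding graph_iso_def by (elim exE conjE)
  obtain g where g: "bij_betw g (uverts H) (uverts K)" "uedges K = (`) g ` uedges H"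
    using assms(2) unfolding graph_iso_def by (elim exE conjE)
  have "(`) g ` (`) f ` uedges G = (`) (g \<circ> f) ` uedges G"
    by (simp only: image_image o_def)
  then have "uedges K = (`) (g \<circ> f) ` uedges G" using f(2) g(2) by simp
  then show ?thesis
    unfolding graph_iso_def using bij_betw_trans[OF f(1) g(1)] by (intro exI conjI)
qed

theorem theorem3p2:
  fixes G :: "'a ugraph" and n :: nat
  assumes "simple_graph G"
    and "connected_graph G"
    and "partial_k_tree 3 G"
    and "card (uverts G) = n"
  shows "pn G \<le> n div 2 \<or> graph_iso G (complete_graph 3) \<or> graph_iso G K5_minus"
proof -
  obtain T :: "nat ugraph" and H where T: "k_tree 3 T" "subgraph H T" and iso: "graph_iso G H"
    using assms(3) by (auto simp: partial_k_tree_def)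
  obtain f where f: "bij_betw f (uverts G) (uverts H)" "uedges H = (`) f ` uedges G"
    using iso by (auto simp: graph_iso_def)
  have G2: "finite (uverts G)" "uedges G \<subseteq> all2 (uverts G)" using assms(1) by (simp_all add: simple_all2)
  have H: "finite (uverts H)" "uedges H \<subseteq> all2 (uverts H)" "uverts H \<subseteq> uverts T" "uedges H \<subseteq> uedges T"
    using T(2) by (auto simp: subgraph_def simple_all2)
  have c: "card (uverts H) = n" using bij_betw_same_card[OF f(1)] assms(4) by simp
  \<comment> \<open>The argument runs in the copy \<open>H\<close> over \<open>nat\<close>, where
    the 3-tree lives; the bound is then carried back along the inverse bijection.\<close>
  have "good (uverts H) (uedges T)" using good_mono[OF k_tree_good[OF T(1)] H(3)] .
  then have "pnle (uedges H) (card (uverts H) div 2) \<or> exc (uverts H) (uedges H)"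
    by (rule pnle_or_exc[OF H(1,2,4) _ conn_image[OF assms(2) f]])
  then show ?thesis
  proof
    assume p: "pnle (uedges H) (card (uverts H) div 2)"
    define g where "g = inv_into (uverts G) f"
    have g: "inj_on g (uverts H)" using bij_betw_inv_into[OF f(1)] by (simp add: g_def bij_betw_def)
    have "g ` f ` e = e" if "e \<in> uedges G" for e
    proof -
      have "e \<subseteq> uverts G" using that G2(2) by (auto simp: all2_def)
      then show ?thesis using f(1) by (simp add: g_def bij_betw_def inv_into_image_cancel)
    qed
    then have "(`) g ` uedges H = uedges G" unfolding f(2) by (force simp: image_image)
    then have "pnle (uedges G) (n div 2)" using pnle_image[OF H(2) g p] c by simp
    then show ?thesis using pn_le[OF G2(2,1)] by blast
  next
    assume "exc (uverts H) (uedges H)"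
    from exc_iso[OF this] have "graph_iso H (complete_graph 3) \<or> graph_iso H K5_minus" by simp
    then show ?thesis using graph_iso_trans[OF iso] by blast
  qed
qed

end
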